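(* Let $n,m\ge 1$ and let $f:\mathbb{R}^n\to\mathbb{R}^m$ be an entire smooth solution of the minimal surface system with graph $\Sigma=\{(x,f(x)):x\in\mathbb{R}^n\}\subset\mathbb{R}^{n+m}$. Suppose the following three conditions hold: 1) the normal bundle of $\Sigma$ is flat; 2) $\sqrt{\det(I+(df)^Tdf)}(x)=o\left(\sqrt{|x|^2+|f(x)|^2}\right)$ as $|x|\to\infty$; 3) there is a constant $c(n)$ such that $\mathrm{Vol}(\Sigma\cap B_R)\le c(n)R^n$ for all $R>0$, where $B_R$ is the ball of radius $R$ in $\mathbb{R}^{n+m}$ centered at the origin and $\mathrm{Vol}$ is the $n$-dimensional volume. Then $f$ is a linear map (i.e. affine: $\Sigma$ is an $n$-plane).
   Context: Minimal surface system: $f=(f^1,\dots,f^m)$ is a solution if $\sum_{i,j=1}^n\frac{\partial}{\partial x^i}\left(\sqrt{g}\,g^{ij}\frac{\partial f^\alpha}{\partial x^j}\right)=0$ for each $\alpha=1,\dots,m$, where $g_{ij}=\delta_{ij}+\sum_{\beta=1}^m\frac{\partial f^\beta}{\partial x^i}\frac{\partial f^\beta}{\partial x^j}$, $(g^{ij})=(g_{ij})^{-1}$ and $g=\det(g_{ij})$. The graph of a solution is a minimal submanifold of $\mathbb{R}^{n+m}$ of dimension $n$ and codimension $m$. Here $df$ is the Jacobian matrix of $f$, so $\det(I+(df)^Tdf)=g$. Flat normal bundle: near a point of $\Sigma$ choose an orthonormal frame $e_1,\dots,e_n$ of the tangent bundle and $e_{n+1},\dots,e_{n+m}$ of the normal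 bundle. The coefficients of the second fundamental form are $h_{\alpha ij}=\langle\nabla_{e_i}e_\alpha,e_j\rangle$, where $\nabla$ is the flat connection of $\mathbb{R}^{n+m}$. By the Ricci equation the curvature of the normal bundle is $R_{\alpha\beta ij}=\sum_{k}(h_{\alpha ik}h_{\beta jk}-h_{\alpha jk}h_{\beta ik})$. $\Sigma$ has flat normal bundle if $R_{\alpha\beta ij}\equiv 0$ for all $\alpha,\beta,i,j$. *)

theory Defs
  imports "HOL-Analysis.Analysis" "HOL-Library.Landau_Symbols"
begin

text \<open>
  Differentiability of class \<open>C\<^sup>k\<close> on an open subset of a Euclidean space: \<open>f\<close> is (Frechet)
  differentiable and each directional derivative is of class \<open>C\<^sup>k\<^sup>-\<^sup>1\<close>.  In finite dimension this
  agrees with the definition by operator-norm continuity of the iterated derivatives.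
\<close>

primrec Ck_on :: "nat \<Rightarrow> 'a::euclidean_space set \<Rightarrow> ('a \<Rightarrow> 'b::real_normed_vector) \<Rightarrow> bool" where
  "Ck_on 0 U f \<longleftrightarrow> continuous_on U f"
| "Ck_on (Suc k) U f \<longleftrightarrow>
     f differentiable_on U \<and> (\<forall>v. Ck_on k U (\<lambda>x. frechet_derivative f (at x) v))"

definition smooth_on :: "'a::euclidean_space set \<Rightarrow> ('a \<Rightarrow> 'b::real_normed_vector) \<Rightarrow> bool" where
  "smooth_on U f \<longleftrightarrow> (\<forall>k. Ck_on k U f)"

definition partial :: "'n \<Rightarrow> (real^'n \<Rightarrow> real) \<Rightarrow> real^'n \<Rightarrow> real" where
  "partial i u x = deriv (\<lambda>t. u (x + t *\<^sub>R axis i 1)) 0"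

definition metric :: "(real^'n \<Rightarrow> real^'m) \<Rightarrow> real^'n \<Rightarrow> real^'n^'n" where
  "metric f x = (\<chi> i j. (if i = j then 1 else 0) +
     (\<Sum>\<beta>\<in>UNIV. partial i (\<lambda>y. f y $ \<beta>) x * partial j (\<lambda>y. f y $ \<beta>) x))"

definition minimal_surface_system :: "(real^'n \<Rightarrow> real^'m) \<Rightarrow> bool" where
  "minimal_surface_system f \<longleftrightarrow>
     (\<forall>\<alpha> x. (\<Sum>i\<in>UNIV. \<Sum>j\<in>UNIV.
        partial i (\<lambda>y. sqrt (det (metric f y)) * matrix_inv (metric f y) $ i $ j
                        * partial j (\<lambda>z. f z $ \<alpha>) y) x) = 0)"

text \<open>The ambient space of dimension \<open>n + m\<close> is the Euclidean product of the two factors.\<close>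

definition graph_map :: "(real^'n \<Rightarrow> real^'m) \<Rightarrow> real^'n \<Rightarrow> (real^'n) \<times> (real^'m)" where
  "graph_map f x = (x, f x)"

definition graph_of :: "(real^'n \<Rightarrow> real^'m) \<Rightarrow> ((real^'n) \<times> (real^'m)) set" where
  "graph_of f = range (graph_map f)"

text \<open>Tangent and normal space of the graph at the point over \<open>x\<close>.\<close>

definition tangent_space :: "(real^'n \<Rightarrow> real^'m) \<Rightarrow> real^'n \<Rightarrow> ((real^'n) \<times> (real^'m)) set" where
  "tangent_space f x = range (frechet_derivative (graph_map f) (at x))"

definition normal_space :: "(real^'n \<Rightarrow> real^'m) \<Rightarrow> real^'n \<Rightarrow> ((real^'n) \<times> (real^'m)) set" where
  "normal_space f x = (tangent_space f x)\<^sup>\<bottom>"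

text \<open>
  Vector fields along the graph are written in the global chart \<open>graph_map f\<close>, i.e. as functions
  of the base point \<open>x\<close>.  \<open>T i\<close> stands for \<open>e\<^sub>i\<close> and \<open>N \<alpha>\<close> for \<open>e\<^sub>\<alpha>\<close>.
\<close>

definition adapted_frame ::
  "(real^'n \<Rightarrow> real^'m) \<Rightarrow> (real^'n) set \<Rightarrow>
   ('n \<Rightarrow> real^'n \<Rightarrow> (real^'n) \<times> (real^'m)) \<Rightarrow> ('m \<Rightarrow> real^'n \<Rightarrow> (real^'n) \<times> (real^'m)) \<Rightarrow> bool" where
  "adapted_frame f U T N \<longleftrightarrow>
     (\<forall>i. smooth_on U (T i)) \<and> (\<forall>\<alpha>. smooth_on U (N \<alpha>)) \<and>
     (\<forall>x\<in>U. (\<forall>i. T i x \<in> tangent_space f x) \<and> (\<forall>\<alpha>. N \<alpha> x \<in> normal_space f x) \<and>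
        (\<forall>i j. T i x \<bullet> T j x = (if i = j then 1 else 0)) \<and>
        (\<forall>\<alpha> \<beta>. N \<alpha> x \<bullet> N \<beta> x = (if \<alpha> = \<beta> then 1 else 0)))"

text \<open>
  The flat connection differentiates componentwise.  A tangent vector \<open>e\<close> of the graph is the image
  of \<open>fst e\<close> under the derivative of \<open>graph_map f\<close>, so that differentiating a field along the graph
  in the direction \<open>e\<close> means differentiating its chart expression in the direction \<open>fst e\<close>.
\<close>

definition flat_connection ::
  "(real^'n) \<times> (real^'m) \<Rightarrow> (real^'n \<Rightarrow> (real^'n) \<times> (real^'m)) \<Rightarrow> real^'n \<Rightarrow> (real^'n) \<times> (real^'m)" where
  "flat_connection e V x = frechet_derivative V (at x) (fst e)"

definition second_fundamental_coeff ::
  "('n \<Rightarrow> real^'n \<Rightarrow> (real^'n) \<times> (real^'m)) \<Rightarrow> ('m \<Rightarrow> real^'n \<Rightarrow> (real^'n) \<times> (real^'m)) \<Rightarrow>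
   'm \<Rightarrow> 'n \<Rightarrow> 'n \<Rightarrow> real^'n \<Rightarrow> real" where
  "second_fundamental_coeff T N \<alpha> i j x = flat_connection (T i x) (N \<alpha>) x \<bullet> T j x"

definition normal_curvature ::
  "('n \<Rightarrow> real^'n \<Rightarrow> (real^'n) \<times> (real^'m)) \<Rightarrow> ('m \<Rightarrow> real^'n \<Rightarrow> (real^'n) \<times> (real^'m)) \<Rightarrow>
   'm \<Rightarrow> 'm \<Rightarrow> 'n \<Rightarrow> 'n \<Rightarrow> real^'n \<Rightarrow> real" where
  "normal_curvature T N \<alpha> \<beta> i j x =
     (let h = second_fundamental_coeff T N in
      \<Sum>k\<in>UNIV. h \<alpha> i k x * h \<beta> j k x - h \<alpha> j k x * h \<beta> i k x)"

text \<open>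
  The vanishing of the curvature does not depend on the frame, so one frame around each point
  suffices.
\<close>

definition flat_normal_bundle :: "(real^'n \<Rightarrow> real^'m) \<Rightarrow> bool" where
  "flat_normal_bundle f \<longleftrightarrow>
     (\<forall>p. \<exists>U T N. open U \<and> p \<in> U \<and> adapted_frame f U T N \<and>
        (\<forall>\<alpha> \<beta> i j. \<forall>x\<in>U. normal_curvature T N \<alpha> \<beta> i j x = 0))"

text \<open>
  The Riemannian volume of a (Borel) subset \<open>A\<close> of the graph, computed in the global chart
  \<open>graph_map f\<close>, in which the volume form is \<open>sqrt g dx\<close>.
\<close>

definition graph_volume :: "(real^'n \<Rightarrow> real^'m) \<Rightarrow> ((real^'n) \<times> (real^'m)) set \<Rightarrow> ennreal" where
  "graph_volume f A =
     (\<integral>\<^sup>+x\<in>{x. graph_map f x \<in> A}. ennreal (sqrt (det (metric f x))) \<partial>lborel)"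

end

theory Submission
  imports Defs
begin

text \<open>
  The proof is a pointwise maximum principle.  Let \<open>g\<close> be the determinant of the metric, so that
  \<open>v = \<surd>g\<close> is the volume density, let \<open>A\<close> be the second fundamental form and \<open>n\<close> the dimension.
  If the normal bundle is flat, then
  \<open>\<Delta> ln v = |A|\<^sup>2 + |\<nabla> ln v|\<^sup>2\<close>, while the Simons identity and the refined Kato inequality give
  \<open>\<Delta> ln |A| \<ge> - |A|\<^sup>2 - (1 - 1/n) |\<nabla> ln |A||\<^sup>2\<close>.  Moreover \<open>\<Delta>|X - X\<^sub>0|\<^sup>2 = 2n\<close> for the position vector
  \<open>X\<close>.  Suppose \<open>g \<le> W/2\<close> on \<open>{|X - X\<^sub>0| \<le> R}\<close> and consider there a maximum point of
  \<open>|A|\<^sup>2 g (W + g) \<eta>\<^sup>2\<close> with \<open>\<eta> = R\<^sup>2 - |X - X\<^sub>0|\<^sup>2\<close>.  The three relations bound the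
  product by a constant times \<open>R\<^sup>2 W\<^sup>2\<close>, so \<open>|A|\<^sup>2 g\<close> at \<open>X\<^sub>0\<close> is at most a constant times
  \<open>W / R\<^sup>2\<close>.  The growth condition on \<open>v\<close> lets one choose \<open>W = o(R\<^sup>2)\<close>, and \<open>R \<rightarrow> \<infinity>\<close> yields
  \<open>A = 0\<close>.
\<close>

section \<open>Smooth functions and directional derivatives\<close>

text \<open>In the Laplacian of ln(|A|^2 g) the multiples of |A|^2 cancel exactly, so that product
  alone gives no estimate; the factor W + g restores a term r |A|^2 with r = g/(W + g). Since r may
  be very small, the surplus it leaves in the squared gradient of ln v cannot absorb the cross term
  with the gradient of the cutoff. The gain 1/n in the Kato inequality does this uniformly in r, and
  r drops out at the end because g (W + g) = r (W + g)^2. Flatness enters twice: it removes the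
  commutators of shape operators from the Simons identity, and it turns a crossed quadratic sum in
  the Laplacian of ln v into the squared gradient of ln v. Smooth orthonormal frames exist only
  locally and bring connection forms. Derivatives are therefore taken of globally defined ambient
  objects, chiefly the tangent projection, while frames are used at single points and carry no
  regularity.\<close>

definition dird :: "'a::euclidean_space \<Rightarrow> ('a \<Rightarrow> 'b::real_normed_vector) \<Rightarrow> 'a \<Rightarrow> 'b" where
  "dird h u x = frechet_derivative u (at x) h"

lemma Ck_on_Suc_imp: "Ck_on (Suc k) UNIV u \<Longrightarrow> Ck_on k UNIV u"
  by (induction k arbitrary: u) (auto intro: differentiable_imp_continuous_on)

lemma Ck_on_Suc_dird: "Ck_on (Suc k) UNIV u \<longleftrightarrow> (\<forall>x. u differentiable at x) \<and> (\<forall>h. Ck_on k UNIV (dird h u))"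
  by (simp add: differentiable_on_def dird_def[abs_def])

text \<open>This coinductive form removes the order counter: most later arguments need only one
  derivative and the smoothness of every \<open>dird h u\<close>.\<close>

lemma smooth_on_UNIV_iff:
  "smooth_on UNIV u \<longleftrightarrow> (\<forall>x. u differentiable at x) \<and> (\<forall>h. smooth_on UNIV (dird h u))"
proof
  assume "smooth_on UNIV u"
  then have "Ck_on (Suc k) UNIV u" for k
    unfolding smooth_on_def by blast
  then have "(\<forall>x. u differentiable at x) \<and> (\<forall>h. Ck_on k UNIV (dird h u))" for k
    unfolding Ck_on_Suc_dird by blast
  then show "(\<forall>x. u differentiable at x) \<and> (\<forall>h. smooth_on UNIV (dird h u))"
    unfolding smooth_on_def by blast
next
  assume "(\<forall>x. u differentiable at x) \<and> (\<forall>h. smooth_on UNIV (dird h u))"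
  then have "Ck_on (Suc k) UNIV u" for k
    unfolding smooth_on_def Ck_on_Suc_dird by blast
  then show "smooth_on UNIV u"
    unfolding smooth_on_def using Ck_on_Suc_imp by blast
qed

lemma smooth_dird: "smooth_on UNIV u \<Longrightarrow> smooth_on UNIV (dird h u)"
  by (simp add: smooth_on_UNIV_iff[of u])

lemma smooth_has_derivative: "smooth_on UNIV u \<Longrightarrow> (u has_derivative (\<lambda>h. dird h u x)) (at x)"
  unfolding dird_def by (simp add: smooth_on_UNIV_iff[of u] frechet_derivative_works[symmetric])

lemma differentiable_dird: "u differentiable at x \<Longrightarrow> (u has_derivative (\<lambda>h. dird h u x)) (at x)"
  unfolding dird_def using frechet_derivative_works by blast

lemma dird_eqI: "(u has_derivative u') (at x) \<Longrightarrow> dird h u x = u' h"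
  unfolding dird_def using frechet_derivative_at by metis

lemma smooth_continuous: "smooth_on UNIV u \<Longrightarrow> continuous_on UNIV u"
  unfolding smooth_on_def using Ck_on.simps(1) by blast

lemma dird_bounded_linear: "smooth_on UNIV u \<Longrightarrow> bounded_linear (\<lambda>h. dird h u x)"
  using smooth_has_derivative has_derivative_bounded_linear by blast

lemma Ck_const: "Ck_on k UNIV (\<lambda>x. c)"
  by (induction k arbitrary: c) (auto simp: differentiable_on_def)

lemma smooth_const [simp]: "smooth_on UNIV (\<lambda>x. c)"
  by (simp add: smooth_on_def Ck_const)

lemma dird_const [simp]: "dird h (\<lambda>x. c) x = 0"
  by (rule dird_eqI) simp

lemma Ck_bounded_linear: 
  assumes T: "bounded_linear T" 
  shows "Ck_on k UNIV u \<Longrightarrow> Ck_on k UNIV (\<lambda>x. T (u x))"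
proof (induction k arbitrary: u)
  case 0
  then show ?case using T by (auto intro: linear_continuous_on_compose bounded_linear.continuous_on)
next
  case (Suc k)
  have d: "u differentiable at x" for x using Suc.prems unfolding Ck_on_Suc_dird by blast
  have hd: "((\<lambda>x. T (u x)) has_derivative (\<lambda>h. T (dird h u x))) (at x)" for x
    unfolding dird_def using d frechet_derivative_works bounded_linear.has_derivative[OF T] by blast
  have "dird h (\<lambda>x. T (u x)) = (\<lambda>x. T (dird h u x))" for h
    using dird_eqI[OF hd] by blast
  then show ?case
    using Suc hd unfolding Ck_on_Suc_dird differentiable_def by auto
qed

lemma smooth_bounded_linear: "bounded_linear T \<Longrightarrow> smooth_on UNIV u \<Longrightarrow> smooth_on UNIV (\<lambda>x. T (u x))"
  by (simp add: smooth_on_def Ck_bounded_linear)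

lemma dird_linear: "bounded_linear T \<Longrightarrow> smooth_on UNIV u \<Longrightarrow> dird h (\<lambda>x. T (u x)) x = T (dird h u x)"
  by (rule dird_eqI[OF bounded_linear.has_derivative[OF _ smooth_has_derivative]])

lemma Ck_add: "Ck_on k UNIV u \<Longrightarrow> Ck_on k UNIV v \<Longrightarrow> Ck_on k UNIV (\<lambda>x. u x + v x)"
proof (induction k arbitrary: u v)
  case 0
  then show ?case by (auto intro: continuous_on_add)
next
  case (Suc k)
  have d: "u differentiable at x" "v differentiable at x" for x 
    using Suc.prems unfolding Ck_on_Suc_dird by auto
  have hd: "((\<lambda>x. u x + v x) has_derivative (\<lambda>h. dird h u x + dird h v x)) (at x)" for x
    by (intro has_derivative_add differentiable_dird d)
  have "dird h (\<lambda>x. u x + v x) = (\<lambda>x. dird h u x + dird h v x)" for h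
    using dird_eqI[OF hd] by blast
  moreover have "(\<lambda>x. u x + v x) differentiable at x" for x using hd differentiable_def by blast
  ultimately show ?case
    using Suc unfolding Ck_on_Suc_dird by simp
qed

text \<open>One statement covers products, inner products, scaling, evaluation and composition of
  operators. The Leibniz rule reproduces the shape with one factor undifferentiated;
  \<open>Ck_on_Suc_imp\<close> lowers the order of that factor.\<close>

lemma Ck_bilinear: 
  assumes B: "bounded_bilinear B"
  shows "Ck_on k UNIV u \<Longrightarrow> Ck_on k UNIV v \<Longrightarrow> Ck_on k UNIV (\<lambda>x. B (u x) (v x))"
proof (induction k arbitrary: u v)
  case 0
  then show ?case using B by (auto intro: bounded_bilinear.continuous_on)
next
  case (Suc k)
  have d: "u differentiable at x" "v differentiable at x" for x 
    using Suc.prems unfolding Ck_on_Suc_dird by auto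
  have hd: "((\<lambda>x. B (u x) (v x)) has_derivative (\<lambda>h. B (u x) (dird h v x) + B (dird h u x) (v x))) (at x)" for x
    by (intro bounded_bilinear.FDERIV[OF B] differentiable_dird d)
  have "dird h (\<lambda>x. B (u x) (v x)) = (\<lambda>x. B (u x) (dird h v x) + B (dird h u x) (v x))" for h
    using dird_eqI[OF hd] by blast
  moreover have "Ck_on k UNIV u" "Ck_on k UNIV v" using Suc.prems Ck_on_Suc_imp by blast+
  moreover have "(\<lambda>x. B (u x) (v x)) differentiable at x" for x using hd differentiable_def by blast
  ultimately show ?case
    using Suc unfolding Ck_on_Suc_dird by (simp add: Ck_add)
qed

lemma smooth_add: "smooth_on UNIV u \<Longrightarrow> smooth_on UNIV v \<Longrightarrow> smooth_on UNIV (\<lambda>x. u x + v x)"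
  by (simp add: smooth_on_def Ck_add)

lemma smooth_minus: "smooth_on UNIV u \<Longrightarrow> smooth_on UNIV (\<lambda>x. - u x)"
  using smooth_bounded_linear[OF bounded_linear_minus[OF bounded_linear_ident]] .

lemma smooth_diff: "smooth_on UNIV u \<Longrightarrow> smooth_on UNIV v \<Longrightarrow> smooth_on UNIV (\<lambda>x. u x - v x)"
  unfolding diff_conv_add_uminus by (intro smooth_add smooth_minus)

lemma smooth_sum: "(\<And>i. i \<in> I \<Longrightarrow> smooth_on UNIV (u i)) \<Longrightarrow> smooth_on UNIV (\<lambda>x. \<Sum>i\<in>I. u i x)"
  by (induction I rule: infinite_finite_induct) (simp_all add: smooth_add)

lemma smooth_bilinear: 
  "bounded_bilinear B \<Longrightarrow> smooth_on UNIV u \<Longrightarrow> smooth_on UNIV v \<Longrightarrow> smooth_on UNIV (\<lambda>x. B (u x) (v x))"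
  by (simp add: smooth_on_def Ck_bilinear)

lemmas smooth_inner = smooth_bilinear[OF bounded_bilinear_inner]
lemmas smooth_scaleR = smooth_bilinear[OF bounded_bilinear_scaleR]
lemmas smooth_mult = smooth_bilinear[OF bounded_bilinear_mult]
lemmas smooth_blinfun_apply = smooth_bilinear[OF bounded_bilinear_blinfun_apply]

lemma smooth_ident [simp]: "smooth_on UNIV (\<lambda>x. x)"
proof -
  have "dird h (\<lambda>x. x) = (\<lambda>x. h)" for h :: 'a
    using dird_eqI[OF has_derivative_ident] by blast
  then show ?thesis by (subst smooth_on_UNIV_iff) simp
qed

lemmas smooth_intros = smooth_add smooth_minus smooth_diff smooth_sum smooth_inner smooth_scaleR
  smooth_mult smooth_blinfun_apply smooth_dird smooth_const smooth_ident

lemma dird_add: "smooth_on UNIV u \<Longrightarrow> smooth_on UNIV v \<Longrightarrow> 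
    dird h (\<lambda>x. u x + v x) x = dird h u x + dird h v x"
  by (rule dird_eqI) (intro has_derivative_add smooth_has_derivative)

lemma dird_minus: "smooth_on UNIV u \<Longrightarrow> dird h (\<lambda>x. - u x) x = - dird h u x"
  by (rule dird_eqI) (intro has_derivative_minus smooth_has_derivative)

lemma dird_diff: "smooth_on UNIV u \<Longrightarrow> smooth_on UNIV v \<Longrightarrow> 
    dird h (\<lambda>x. u x - v x) x = dird h u x - dird h v x"
  by (rule dird_eqI) (intro has_derivative_diff smooth_has_derivative)

lemma dird_sum: "(\<And>i. i \<in> I \<Longrightarrow> smooth_on UNIV (u i)) \<Longrightarrow> 
    dird h (\<lambda>x. \<Sum>i\<in>I. u i x) x = (\<Sum>i\<in>I. dird h (u i) x)"
  by (rule dird_eqI) (intro has_derivative_sum smooth_has_derivative)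

lemma dird_bilinear: "bounded_bilinear B \<Longrightarrow> smooth_on UNIV u \<Longrightarrow> smooth_on UNIV v \<Longrightarrow> 
    dird h (\<lambda>x. B (u x) (v x)) x = B (u x) (dird h v x) + B (dird h u x) (v x)"
  by (rule dird_eqI) (intro bounded_bilinear.FDERIV smooth_has_derivative)

lemmas dird_inner = dird_bilinear[OF bounded_bilinear_inner]
lemmas dird_scaleR = dird_bilinear[OF bounded_bilinear_scaleR]
lemmas dird_mult = dird_bilinear[OF bounded_bilinear_mult]
lemmas dird_blinfun_apply = dird_bilinear[OF bounded_bilinear_blinfun_apply]

lemma dird_linear_combination:
  assumes "smooth_on UNIV u"
  shows "dird h u x = (\<Sum>i\<in>Basis. (h \<bullet> i) *\<^sub>R dird i u x)"
proof -
  interpret bounded_linear "\<lambda>h. dird h u x" using dird_bounded_linear[OF assms] .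
  have "dird h u x = dird (\<Sum>i\<in>Basis. (h \<bullet> i) *\<^sub>R i) u x" by (simp add: euclidean_representation)
  then show ?thesis by (simp add: sum scaleR)
qed

text \<open>The direction varies with the point, so it is expanded in constant directions with
  smooth coefficients \<open>w x \<bullet> i\<close>.\<close>

lemma smooth_dird_field:
  assumes "smooth_on UNIV u" "smooth_on UNIV w"
  shows "smooth_on UNIV (\<lambda>x. dird (w x) u x)"
proof -
  have "(\<lambda>x. dird (w x) u x) = (\<lambda>x. \<Sum>i\<in>Basis. (w x \<bullet> i) *\<^sub>R dird i u x)"
    using dird_linear_combination[OF assms(1)] by blast
  then show ?thesis using assms by (auto intro!: smooth_intros)
qed

lemma dird_dird_field:
  assumes "smooth_on UNIV u" "smooth_on UNIV w"
  shows "dird h (\<lambda>x. dird (w x) u x) x = dird h (dird (w x) u) x + dird (dird h w x) u x"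
proof -
  have "(\<lambda>x. dird (w x) u x) = (\<lambda>x. \<Sum>i\<in>Basis. (w x \<bullet> i) *\<^sub>R dird i u x)"
    using dird_linear_combination[OF assms(1)] by blast
  then have "dird h (\<lambda>x. dird (w x) u x) x
      = (\<Sum>i\<in>Basis. (w x \<bullet> i) *\<^sub>R dird h (dird i u) x + (dird h w x \<bullet> i) *\<^sub>R dird i u x)"
    using assms by (simp add: dird_sum dird_scaleR dird_inner smooth_intros)
  moreover have "dird h (dird (w x) u) x = (\<Sum>i\<in>Basis. (w x \<bullet> i) *\<^sub>R dird h (dird i u) x)"
  proof -
    have "dird (w x) u = (\<lambda>y. \<Sum>i\<in>Basis. (w x \<bullet> i) *\<^sub>R dird i u y)"
      using dird_linear_combination[OF assms(1)] by blast
    then show ?thesis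
      using assms by (simp add: dird_sum dird_scaleR smooth_intros)
  qed
  moreover have "dird (dird h w x) u x = (\<Sum>i\<in>Basis. (dird h w x \<bullet> i) *\<^sub>R dird i u x)"
    using dird_linear_combination[OF assms(1)] by blast
  ultimately show ?thesis by (simp add: sum.distrib)
qed

section \<open>Symmetry of second directional derivatives\<close>

lemma smooth_has_real_derivative_line:
  fixes u :: "'a::euclidean_space \<Rightarrow> real"
  assumes "smooth_on UNIV u"
  shows "((\<lambda>s. u (x + s *\<^sub>R h)) has_real_derivative dird h u (x + s *\<^sub>R h)) (at s)"
proof -
  have "((\<lambda>s. u (x + s *\<^sub>R h)) has_derivative (\<lambda>r. dird (r *\<^sub>R h) u (x + s *\<^sub>R h))) (at s)"
    by (rule has_derivative_compose[OF _ smooth_has_derivative[OF assms]])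
      (auto intro!: derivative_eq_intros)
  moreover have "dird (r *\<^sub>R h) u y = r * dird h u y" for r y
    using linear_simps(5)[OF dird_bounded_linear[OF assms, of y]] by simp
  ultimately show ?thesis by (simp add: has_field_derivative_def mult_commute_abs)
qed

text \<open>The mean value theorem is applied twice, along \<open>h\<close> and then along
  \<open>k\<close>. The left side is symmetric in \<open>h\<close> and \<open>k\<close> and the
  right side is not, which forces the mixed derivatives to agree in the limit.\<close>

lemma second_difference:
  fixes u :: "'a::euclidean_space \<Rightarrow> real"
  assumes "smooth_on UNIV u" "t > 0"
  obtains s r where "0 < s" "s < t" "0 < r" "r < t"
    "u (x + t *\<^sub>R h + t *\<^sub>R k) - u (x + t *\<^sub>R h) - u (x + t *\<^sub>R k) + u x
       = t * t * dird k (dird h u) (x + s *\<^sub>R h + r *\<^sub>R k)"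
proof -
  define \<phi> where "\<phi> s = u ((x + t *\<^sub>R k) + s *\<^sub>R h) - u (x + s *\<^sub>R h)" for s
  have "(\<phi> has_real_derivative (dird h u ((x + t *\<^sub>R k) + s *\<^sub>R h) - dird h u (x + s *\<^sub>R h))) (at s)" for s
    unfolding \<phi>_def by (intro DERIV_diff smooth_has_real_derivative_line assms)
  from MVT2[OF assms(2), of \<phi>, OF this] obtain s where
    s: "0 < s" "s < t" "\<phi> t - \<phi> 0 = (t - 0) * (dird h u ((x + t *\<^sub>R k) + s *\<^sub>R h) - dird h u (x + s *\<^sub>R h))"
    by blast
  have "((\<lambda>r. dird h u ((x + s *\<^sub>R h) + r *\<^sub>R k)) has_real_derivative dird k (dird h u) ((x + s *\<^sub>R h) + r *\<^sub>R k)) (at r)" for r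
    by (intro smooth_has_real_derivative_line smooth_intros assms)
  from MVT2[OF assms(2), of "\<lambda>r. dird h u ((x + s *\<^sub>R h) + r *\<^sub>R k)", OF this] obtain r where
    r: "0 < r" "r < t" "dird h u ((x + s *\<^sub>R h) + t *\<^sub>R k) - dird h u (x + s *\<^sub>R h)
       = t * dird k (dird h u) ((x + s *\<^sub>R h) + r *\<^sub>R k)" by auto
  show ?thesis
    using that[OF s(1,2) r(1,2)] s(3) r(3) by (simp add: \<phi>_def add_ac)
qed

lemma tendsto_of_small:
  fixes q :: "'a::euclidean_space \<Rightarrow> real"
  assumes "continuous_on UNIV q" "\<And>n. norm (y n - x) \<le> c / real (Suc n)"
  shows "(\<lambda>n. q (y n)) \<longlonglongrightarrow> q x"
proof -
  have "(\<lambda>n. c / real (Suc n)) \<longlonglongrightarrow> 0"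
    by (rule LIMSEQ_Suc) (rule lim_const_over_n)
  then have "(\<lambda>n. y n - x) \<longlonglongrightarrow> 0"
    using assms(2) by (intro Lim_null_comparison[of "\<lambda>n. y n - x" "\<lambda>n. c / real (Suc n)"] always_eventually) auto
  then have "y \<longlonglongrightarrow> x" by (simp add: LIM_zero_iff)
  then show ?thesis
    using assms(1) by (intro isCont_tendsto_compose[of _ q]) (auto simp: continuous_on_eq_continuous_at)
qed

lemma dird_dird_commute_real:
  fixes u :: "'a::euclidean_space \<Rightarrow> real"
  assumes u: "smooth_on UNIV u"
  shows "dird k (dird h u) x = dird h (dird k u) x"
proof -
  define t where "t n = 1 / real (Suc n)" for n
  have t: "t n > 0" for n by (simp add: t_def)
  have "\<exists>y. norm (y - x) \<le> (norm h + norm k) / real (Suc n) \<and> 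
      u (x + t n *\<^sub>R h + t n *\<^sub>R k) - u (x + t n *\<^sub>R h) - u (x + t n *\<^sub>R k) + u x
       = t n * t n * dird k (dird h u) y" for h k n
  proof -
    obtain s r where sr: "0 < s" "s < t n" "0 < r" "r < t n"
    "u (x + t n *\<^sub>R h + t n *\<^sub>R k) - u (x + t n *\<^sub>R h) - u (x + t n *\<^sub>R k) + u x
       = t n * t n * dird k (dird h u) (x + s *\<^sub>R h + r *\<^sub>R k)"
      using second_difference[OF u t] by metis
    have "norm (x + s *\<^sub>R h + r *\<^sub>R k - x) \<le> norm (s *\<^sub>R h) + norm (r *\<^sub>R k)"
      by (metis add.assoc add_diff_cancel_left' norm_triangle_ineq)
    also have "\<dots> = s * norm h + r * norm k" using sr by simp
    also have "\<dots> \<le> t n * norm h + t n * norm k" 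
      using sr by (intro add_mono mult_right_mono) auto
    also have "\<dots> = (norm h + norm k) / real (Suc n)" by (simp add: t_def add_divide_distrib)
    finally show ?thesis using sr(5) by blast
  qed
  note ex = this
  obtain y where y: "\<And>n. norm (y n - x) \<le> (norm h + norm k) / real (Suc n)"
     "\<And>n. u (x + t n *\<^sub>R h + t n *\<^sub>R k) - u (x + t n *\<^sub>R h) - u (x + t n *\<^sub>R k) + u x
       = t n * t n * dird k (dird h u) (y n)" using ex[of h k] by metis
  obtain z where z: "\<And>n. norm (z n - x) \<le> (norm k + norm h) / real (Suc n)"
     "\<And>n. u (x + t n *\<^sub>R k + t n *\<^sub>R h) - u (x + t n *\<^sub>R k) - u (x + t n *\<^sub>R h) + u x
       = t n * t n * dird h (dird k u) (z n)" using ex[of k h] by metis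
  have "t n * t n * dird k (dird h u) (y n) = t n * t n * dird h (dird k u) (z n)" for n
    using y(2)[of n] z(2)[of n] by (simp add: algebra_simps)
  then have eq: "dird k (dird h u) (y n) = dird h (dird k u) (z n)" for n
    using t[of n] by (simp del: of_nat_Suc) (metis less_irrefl)
  have "(\<lambda>n. dird k (dird h u) (y n)) \<longlonglongrightarrow> dird k (dird h u) x"
    by (rule tendsto_of_small[OF _ y(1)]) (intro smooth_continuous smooth_intros u)
  moreover have "(\<lambda>n. dird h (dird k u) (z n)) \<longlonglongrightarrow> dird h (dird k u) x"
    by (rule tendsto_of_small[OF _ z(1)]) (intro smooth_continuous smooth_intros u)
  ultimately show ?thesis using eq LIMSEQ_unique by auto
qed

lemma dird_dird_linear:
  assumes "bounded_linear T" "smooth_on UNIV u"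
  shows "dird k (dird h (\<lambda>x. T (u x))) x = T (dird k (dird h u) x)"
proof -
  have "dird h (\<lambda>x. T (u x)) = (\<lambda>x. T (dird h u x))" using dird_linear[OF assms] by blast
  then show ?thesis using assms by (simp add: dird_linear smooth_dird)
qed

lemma dird_dird_commute:
  fixes u :: "'a::euclidean_space \<Rightarrow> 'b::euclidean_space"
  assumes u: "smooth_on UNIV u"
  shows "dird k (dird h u) x = dird h (dird k u) x"
proof (rule euclidean_eqI)
  fix b :: 'b
  have "dird k (dird h (\<lambda>x. u x \<bullet> b)) x = dird h (dird k (\<lambda>x. u x \<bullet> b)) x"
    by (rule dird_dird_commute_real) (intro smooth_intros u)
  then show "dird k (dird h u) x \<bullet> b = dird h (dird k u) x \<bullet> b"
    by (simp only: dird_dird_linear[OF bounded_linear_inner_left u])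
qed

lemma bounded_linear_blinfun_apply_left: "bounded_linear (\<lambda>w. blinfun_apply w b)"
  by (rule bounded_bilinear.bounded_linear_left[OF bounded_bilinear_blinfun_apply])

text \<open>Evaluation at a vector reduces the operator-valued case to the vector-valued
  one.\<close>

lemma dird_dird_commute_blinfun:
  fixes u :: "'a::euclidean_space \<Rightarrow> 'v::euclidean_space \<Rightarrow>\<^sub>L 'b::euclidean_space"
  assumes u: "smooth_on UNIV u"
  shows "dird k (dird h u) x = dird h (dird k u) x"
proof (rule blinfun_eqI)
  fix b :: 'v
  have "dird k (dird h (\<lambda>x. blinfun_apply (u x) b)) x = dird h (dird k (\<lambda>x. blinfun_apply (u x) b)) x"
    by (rule dird_dird_commute) (intro smooth_intros u)
  then show "blinfun_apply (dird k (dird h u) x) b = blinfun_apply (dird h (dird k u) x) b"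
    by (simp only: dird_dird_linear[OF bounded_linear_blinfun_apply_left u])
qed

section \<open>Algebra of the second fundamental form\<close>

lemma sum_UNIV_prod:
  fixes f :: "'a::finite \<times> 'b::finite \<Rightarrow> 'c::comm_monoid_add"
  shows "(\<Sum>q\<in>UNIV. f q) = (\<Sum>a\<in>UNIV. \<Sum>b\<in>UNIV. f (a, b))"
  by (simp add: sum.cartesian_product)

lemma sum_mult_exchange:
  fixes F G K L :: "'a \<Rightarrow> 'b \<Rightarrow> real"
  shows "(\<Sum>b\<in>S. \<Sum>c\<in>T. (\<Sum>v\<in>U. F v b * G v c) * (\<Sum>w\<in>V. K w b * L w c))
    = (\<Sum>v\<in>U. \<Sum>w\<in>V. (\<Sum>b\<in>S. F v b * K w b) * (\<Sum>c\<in>T. G v c * L w c))"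
proof -
  have "(\<Sum>b\<in>S. \<Sum>c\<in>T. (\<Sum>v\<in>U. F v b * G v c) * (\<Sum>w\<in>V. K w b * L w c))
    = (\<Sum>b\<in>S. \<Sum>c\<in>T. \<Sum>v\<in>U. \<Sum>w\<in>V. (F v b * K w b) * (G v c * L w c))"
    by (simp add: sum_product mult_ac)
  also have "\<dots> = (\<Sum>b\<in>S. \<Sum>v\<in>U. \<Sum>c\<in>T. \<Sum>w\<in>V. (F v b * K w b) * (G v c * L w c))"
    by (rule sum.cong[OF refl], rule sum.swap)
  also have "\<dots> = (\<Sum>v\<in>U. \<Sum>b\<in>S. \<Sum>c\<in>T. \<Sum>w\<in>V. (F v b * K w b) * (G v c * L w c))"
    by (rule sum.swap)
  also have "\<dots> = (\<Sum>v\<in>U. \<Sum>b\<in>S. \<Sum>w\<in>V. \<Sum>c\<in>T. (F v b * K w b) * (G v c * L w c))"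
    by (rule sum.cong[OF refl], rule sum.cong[OF refl], rule sum.swap)
  also have "\<dots> = (\<Sum>v\<in>U. \<Sum>w\<in>V. \<Sum>b\<in>S. \<Sum>c\<in>T. (F v b * K w b) * (G v c * L w c))"
    by (rule sum.cong[OF refl], rule sum.swap)
  also have "\<dots> = (\<Sum>v\<in>U. \<Sum>w\<in>V. (\<Sum>b\<in>S. F v b * K w b) * (\<Sum>c\<in>T. G v c * L w c))"
    by (simp add: sum_product)
  finally show ?thesis .
qed

text \<open>For the matrix F with entries \<open>f v b\<close> the Gram matrices of rows and of
  columns have the same Frobenius norm. Different groupings of the indices of a second fundamental
  form turn this into the quartic identities below.\<close>

lemma gram_exchange:
  fixes f :: "'a \<Rightarrow> 'b \<Rightarrow> real"
  shows "(\<Sum>b\<in>S. \<Sum>c\<in>S. (\<Sum>v\<in>U. f v b * f v c)\<^sup>2) = (\<Sum>v\<in>U. \<Sum>w\<in>U. (\<Sum>b\<in>S. f v b * f w b)\<^sup>2)"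
  unfolding power2_eq_square by (rule sum_mult_exchange)

text \<open>\<open>H \<alpha>\<close> is the shape operator in the normal direction \<alpha> at one
  point. \<open>H_flat\<close> is the Ricci equation with vanishing normal curvature: given
  \<open>H_sym\<close>, it says that any two shape operators commute.\<close>

locale second_form =
  fixes H :: "'j::finite \<Rightarrow> 'i::finite \<Rightarrow> 'i \<Rightarrow> real"
  assumes H_sym: "H \<alpha> i k = H \<alpha> k i"
    and H_trace: "(\<Sum>i\<in>UNIV. H \<alpha> i i) = 0"
    and H_flat: "(\<Sum>k\<in>UNIV. H \<alpha> i k * H \<beta> j k) = (\<Sum>k\<in>UNIV. H \<alpha> j k * H \<beta> i k)"
begin

text \<open>\<open>ss\<close> is the sum of the squared shape operators, by the Gauss equation minus
  the Ricci tensor; \<open>nn\<close> is their Gram matrix and \<open>ee\<close> is |A|^2. The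
  squared Frobenius norms \<open>s2\<close> and \<open>n2\<close> are the quartic invariants that
  occur.\<close>

definition ss :: "'i \<Rightarrow> 'i \<Rightarrow> real" where "ss k l = (\<Sum>i\<in>UNIV. \<Sum>\<alpha>\<in>UNIV. H \<alpha> i k * H \<alpha> i l)"
definition nn :: "'j \<Rightarrow> 'j \<Rightarrow> real" where "nn \<alpha> \<beta> = (\<Sum>i\<in>UNIV. \<Sum>k\<in>UNIV. H \<alpha> i k * H \<beta> i k)"
definition ee :: real where "ee = (\<Sum>\<alpha>\<in>UNIV. nn \<alpha> \<alpha>)"
definition s2 :: real where "s2 = (\<Sum>k\<in>UNIV. \<Sum>l\<in>UNIV. (ss k l)\<^sup>2)"
definition n2 :: real where "n2 = (\<Sum>\<alpha>\<in>UNIV. \<Sum>\<beta>\<in>UNIV. (nn \<alpha> \<beta>)\<^sup>2)"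

text \<open>Cauchy-Schwarz for the entries of the Gram matrix \<open>nn\<close>. In the Simons
  identity \<open>n2\<close> is the whole quartic term, so this is the source of the bound by
  |A|^4.\<close>

lemma n2_le: "n2 \<le> ee\<^sup>2"
proof -
  have nn: "nn \<alpha> \<beta> = (\<Sum>q\<in>UNIV. H \<alpha> (fst q) (snd q) * H \<beta> (fst q) (snd q))" for \<alpha> \<beta>
    by (simp add: nn_def sum_UNIV_prod)
  have "(nn \<alpha> \<beta>)\<^sup>2 \<le> nn \<alpha> \<alpha> * nn \<beta> \<beta>" for \<alpha> \<beta>
    unfolding nn using Cauchy_Schwarz_ineq_sum[of "\<lambda>q. H \<alpha> (fst q) (snd q)" "\<lambda>q. H \<beta> (fst q) (snd q)" UNIV]
    by (simp add: power2_eq_square)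
  then have "n2 \<le> (\<Sum>\<alpha>\<in>UNIV. \<Sum>\<beta>\<in>UNIV. nn \<alpha> \<alpha> * nn \<beta> \<beta>)"
    unfolding n2_def by (intro sum_mono) auto
  also have "\<dots> = ee\<^sup>2" by (simp add: ee_def power2_eq_square sum_product)
  finally show ?thesis .
qed

text \<open>\<open>H\<close> is read as a matrix with rows (a, \<alpha>) and columns c; its two Gram
  matrices are the products of shape operators and \<open>ss\<close>.\<close>

lemma sum_cross_squares:
  "(\<Sum>a\<in>UNIV. \<Sum>d\<in>UNIV. \<Sum>\<alpha>\<in>UNIV. \<Sum>\<beta>\<in>UNIV. (\<Sum>c\<in>UNIV. H \<alpha> a c * H \<beta> d c)\<^sup>2) = s2"
proof -
  let ?f = "\<lambda>c q. H (snd q) (fst q) c"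
  have "s2 = (\<Sum>k\<in>UNIV. \<Sum>l\<in>UNIV. (\<Sum>q\<in>UNIV. ?f k q * ?f l q)\<^sup>2)"
    by (simp add: s2_def ss_def sum_UNIV_prod)
  also have "\<dots> = (\<Sum>p\<in>UNIV. \<Sum>q\<in>UNIV. (\<Sum>c\<in>UNIV. ?f c p * ?f c q)\<^sup>2)"
    by (rule gram_exchange[symmetric])
  also have "\<dots> = (\<Sum>a\<in>UNIV. \<Sum>\<alpha>\<in>UNIV. \<Sum>d\<in>UNIV. \<Sum>\<beta>\<in>UNIV. (\<Sum>c\<in>UNIV. H \<alpha> a c * H \<beta> d c)\<^sup>2)"
    by (simp add: sum_UNIV_prod)
  also have "\<dots> = (\<Sum>a\<in>UNIV. \<Sum>d\<in>UNIV. \<Sum>\<alpha>\<in>UNIV. \<Sum>\<beta>\<in>UNIV. (\<Sum>c\<in>UNIV. H \<alpha> a c * H \<beta> d c)\<^sup>2)"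
    by (rule sum.cong[OF refl], rule sum.swap)
  finally show ?thesis by simp
qed

text \<open>This is the squared norm of the tangential block of the second derivatives of the
  projection, see \<open>B_tt\<close>. Each pure square gives \<open>n2\<close>, with
  \<open>H\<close> read as a matrix with rows \<alpha> and columns (i, k); the mixed product equals
  \<open>s2\<close> by flatness.\<close>

lemma sum_tangential_squares:
  "(\<Sum>d\<in>UNIV. \<Sum>a\<in>UNIV. \<Sum>b\<in>UNIV. \<Sum>c\<in>UNIV.
      ((\<Sum>\<alpha>\<in>UNIV. H \<alpha> a b * H \<alpha> d c) + (\<Sum>\<alpha>\<in>UNIV. H \<alpha> d b * H \<alpha> a c))\<^sup>2) = 2 * n2 + 2 * s2"
proof -
  define x where "x a b d c = (\<Sum>\<alpha>\<in>UNIV. H \<alpha> a b * H \<alpha> d c)" for a b d c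
  have n: "(\<Sum>d\<in>UNIV. \<Sum>a\<in>UNIV. \<Sum>b\<in>UNIV. \<Sum>c\<in>UNIV. (x d b a c)\<^sup>2) = n2"
  proof -
    let ?f = "\<lambda>\<alpha> q. H \<alpha> (fst q) (snd q)"
    have "n2 = (\<Sum>\<alpha>\<in>UNIV. \<Sum>\<beta>\<in>UNIV. (\<Sum>q\<in>UNIV. ?f \<alpha> q * ?f \<beta> q)\<^sup>2)"
      by (simp add: n2_def nn_def sum_UNIV_prod)
    also have "\<dots> = (\<Sum>p\<in>UNIV. \<Sum>q\<in>UNIV. (\<Sum>\<alpha>\<in>UNIV. ?f \<alpha> p * ?f \<alpha> q)\<^sup>2)"
      by (rule gram_exchange[symmetric])
    also have "\<dots> = (\<Sum>d\<in>UNIV. \<Sum>b\<in>UNIV. \<Sum>a\<in>UNIV. \<Sum>c\<in>UNIV. (x d b a c)\<^sup>2)"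
      by (simp add: sum_UNIV_prod x_def)
    also have "\<dots> = (\<Sum>d\<in>UNIV. \<Sum>a\<in>UNIV. \<Sum>b\<in>UNIV. \<Sum>c\<in>UNIV. (x d b a c)\<^sup>2)"
      by (rule sum.cong[OF refl], rule sum.swap)
    finally show ?thesis by simp
  qed
  have n': "(\<Sum>d\<in>UNIV. \<Sum>a\<in>UNIV. \<Sum>b\<in>UNIV. \<Sum>c\<in>UNIV. (x a b d c)\<^sup>2) = n2"
    by (subst sum.swap) (rule n)
  have "(\<Sum>d\<in>UNIV. \<Sum>a\<in>UNIV. \<Sum>b\<in>UNIV. \<Sum>c\<in>UNIV. x a b d c * x d b a c)
      = (\<Sum>d\<in>UNIV. \<Sum>a\<in>UNIV. \<Sum>\<alpha>\<in>UNIV. \<Sum>\<beta>\<in>UNIV. 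
          (\<Sum>b\<in>UNIV. H \<alpha> a b * H \<beta> d b) * (\<Sum>c\<in>UNIV. H \<alpha> d c * H \<beta> a c))"
    unfolding x_def by (intro sum.cong refl sum_mult_exchange)
  also have "\<dots> = (\<Sum>d\<in>UNIV. \<Sum>a\<in>UNIV. \<Sum>\<alpha>\<in>UNIV. \<Sum>\<beta>\<in>UNIV. (\<Sum>c\<in>UNIV. H \<alpha> d c * H \<beta> a c)\<^sup>2)"
    by (intro sum.cong refl) (subst H_flat, simp add: power2_eq_square)
  finally have s: "(\<Sum>d\<in>UNIV. \<Sum>a\<in>UNIV. \<Sum>b\<in>UNIV. \<Sum>c\<in>UNIV. x a b d c * x d b a c) = s2"
    by (simp add: sum_cross_squares)
  have "(\<Sum>d\<in>UNIV. \<Sum>a\<in>UNIV. \<Sum>b\<in>UNIV. \<Sum>c\<in>UNIV. (x a b d c + x d b a c)\<^sup>2)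
      = (\<Sum>d\<in>UNIV. \<Sum>a\<in>UNIV. \<Sum>b\<in>UNIV. \<Sum>c\<in>UNIV. (x a b d c)\<^sup>2) 
      + (\<Sum>d\<in>UNIV. \<Sum>a\<in>UNIV. \<Sum>b\<in>UNIV. \<Sum>c\<in>UNIV. (x d b a c)\<^sup>2) 
      + 2 * (\<Sum>d\<in>UNIV. \<Sum>a\<in>UNIV. \<Sum>b\<in>UNIV. \<Sum>c\<in>UNIV. x a b d c * x d b a c)"
    by (simp add: power2_sum sum.distrib sum_distrib_left mult.assoc)
  then show ?thesis unfolding n n' s by (simp add: x_def)
qed

text \<open>The corresponding norm of the normal block, see \<open>B_nn\<close>. Since shape
  operators commute, the two summands are equal.\<close>

lemma sum_normal_squares:
  "(\<Sum>d\<in>UNIV. \<Sum>a\<in>UNIV. \<Sum>\<alpha>\<in>UNIV. \<Sum>\<beta>\<in>UNIV.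
      ((\<Sum>c\<in>UNIV. H \<alpha> a c * H \<beta> d c) + (\<Sum>c\<in>UNIV. H \<alpha> d c * H \<beta> a c))\<^sup>2) = 4 * s2"
proof -
  have "((\<Sum>c\<in>UNIV. H \<alpha> a c * H \<beta> d c) + (\<Sum>c\<in>UNIV. H \<alpha> d c * H \<beta> a c))\<^sup>2 
      = 4 * (\<Sum>c\<in>UNIV. H \<alpha> d c * H \<beta> a c)\<^sup>2" for \<alpha> \<beta> a d
    by (subst H_flat) (simp add: power2_eq_square)
  then show ?thesis using sum_cross_squares by (simp add: sum_distrib_left[symmetric])
qed

lemma ss_sym: "ss k l = ss l k" by (simp add: ss_def mult.commute)

text \<open>The factor next to \<open>H \<alpha> k l\<close> is the normal component of a derivative
  of the Laplacian of the projection, see \<open>sum_C_normal\<close>. Of its four cubic sums two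
  cancel; the others, M and N, contract with \<open>H\<close> to \<open>s2\<close> and
  \<open>n2\<close>, and 2(M - N) - 4M = -2M - 2N.\<close>

lemma sum_derivative_terms:
  "(\<Sum>k\<in>UNIV. \<Sum>l\<in>UNIV. \<Sum>\<alpha>\<in>UNIV. H \<alpha> k l *
      (2 * (\<Sum>i\<in>UNIV. (\<Sum>\<beta>\<in>UNIV. H \<beta> i l * ((\<Sum>c\<in>UNIV. H \<beta> i c * H \<alpha> k c) + (\<Sum>c\<in>UNIV. H \<beta> k c * H \<alpha> i c)))
         - (\<Sum>m\<in>UNIV. ((\<Sum>\<gamma>\<in>UNIV. H \<gamma> i l * H \<gamma> k m) + (\<Sum>\<gamma>\<in>UNIV. H \<gamma> k l * H \<gamma> i m)) * H \<alpha> i m))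
       - 4 * (\<Sum>m\<in>UNIV. ss l m * H \<alpha> k m))) = - 2 * s2 - 2 * n2"
proof -
  have 1: "(\<Sum>i\<in>UNIV. (\<Sum>\<beta>\<in>UNIV. H \<beta> i l * ((\<Sum>c\<in>UNIV. H \<beta> i c * H \<alpha> k c) + (\<Sum>c\<in>UNIV. H \<beta> k c * H \<alpha> i c)))
         - (\<Sum>m\<in>UNIV. ((\<Sum>\<gamma>\<in>UNIV. H \<gamma> i l * H \<gamma> k m) + (\<Sum>\<gamma>\<in>UNIV. H \<gamma> k l * H \<gamma> i m)) * H \<alpha> i m))
       = (\<Sum>m\<in>UNIV. ss l m * H \<alpha> k m) - (\<Sum>\<gamma>\<in>UNIV. nn \<gamma> \<alpha> * H \<gamma> k l)" for \<alpha> k l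
  proof -
    have a: "(\<Sum>i\<in>UNIV. \<Sum>\<beta>\<in>UNIV. H \<beta> i l * (\<Sum>c\<in>UNIV. H \<beta> i c * H \<alpha> k c)) = (\<Sum>m\<in>UNIV. ss l m * H \<alpha> k m)"
    proof -
      have "(\<Sum>m\<in>UNIV. ss l m * H \<alpha> k m) = (\<Sum>m\<in>UNIV. \<Sum>i\<in>UNIV. \<Sum>\<beta>\<in>UNIV. H \<beta> i l * (H \<beta> i m * H \<alpha> k m))"
        by (simp add: ss_def sum_distrib_right mult.assoc)
      also have "\<dots> = (\<Sum>i\<in>UNIV. \<Sum>m\<in>UNIV. \<Sum>\<beta>\<in>UNIV. H \<beta> i l * (H \<beta> i m * H \<alpha> k m))" by (rule sum.swap)
      also have "\<dots> = (\<Sum>i\<in>UNIV. \<Sum>\<beta>\<in>UNIV. \<Sum>m\<in>UNIV. H \<beta> i l * (H \<beta> i m * H \<alpha> k m))"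
        by (rule sum.cong[OF refl], rule sum.swap)
      finally show ?thesis by (simp add: sum_distrib_left)
    qed
    have b: "(\<Sum>m\<in>UNIV. (\<Sum>\<gamma>\<in>UNIV. H \<gamma> i l * H \<gamma> k m) * H \<alpha> i m) 
        = (\<Sum>\<beta>\<in>UNIV. H \<beta> i l * (\<Sum>c\<in>UNIV. H \<beta> k c * H \<alpha> i c))" for i
      unfolding sum_distrib_right sum_distrib_left mult.assoc by (rule sum.swap)
    have c: "(\<Sum>i\<in>UNIV. \<Sum>m\<in>UNIV. (\<Sum>\<gamma>\<in>UNIV. H \<gamma> k l * H \<gamma> i m) * H \<alpha> i m) = (\<Sum>\<gamma>\<in>UNIV. nn \<gamma> \<alpha> * H \<gamma> k l)"
    proof -
      have "(\<Sum>\<gamma>\<in>UNIV. nn \<gamma> \<alpha> * H \<gamma> k l) = (\<Sum>\<gamma>\<in>UNIV. \<Sum>i\<in>UNIV. \<Sum>m\<in>UNIV. H \<gamma> k l * H \<gamma> i m * H \<alpha> i m)"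
        by (simp add: nn_def sum_distrib_right sum_distrib_left mult_ac)
      also have "\<dots> = (\<Sum>i\<in>UNIV. \<Sum>\<gamma>\<in>UNIV. \<Sum>m\<in>UNIV. H \<gamma> k l * H \<gamma> i m * H \<alpha> i m)" by (rule sum.swap)
      also have "\<dots> = (\<Sum>i\<in>UNIV. \<Sum>m\<in>UNIV. \<Sum>\<gamma>\<in>UNIV. H \<gamma> k l * H \<gamma> i m * H \<alpha> i m)"
        by (rule sum.cong[OF refl], rule sum.swap)
      finally show ?thesis by (simp add: sum_distrib_right)
    qed
    show ?thesis
      unfolding distrib_left distrib_right sum.distrib sum_subtractf a b c by simp
  qed
  have 2: "(\<Sum>k\<in>UNIV. \<Sum>l\<in>UNIV. \<Sum>\<alpha>\<in>UNIV. H \<alpha> k l * (\<Sum>m\<in>UNIV. ss l m * H \<alpha> k m)) = s2"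
  proof -
    have "(\<Sum>k\<in>UNIV. \<Sum>l\<in>UNIV. \<Sum>\<alpha>\<in>UNIV. H \<alpha> k l * (\<Sum>m\<in>UNIV. ss l m * H \<alpha> k m))
       = (\<Sum>k\<in>UNIV. \<Sum>l\<in>UNIV. \<Sum>\<alpha>\<in>UNIV. \<Sum>m\<in>UNIV. ss l m * (H \<alpha> k l * H \<alpha> k m))"
      by (simp add: sum_distrib_left mult_ac)
    also have "\<dots> = (\<Sum>k\<in>UNIV. \<Sum>l\<in>UNIV. \<Sum>m\<in>UNIV. \<Sum>\<alpha>\<in>UNIV. ss l m * (H \<alpha> k l * H \<alpha> k m))"
      by (rule sum.cong[OF refl], rule sum.cong[OF refl], rule sum.swap)
    also have "\<dots> = (\<Sum>l\<in>UNIV. \<Sum>k\<in>UNIV. \<Sum>m\<in>UNIV. \<Sum>\<alpha>\<in>UNIV. ss l m * (H \<alpha> k l * H \<alpha> k m))"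
      by (rule sum.swap)
    also have "\<dots> = (\<Sum>l\<in>UNIV. \<Sum>m\<in>UNIV. \<Sum>k\<in>UNIV. \<Sum>\<alpha>\<in>UNIV. ss l m * (H \<alpha> k l * H \<alpha> k m))"
      by (rule sum.cong[OF refl], rule sum.swap)
    also have "\<dots> = (\<Sum>l\<in>UNIV. \<Sum>m\<in>UNIV. ss l m * ss l m)"
      by (simp add: ss_def sum_distrib_left)
    finally show ?thesis by (simp add: s2_def power2_eq_square)
  qed
  have 3: "(\<Sum>k\<in>UNIV. \<Sum>l\<in>UNIV. \<Sum>\<alpha>\<in>UNIV. H \<alpha> k l * (\<Sum>\<gamma>\<in>UNIV. nn \<gamma> \<alpha> * H \<gamma> k l)) = n2"
  proof -
    have "(\<Sum>k\<in>UNIV. \<Sum>l\<in>UNIV. \<Sum>\<alpha>\<in>UNIV. H \<alpha> k l * (\<Sum>\<gamma>\<in>UNIV. nn \<gamma> \<alpha> * H \<gamma> k l))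
       = (\<Sum>q\<in>UNIV. \<Sum>\<alpha>\<in>UNIV. \<Sum>\<gamma>\<in>UNIV. nn \<gamma> \<alpha> * (H \<gamma> (fst q) (snd q) * H \<alpha> (fst q) (snd q)))"
      by (simp add: sum_distrib_left mult_ac sum_UNIV_prod)
    also have "\<dots> = (\<Sum>\<alpha>\<in>UNIV. \<Sum>q\<in>UNIV. \<Sum>\<gamma>\<in>UNIV. nn \<gamma> \<alpha> * (H \<gamma> (fst q) (snd q) * H \<alpha> (fst q) (snd q)))"
      by (rule sum.swap)
    also have "\<dots> = (\<Sum>\<alpha>\<in>UNIV. \<Sum>\<gamma>\<in>UNIV. \<Sum>q\<in>UNIV. nn \<gamma> \<alpha> * (H \<gamma> (fst q) (snd q) * H \<alpha> (fst q) (snd q)))"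
      by (rule sum.cong[OF refl], rule sum.swap)
    also have "\<dots> = (\<Sum>\<alpha>\<in>UNIV. \<Sum>\<gamma>\<in>UNIV. nn \<gamma> \<alpha> * nn \<gamma> \<alpha>)"
      by (simp add: nn_def sum_distrib_left sum_UNIV_prod)
    also have "\<dots> = (\<Sum>\<gamma>\<in>UNIV. \<Sum>\<alpha>\<in>UNIV. nn \<gamma> \<alpha> * nn \<gamma> \<alpha>)" by (rule sum.swap)
    finally show ?thesis by (simp add: n2_def power2_eq_square)
  qed
  have "H \<alpha> k l * (2 * (M - N) - 4 * M) = (- 2) * (H \<alpha> k l * M) + (- 2) * (H \<alpha> k l * N)" for \<alpha> k l M N
    by (simp add: algebra_simps)
  then show ?thesis unfolding 1 by (simp only: sum.distrib sum_distrib_left[symmetric] 2 3)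
qed

end

text \<open>The algebraic core of the refined Kato inequality. For each m the trace-free symmetric
  matrix B is compared with the trace-free symmetric part \<open>T\<close> of c \<otimes> Bc. With q
  = |c|^2, expanding |qB - T|^2 \<ge> 0 improves the factor 1 of Cauchy-Schwarz to 1 + 1/n.\<close>

lemma trace_free_symmetric_bound:
  fixes B :: "'i::finite \<Rightarrow> 'i \<Rightarrow> 'm::finite \<Rightarrow> real" and c :: "'i \<Rightarrow> real"
  assumes sym: "\<And>i k m. B i k m = B k i m" and tr: "\<And>m. (\<Sum>i\<in>UNIV. B i i m) = 0"
  shows "(1 + 1 / real CARD('i)) * (\<Sum>k\<in>UNIV. \<Sum>m\<in>UNIV. (\<Sum>i\<in>UNIV. c i * B i k m)\<^sup>2)
     \<le> (\<Sum>i\<in>UNIV. (c i)\<^sup>2) * (\<Sum>i\<in>UNIV. \<Sum>k\<in>UNIV. \<Sum>m\<in>UNIV. (B i k m)\<^sup>2)"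
proof -
  define n where "n = real CARD('i)"
  have n1: "n \<ge> 1" by (simp add: n_def Suc_leI)
  define q where "q = (\<Sum>i\<in>UNIV. (c i)\<^sup>2)"
  define b where "b k m = (\<Sum>i\<in>UNIV. c i * B i k m)" for k m
  define \<beta> where "\<beta> m = (\<Sum>k\<in>UNIV. c k * b k m)" for m
  have q0: "q \<ge> 0" by (simp add: q_def sum_nonneg)
  have key: "(1 + 1 / n) * (\<Sum>k\<in>UNIV. (b k m)\<^sup>2) \<le> q * (\<Sum>i\<in>UNIV. \<Sum>k\<in>UNIV. (B i k m)\<^sup>2)" for m
  proof (cases "q = 0")
    case True
    then have "c i = 0" for i by (simp add: q_def sum_nonneg_eq_0_iff)
    then show ?thesis using True by (simp add: b_def)
  next
    case False
    then have qp: "q > 0" using q0 by simp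
    define bb where "bb = (\<Sum>k\<in>UNIV. (b k m)\<^sup>2)"
    define BB where "BB = (\<Sum>i\<in>UNIV. \<Sum>k\<in>UNIV. (B i k m)\<^sup>2)"
    define \<delta> where "\<delta> i k = (if i = k then 1 else 0 :: real)" for i k :: 'i
    define T where "T i k = (c i * b k m + c k * b i m - (2 / n * \<beta> m) * \<delta> i k) / 2" for i k
    have s1: "(\<Sum>i\<in>UNIV. \<Sum>k\<in>UNIV. B i k m * (c i * b k m)) = bb"
      unfolding bb_def power2_eq_square b_def[of _ m] 
      by (subst sum.swap) (simp add: sum_distrib_left sum_distrib_right mult_ac)
    have s2: "(\<Sum>i\<in>UNIV. \<Sum>k\<in>UNIV. B i k m * (c k * b i m)) = bb"
      using s1 by (subst sum.swap) (simp add: sym[of _ _ m])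
    have s3: "(\<Sum>i\<in>UNIV. \<Sum>k\<in>UNIV. B i k m * \<delta> i k) = 0"
      using tr by (simp add: \<delta>_def if_distrib cong: if_cong)
    have BT: "(\<Sum>i\<in>UNIV. \<Sum>k\<in>UNIV. B i k m * T i k) = bb"
    proof -
      have "B i k m * T i k = (1/2) * (B i k m * (c i * b k m)) + (1/2) * (B i k m * (c k * b i m)) 
          + (- \<beta> m / n) * (B i k m * \<delta> i k)" for i k
        by (simp add: T_def field_simps)
      then show ?thesis
        by (simp only: sum.distrib sum_distrib_left[symmetric] s1 s2 s3)
    qed
    have t1: "(\<Sum>i\<in>UNIV. \<Sum>k\<in>UNIV. (c i * b k m)\<^sup>2) = q * bb"
      by (simp add: power_mult_distrib q_def bb_def sum_product)
    have t2: "(\<Sum>i\<in>UNIV. \<Sum>k\<in>UNIV. (c k * b i m)\<^sup>2) = q * bb"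
      by (subst sum.swap) (rule t1)
    have t3: "(\<Sum>i\<in>UNIV. \<Sum>k\<in>UNIV. (c i * b k m) * (c k * b i m)) = (\<beta> m)\<^sup>2"
      unfolding \<beta>_def power2_eq_square sum_product by (simp add: mult_ac)
    have t4: "(\<Sum>i\<in>UNIV. \<Sum>k\<in>UNIV. (c i * b k m) * \<delta> i k) = \<beta> m"
      by (simp add: \<delta>_def \<beta>_def if_distrib cong: if_cong)
    have t5: "(\<Sum>i\<in>UNIV. \<Sum>k\<in>UNIV. (c k * b i m) * \<delta> i k) = \<beta> m"
      by (simp add: \<delta>_def \<beta>_def if_distrib cong: if_cong)
    have t6: "(\<Sum>i\<in>UNIV. \<Sum>k\<in>UNIV. (\<delta> i k)\<^sup>2) = n"
    proof -
      have "(\<delta> i k)\<^sup>2 = \<delta> i k" for i k by (simp add: \<delta>_def)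
      then show ?thesis by (simp add: \<delta>_def n_def)
    qed
    have TT: "(\<Sum>i\<in>UNIV. \<Sum>k\<in>UNIV. (T i k)\<^sup>2) = (q * bb + (1 - 2 / n) * (\<beta> m)\<^sup>2) / 2"
    proof -
      have "(T i k)\<^sup>2 = (1/4) * (c i * b k m)\<^sup>2 + (1/4) * (c k * b i m)\<^sup>2 + (1/2) * ((c i * b k m) * (c k * b i m))
          + (- \<beta> m / n) * ((c i * b k m) * \<delta> i k) + (- \<beta> m / n) * ((c k * b i m) * \<delta> i k) + (\<beta> m / n)\<^sup>2 * (\<delta> i k)\<^sup>2" for i k
        using n1 by (simp add: T_def field_simps power2_eq_square)
      then have "(\<Sum>i\<in>UNIV. \<Sum>k\<in>UNIV. (T i k)\<^sup>2) = (1/4) * (q * bb) + (1/4) * (q * bb) + (1/2) * (\<beta> m)\<^sup>2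
          + (- \<beta> m / n) * \<beta> m + (- \<beta> m / n) * \<beta> m + (\<beta> m / n)\<^sup>2 * n"
        by (simp only: sum.distrib sum_distrib_left[symmetric] t1 t2 t3 t4 t5 t6)
      also have "\<dots> = (q * bb + (1 - 2 / n) * (\<beta> m)\<^sup>2) / 2"
        using n1 by (simp add: field_simps power2_eq_square)
      finally show ?thesis .
    qed
    have "0 \<le> (\<Sum>i\<in>UNIV. \<Sum>k\<in>UNIV. (q * B i k m - T i k)\<^sup>2)" by (intro sum_nonneg) auto
    also have "\<dots> = q\<^sup>2 * BB + (- 2 * q) * bb + (\<Sum>i\<in>UNIV. \<Sum>k\<in>UNIV. (T i k)\<^sup>2)"
    proof -
      have "(q * B i k m - T i k)\<^sup>2 = q\<^sup>2 * (B i k m)\<^sup>2 + (- 2 * q) * (B i k m * T i k) + (T i k)\<^sup>2" for i k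
        by (simp add: power2_eq_square algebra_simps)
      then show ?thesis
        by (simp only: sum.distrib sum_distrib_left[symmetric] BT BB_def)
    qed
    finally have pos: "0 \<le> q\<^sup>2 * BB - 2 * q * bb + (q * bb + (1 - 2 / n) * (\<beta> m)\<^sup>2) / 2"
      unfolding TT by simp
    have \<beta>: "(\<beta> m)\<^sup>2 \<le> q * bb"
      unfolding \<beta>_def q_def bb_def by (rule Cauchy_Schwarz_ineq_sum)
    have "(1 - 2 / n) * (\<beta> m)\<^sup>2 \<le> (1 - 2 / n) * (q * bb)"
    \<comment> \<open>For n = 1 the factor 1 - 2/n is negative and monotonicity fails, but a
      trace-free matrix of size one vanishes.\<close>
    proof (cases "CARD('i) = 1")
      case True
      then obtain i0 where i0: "(UNIV :: 'i set) = {i0}" by (metis card_1_singletonE)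
      then have "B i k m = 0" for i k using tr[of m] by (metis (full_types) UNIV_I finite.emptyI singletonD sum.empty sum.insert empty_iff add_0_right)
      then show ?thesis by (simp add: bb_def b_def \<beta>_def)
    next
      case False
      then have "n \<ge> 2" unfolding n_def using n1 n_def by linarith
      then show ?thesis using \<beta> by (intro mult_left_mono) auto
    qed
    moreover have "0 \<le> x + (y + v) / 2" if "v' \<le> v" "0 \<le> x + (y + v') / 2" for v v' x y :: real
      using that by (simp add: field_simps)
    ultimately have "0 \<le> q\<^sup>2 * BB - 2 * q * bb + (q * bb + (1 - 2 / n) * (q * bb)) / 2"
      using pos by blast
    also have "\<dots> = q * (q * BB - (1 + 1 / n) * bb)"
      using n1 by (simp add: field_simps power2_eq_square)
    finally have "0 \<le> q * BB - (1 + 1 / n) * bb" using qp by (simp add: zero_le_mult_iff)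
    then show ?thesis by (simp add: bb_def BB_def)
  qed
  have "(1 + 1 / n) * (\<Sum>k\<in>UNIV. \<Sum>m\<in>UNIV. (b k m)\<^sup>2) = (\<Sum>m\<in>UNIV. (1 + 1 / n) * (\<Sum>k\<in>UNIV. (b k m)\<^sup>2))"
    by (subst sum.swap) (simp add: sum_distrib_left)
  also have "\<dots> \<le> (\<Sum>m\<in>UNIV. q * (\<Sum>i\<in>UNIV. \<Sum>k\<in>UNIV. (B i k m)\<^sup>2))"
    by (intro sum_mono key)
  also have "\<dots> = q * (\<Sum>i\<in>UNIV. \<Sum>k\<in>UNIV. \<Sum>m\<in>UNIV. (B i k m)\<^sup>2)"
  proof -
    have "(\<Sum>m\<in>UNIV. \<Sum>i\<in>UNIV. \<Sum>k\<in>UNIV. (B i k m)\<^sup>2) = (\<Sum>i\<in>UNIV. \<Sum>m\<in>UNIV. \<Sum>k\<in>UNIV. (B i k m)\<^sup>2)"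
      by (rule sum.swap)
    also have "\<dots> = (\<Sum>i\<in>UNIV. \<Sum>k\<in>UNIV. \<Sum>m\<in>UNIV. (B i k m)\<^sup>2)"
      by (rule sum.cong[OF refl], rule sum.swap)
    finally show ?thesis by (simp add: sum_distrib_left[symmetric])
  qed
  finally show ?thesis by (simp add: n_def q_def b_def)
qed

text \<open>
  The refined Kato inequality, in which \<open>B\<close> is the covariant derivative of the second fundamental
  form \<open>h\<close>.  The gain \<open>1/n\<close> over Cauchy-Schwarz is what makes the maximum principle argument close.
\<close>

lemma kato_inequality:
  fixes B :: "'i::finite \<Rightarrow> 'i \<Rightarrow> 'm::finite \<Rightarrow> real" and h :: "'i \<Rightarrow> 'm \<Rightarrow> real"
  assumes sym: "\<And>i k m. B i k m = B k i m" and tr: "\<And>m. (\<Sum>i\<in>UNIV. B i i m) = 0"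
  shows "(1 + 1 / real CARD('i)) * (\<Sum>i\<in>UNIV. (\<Sum>k\<in>UNIV. \<Sum>m\<in>UNIV. B i k m * h k m)\<^sup>2)
     \<le> (\<Sum>k\<in>UNIV. \<Sum>m\<in>UNIV. (h k m)\<^sup>2) * (\<Sum>i\<in>UNIV. \<Sum>k\<in>UNIV. \<Sum>m\<in>UNIV. (B i k m)\<^sup>2)"
proof -
  define c where "c i = (\<Sum>k\<in>UNIV. \<Sum>m\<in>UNIV. B i k m * h k m)" for i
  define q where "q = (\<Sum>i\<in>UNIV. (c i)\<^sup>2)"
  define hh where "hh = (\<Sum>k\<in>UNIV. \<Sum>m\<in>UNIV. (h k m)\<^sup>2)"
  define BB where "BB = (\<Sum>i\<in>UNIV. \<Sum>k\<in>UNIV. \<Sum>m\<in>UNIV. (B i k m)\<^sup>2)"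
  define bb where "bb = (\<Sum>k\<in>UNIV. \<Sum>m\<in>UNIV. (\<Sum>i\<in>UNIV. c i * B i k m)\<^sup>2)"
  have nonneg: "q \<ge> 0" "hh \<ge> 0" "BB \<ge> 0" unfolding q_def hh_def BB_def by (auto intro!: sum_nonneg)
  have "q = (\<Sum>i\<in>UNIV. \<Sum>k\<in>UNIV. \<Sum>m\<in>UNIV. c i * B i k m * h k m)"
    unfolding q_def power2_eq_square by (subst (2) c_def) (simp add: sum_distrib_left mult.assoc)
  also have "\<dots> = (\<Sum>i\<in>UNIV. \<Sum>p\<in>UNIV. c i * B i (fst p) (snd p) * h (fst p) (snd p))"
    by (simp add: sum_UNIV_prod)
  also have "\<dots> = (\<Sum>p\<in>UNIV. (\<Sum>i\<in>UNIV. c i * B i (fst p) (snd p)) * h (fst p) (snd p))"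
    by (subst sum.swap) (simp add: sum_distrib_right)
  \<comment> \<open>One factor \<open>c\<close> has been moved onto \<open>B\<close>, so that
    Cauchy-Schwarz produces the norm of the contraction of \<open>c\<close> with \<open>B\<close>,
    to which \<open>trace_free_symmetric_bound\<close> applies.\<close>
  finally have "q\<^sup>2 \<le> (\<Sum>p\<in>UNIV. (\<Sum>i\<in>UNIV. c i * B i (fst p) (snd p))\<^sup>2) * (\<Sum>p\<in>UNIV. (h (fst p) (snd p))\<^sup>2)"
    by (simp add: Cauchy_Schwarz_ineq_sum)
  then have 1: "q\<^sup>2 \<le> bb * hh" by (simp add: bb_def hh_def sum_UNIV_prod)
  have 2: "(1 + 1 / real CARD('i)) * bb \<le> q * BB"
    unfolding bb_def q_def BB_def by (rule trace_free_symmetric_bound) (rule assms)+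
  have "(1 + 1 / real CARD('i)) * q \<le> hh * BB"
  proof (cases "q = 0")
    case True
    then show ?thesis using nonneg by simp
  next
    case False
    then have qp: "q > 0" using nonneg by simp
    have "(1 + 1 / real CARD('i)) * q\<^sup>2 \<le> (1 + 1 / real CARD('i)) * (bb * hh)"
      using 1 by (intro mult_left_mono) auto
    also have "\<dots> = ((1 + 1 / real CARD('i)) * bb) * hh" by simp
    also have "\<dots> \<le> (q * BB) * hh" using 2 nonneg by (intro mult_right_mono) auto
    finally have "q * ((1 + 1 / real CARD('i)) * q) \<le> q * (hh * BB)"
      by (simp add: power2_eq_square mult_ac)
    then show ?thesis using qp by simp
  qed
  then show ?thesis by (simp add: q_def c_def hh_def BB_def)
qed

section \<open>Tangential derivatives on a minimal submanifold\<close>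

text \<open>A submanifold with a global chart \<open>X\<close>, described by its tangent projection
  \<open>P\<close>. \<open>E\<close> is a fixed linear left inverse of every differential of
  \<open>X\<close>, for a graph the projection to the base; \<open>dX_E_P\<close> says that the
  range of \<open>P x\<close> is no larger than the tangent space. The trace in
  \<open>minimal\<close> is the mean curvature vector.\<close>

locale minimal_immersion =
  fixes X :: "'x::euclidean_space \<Rightarrow> 'v::euclidean_space" and E :: "'v \<Rightarrow> 'x"
    and P :: "'x \<Rightarrow> 'v \<Rightarrow>\<^sub>L 'v"
  assumes smooth_X: "smooth_on UNIV X" and smooth_P: "smooth_on UNIV P"
    and linear_E: "bounded_linear E"
    and E_dX: "E (dird h X x) = h"
    and P_dX: "P x (dird h X x) = dird h X x"
    and dX_E_P: "dird (E (P x a)) X x = P x a"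
    and P_sym: "P x a \<bullet> b = a \<bullet> P x b"
    and minimal: "(\<Sum>a\<in>Basis. blinfun_apply (dird (E (P x a)) P x) a) = 0"
begin

text \<open>
  A constant vector \<open>a\<close> acts on functions by differentiation along its tangential part \<open>P x a\<close>;
  \<open>E\<close> reads off the chart components of a tangent vector.  These derivations replace moving frames:
  at a given point the fields \<open>P a\<close>, with \<open>a\<close> tangent there, have vanishing covariant derivative, and
  the sum of \<open>D a \<circ> D a\<close> over any orthonormal basis of the ambient space is the Laplace--Beltrami operator.
\<close>

definition D :: "'v \<Rightarrow> ('x \<Rightarrow> 'b::real_normed_vector) \<Rightarrow> 'x \<Rightarrow> 'b" where
  "D a u x = dird (E (P x a)) u x"

lemma smooth_EP: "smooth_on UNIV (\<lambda>x. E (P x a))"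
  by (intro smooth_bounded_linear[OF linear_E] smooth_intros smooth_P)

lemma smooth_D: "smooth_on UNIV u \<Longrightarrow> smooth_on UNIV (D a u)"
  using smooth_dird_field[OF _ smooth_EP] unfolding D_def[abs_def] .

lemmas smooths = smooth_intros smooth_D smooth_P smooth_X

lemma D_const [simp]: "D a (\<lambda>x. c) x = 0" by (simp add: D_def)

lemma D_add: "smooth_on UNIV u \<Longrightarrow> smooth_on UNIV v \<Longrightarrow> D a (\<lambda>x. u x + v x) x = D a u x + D a v x"
  by (simp add: D_def dird_add)

lemma D_minus: "smooth_on UNIV u \<Longrightarrow> D a (\<lambda>x. - u x) x = - D a u x"
  by (simp add: D_def dird_minus)

lemma D_diff: "smooth_on UNIV u \<Longrightarrow> smooth_on UNIV v \<Longrightarrow> D a (\<lambda>x. u x - v x) x = D a u x - D a v x"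
  by (simp add: D_def dird_diff)

lemma D_sum: "(\<And>i. i \<in> I \<Longrightarrow> smooth_on UNIV (u i)) \<Longrightarrow> D a (\<lambda>x. \<Sum>i\<in>I. u i x) x = (\<Sum>i\<in>I. D a (u i) x)"
  by (simp add: D_def dird_sum)

lemma D_inner: "smooth_on UNIV u \<Longrightarrow> smooth_on UNIV v \<Longrightarrow>
    D a (\<lambda>x. u x \<bullet> v x) x = u x \<bullet> D a v x + D a u x \<bullet> v x"
  by (simp add: D_def dird_inner)

lemma D_scaleR: "smooth_on UNIV u \<Longrightarrow> smooth_on UNIV v \<Longrightarrow>
    D a (\<lambda>x. u x *\<^sub>R v x) x = u x *\<^sub>R D a v x + D a u x *\<^sub>R v x"
  by (simp add: D_def dird_scaleR)

lemma D_mult: "smooth_on UNIV u \<Longrightarrow> smooth_on UNIV v \<Longrightarrow>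
    D a (\<lambda>x. u x * v x :: real) x = u x * D a v x + D a u x * v x"
  by (simp add: D_def dird_mult)

lemma D_apply: "smooth_on UNIV u \<Longrightarrow> smooth_on UNIV v \<Longrightarrow>
    D a (\<lambda>x. blinfun_apply (u x) (v x)) x = u x (D a v x) + D a u x (v x)"
  by (simp add: D_def dird_blinfun_apply)

lemma D_apply_const: "smooth_on UNIV u \<Longrightarrow> D a (\<lambda>x. blinfun_apply (u x) v) x = D a u x v"
  by (subst D_apply) (simp_all add: blinfun.bilinear_simps)

lemma bounded_linear_D: "smooth_on UNIV u \<Longrightarrow> bounded_linear (\<lambda>a. D a u x)"
  unfolding D_def using bounded_linear_compose[OF dird_bounded_linear
      bounded_linear_compose[OF linear_E blinfun.bounded_linear_right]] .

lemma P_idem: "P x (P x a) = P x a"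
  using P_dX[of x "E (P x a)"] unfolding dX_E_P .

lemma D_P: "D (P x a) u x = D a u x"
  by (simp add: D_def P_idem)

lemma D_eq_0: "smooth_on UNIV u \<Longrightarrow> P x a = 0 \<Longrightarrow> D a u x = 0"
  using D_P[of x a u] linear_simps(3)[OF bounded_linear_D[of u x]] by simp

lemma D_X: "D a X x = P x a"
  by (simp add: D_def dX_E_P)

text \<open>
  On tangent vectors \<open>A a x b\<close> is the second fundamental form; on a normal vector \<open>b\<close> it is the
  Weingarten map.  The field \<open>z a b\<close> measures the failure of \<open>D a\<close> and \<open>D b\<close> to commute.
\<close>

definition A :: "'v \<Rightarrow> 'x \<Rightarrow> 'v \<Rightarrow>\<^sub>L 'v" where "A a = D a P"
definition z :: "'v \<Rightarrow> 'v \<Rightarrow> 'x \<Rightarrow> 'v" where "z a b x = A a x b - A b x a"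
definition B :: "'v \<Rightarrow> 'v \<Rightarrow> 'x \<Rightarrow> 'v \<Rightarrow>\<^sub>L 'v" where "B d a = D d (A a)"
definition C :: "'v \<Rightarrow> 'v \<Rightarrow> 'v \<Rightarrow> 'x \<Rightarrow> 'v \<Rightarrow>\<^sub>L 'v" where "C c d a = D c (B d a)"

lemma smooth_A: "smooth_on UNIV (A a)" unfolding A_def by (intro smooths)
lemma smooth_B: "smooth_on UNIV (B d a)" unfolding B_def by (intro smooths smooth_A)
lemma smooth_z: "smooth_on UNIV (z a b)" unfolding z_def[abs_def] by (intro smooths smooth_A)

text \<open>The commutator is the derivative along the Lie bracket of the chart fields E(P a) and
  E(P b), and E(z a b) is that bracket. Symmetry of second derivatives is a hypothesis because it is
  proved separately for vector-valued and operator-valued \<open>u\<close>.\<close>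

lemma D_D_commute_aux:
  assumes u: "smooth_on UNIV u" and c: "\<And>h k. dird k (dird h u) x = dird h (dird k u) x"
  shows "D a (D b u) x - D b (D a u) x = dird (E (z a b x)) u x"
proof -
  have 1: "D a (D b u) x = dird (E (P x a)) (dird (E (P x b)) u) x + dird (E (A a x b)) u x" for a b
  proof -
    have "dird h (\<lambda>x. E (P x b)) x = E (dird h P x b)" for h
      using dird_linear[OF linear_E, of "\<lambda>x. P x b" h x] smooth_P
      by (simp add: smooth_blinfun_apply dird_blinfun_apply blinfun.bilinear_simps)
    then show ?thesis
      unfolding D_def[abs_def] A_def
      by (simp add: dird_dird_field[OF u smooth_EP])
  qed
  interpret e: bounded_linear E by (rule linear_E)
  interpret d: bounded_linear "\<lambda>h. dird h u x" using dird_bounded_linear[OF u] .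
  show ?thesis unfolding 1 z_def c[of "E (P x a)"] by (simp add: e.diff d.diff)
qed

text \<open>The commutator is applied to the position vector: D a (D b X) = A a b, so
  \<open>z\<close> is itself a value of dX. For tangent a and b this contains the symmetry of the
  second fundamental form.\<close>

lemma z_tangent: "P x (z a b x) = z a b x"
proof -
  have "D a X = (\<lambda>x. P x a)" for a using D_X by blast
  then have "D a (D b X) x = A a x b" for a b
    by (simp add: D_apply_const smooth_P A_def)
  then have "z a b x = D a (D b X) x - D b (D a X) x" by (simp add: z_def)
  also have "\<dots> = dird (E (z a b x)) X x"
    by (rule D_D_commute_aux[OF smooth_X dird_dird_commute[OF smooth_X]])
  finally have "z a b x = dird (E (z a b x)) X x" .
  then show ?thesis using P_dX by metis
qed

lemma D_D_commute:
  assumes u: "smooth_on UNIV u" and c: "\<And>h k. dird k (dird h u) x = dird h (dird k u) x"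
  shows "D a (D b u) x - D b (D a u) x = D (z a b x) u x"
  using D_D_commute_aux[OF assms] by (simp add: D_def z_tangent)

lemma D_D_field:
  assumes "smooth_on UNIV u" "smooth_on UNIV w"
  shows "D a (\<lambda>x. D (w x) u x) x = D a (D (w x) u) x + D (D a w x) u x"
proof -
  have 1: "D v u x = (\<Sum>i\<in>Basis. (v \<bullet> i) *\<^sub>R D i u x)" for v x
  proof -
    interpret bounded_linear "\<lambda>a. D a u x" using bounded_linear_D[OF assms(1)] .
    have "D v u x = D (\<Sum>i\<in>Basis. (v \<bullet> i) *\<^sub>R i) u x" by (simp add: euclidean_representation)
    then show ?thesis by (simp add: sum scaleR)
  qed
  then have "(\<lambda>x. D (w x) u x) = (\<lambda>x. \<Sum>i\<in>Basis. (w x \<bullet> i) *\<^sub>R D i u x)" by blast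
  then have "D a (\<lambda>x. D (w x) u x) x
      = (\<Sum>i\<in>Basis. (w x \<bullet> i) *\<^sub>R D a (D i u) x + (D a w x \<bullet> i) *\<^sub>R D i u x)"
    using assms by (simp add: D_sum D_scaleR D_inner smooths)
  moreover have "D a (D (w x) u) x = (\<Sum>i\<in>Basis. (w x \<bullet> i) *\<^sub>R D a (D i u) x)"
  proof -
    have "D (w x) u = (\<lambda>y. \<Sum>i\<in>Basis. (w x \<bullet> i) *\<^sub>R D i u y)" using 1 by blast
    then show ?thesis using assms by (simp add: D_sum D_scaleR smooths)
  qed
  moreover note 1[of "D a w x" x]
  ultimately show ?thesis by (simp add: sum.distrib)
qed

lemma linear_A: "bounded_linear (\<lambda>a. A a x)"
  unfolding A_def by (rule bounded_linear_D[OF smooth_P])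

lemma linear_B1: "bounded_linear (\<lambda>d. B d a x)"
  unfolding B_def by (rule bounded_linear_D[OF smooth_A])

text \<open>The index \<open>a\<close> is expanded in a fixed basis before differentiating, so
  derivatives inherit linearity in \<open>a\<close>.\<close>

lemma linear_D_family:
  fixes F :: "'v \<Rightarrow> 'x \<Rightarrow> 'c::real_normed_vector"
  assumes F: "\<And>x. bounded_linear (\<lambda>a. F a x)" "\<And>a. smooth_on UNIV (F a)"
  shows "bounded_linear (\<lambda>a. D c (F a) x)"
proof -
  have "F a = (\<lambda>x. \<Sum>i\<in>Basis. (a \<bullet> i) *\<^sub>R F i x)" for a
  proof
    fix x
    interpret l: bounded_linear "\<lambda>a. F a x" by (rule F)
    have "F a x = F (\<Sum>i\<in>Basis. (a \<bullet> i) *\<^sub>R i) x" by (simp add: euclidean_representation)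
    then show "F a x = (\<Sum>i\<in>Basis. (a \<bullet> i) *\<^sub>R F i x)" by (simp add: l.sum l.scaleR)
  qed
  then have "D c (F a) x = D c (\<lambda>x. \<Sum>i\<in>Basis. (a \<bullet> i) *\<^sub>R F i x) x" for a
    by (rule arg_cong)
  also have "D c (\<lambda>x. \<Sum>i\<in>Basis. (a \<bullet> i) *\<^sub>R F i x) x = (\<Sum>i\<in>Basis. (a \<bullet> i) *\<^sub>R D c (F i) x)" for a
    by (simp add: D_sum D_scaleR smooths F)
  finally have e1: "(\<lambda>a. D c (F a) x) = (\<lambda>a. \<Sum>i\<in>Basis. (a \<bullet> i) *\<^sub>R D c (F i) x)"
    by (rule ext)
  show ?thesis unfolding e1
    by (intro bounded_linear_sum bounded_linear_scaleR_const bounded_linear_inner_left)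
qed

lemma linear_B2: "bounded_linear (\<lambda>a. B d a x)"
  unfolding B_def by (rule linear_D_family[OF linear_A smooth_A])

lemma linear_C2: "bounded_linear (\<lambda>d. C c d a x)"
  unfolding C_def by (rule linear_D_family[OF linear_B1 smooth_B])

lemma linear_C3: "bounded_linear (\<lambda>a. C c d a x)"
  unfolding C_def by (rule linear_D_family[OF linear_B2 smooth_B])

lemma A_sym: "A a x b \<bullet> c = b \<bullet> A a x c"
proof -
  have "D a (\<lambda>x. P x b \<bullet> c) x = D a (\<lambda>x. b \<bullet> P x c) x" by (simp add: P_sym)
  then show ?thesis by (simp add: D_inner D_apply_const smooths A_def)
qed

lemma B_sym: "B d a x b \<bullet> c = b \<bullet> B d a x c"
proof -
  have "D d (\<lambda>x. A a x b \<bullet> c) x = D d (\<lambda>x. b \<bullet> A a x c) x" by (simp add: A_sym)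
  then show ?thesis by (simp add: D_inner D_apply_const smooths smooth_A B_def)
qed

lemma C_sym: "C c d a x b \<bullet> b' = b \<bullet> C c d a x b'"
proof -
  have "D c (\<lambda>x. B d a x b \<bullet> b') x = D c (\<lambda>x. b \<bullet> B d a x b') x" by (simp add: B_sym)
  then show ?thesis by (simp add: D_inner D_apply_const smooths smooth_B C_def)
qed

text \<open>The derivative of P^2 = P. It makes \<open>A a x\<close> off-diagonal: tangent vectors
  go to normal ones and normal vectors to tangent ones.\<close>

lemma A_P: "A a x (P x b) + P x (A a x b) = A a x b"
proof -
  have "D a (\<lambda>x. P x (P x b)) x = D a (\<lambda>x. P x b) x" by (simp add: P_idem)
  then show ?thesis by (simp add: D_apply_const D_apply smooths A_def add.commute)
qed

text \<open>The second derivative of P^2 = P. It expresses the diagonal blocks of \<open>B\<close>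
  through products of \<open>A\<close>; only the mixed block carries new information.\<close>

lemma B_P: "B d a x (P x b) + A a x (A d x b) + A d x (A a x b) + P x (B d a x b) = B d a x b"
proof -
  have "D d (\<lambda>x. A a x (P x b) + P x (A a x b)) x = D d (\<lambda>x. A a x b) x" by (simp add: A_P)
  then show ?thesis 
    by (simp add: D_apply_const D_apply D_add smooths smooth_A B_def A_def[symmetric] algebra_simps)
qed

lemma minimal_A: "(\<Sum>a\<in>Basis. A a x a) = 0"
  using minimal[of x] by (simp add: A_def D_def)

lemma minimal_B: "(\<Sum>a\<in>Basis. B d a x a) = 0"
proof -
  have "D d (\<lambda>x. \<Sum>a\<in>Basis. A a x a) x = 0" by (simp add: minimal_A)
  then show ?thesis by (simp add: D_sum D_apply_const smooths smooth_A B_def)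
qed

lemma B_commute: "B d a x - B a d x = A (z d a x) x"
  unfolding B_def A_def by (rule D_D_commute[OF smooth_P dird_dird_commute_blinfun[OF smooth_P]])

lemma C_commute: "C c d a x - C d c a x = B (z c d x) a x"
  unfolding B_def C_def by (rule D_D_commute[OF smooth_A dird_dird_commute_blinfun[OF smooth_A]])

lemma D_z: "D d (z a b) x = B d a x b - B d b x a"
  unfolding z_def[abs_def] by (simp add: D_diff D_apply_const smooths smooth_A B_def)

lemma D_z_tangent: "A d x (z a b x) + P x (D d (z a b) x) = D d (z a b) x"
proof -
  have "D d (\<lambda>x. P x (z a b x)) x = D d (\<lambda>x. z a b x) x" by (simp add: z_tangent)
  then show ?thesis by (simp add: D_apply smooths smooth_z A_def add.commute)
qed

text \<open>\<open>B_commute\<close> is an identity between fields and can be differentiated. The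
  direction \<open>z a b\<close> varies as well, which yields the second term.\<close>

lemma C_commute2: "C d a b x - C d b a x = B d (z a b x) x + A (D d (z a b) x) x"
proof -
  have "(\<lambda>x. B a b x - B b a x) = (\<lambda>x. D (z a b x) P x)"
    by (simp add: B_commute A_def)
  then have "D d (\<lambda>x. B a b x - B b a x) x = D d (\<lambda>x. D (z a b x) P x) x" by simp
  then show ?thesis
    by (simp add: D_diff smooth_B C_def D_D_field[OF smooth_P smooth_z]) (simp add: A_def B_def)
qed

lemma A_P_eq: "A (P x a) x = A a x" by (simp add: A_def D_P)

end

section \<open>Norm and Laplacian of the derivatives of the tangent projection\<close>

context minimal_immersion
begin

lemma linear_A_apply: "bounded_linear (\<lambda>a. A a x b)"
  using bounded_linear_compose[OF bounded_linear_blinfun_apply_left linear_A] .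

lemma A_0: "A 0 x = 0" using linear_simps(3)[OF linear_A] .
lemma B_0: "B 0 a x = 0" using linear_simps(3)[OF linear_B1] .
lemma B_02: "B d 0 x = 0" using linear_simps(3)[OF linear_B2] .

text \<open>The Hilbert-Schmidt inner product; the operator norm carried by the type does not come
  from an inner product in general.\<close>

definition hs :: "('v \<Rightarrow>\<^sub>L 'v) \<Rightarrow> ('v \<Rightarrow>\<^sub>L 'v) \<Rightarrow> real" where
  "hs F G = (\<Sum>b\<in>Basis. F b \<bullet> G b)"

text \<open>\<open>Dm\<close> is the contraction of dP with itself that P^2 = P produces in the
  Laplacian \<open>LP\<close> of \<open>P\<close>.\<close>

definition Dm :: "'x \<Rightarrow> 'v \<Rightarrow> 'v" where "Dm x b = (\<Sum>c\<in>Basis. A c x (A c x b))"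
definition LP :: "'x \<Rightarrow> 'v \<Rightarrow> 'v" where "LP x b = (\<Sum>a\<in>Basis. B a a x b)"
text \<open>The derivative of \<open>P\<close> contains the second fundamental form and its transpose, hence the factor
  \<open>1/2\<close> in its square norm \<open>e\<close>.\<close>

definition e :: "'x \<Rightarrow> real" where "e x = (\<Sum>a\<in>Basis. hs (A a x) (A a x)) / 2"

lemma smooth_e: "smooth_on UNIV e"
proof -
  have "smooth_on UNIV (\<lambda>x. (1 / 2) * (\<Sum>a\<in>Basis. \<Sum>b\<in>Basis. A a x b \<bullet> A a x b))"
    by (intro smooths smooth_A)
  then show ?thesis by (simp add: e_def[abs_def] hs_def)
qed

lemma D_cmult: "smooth_on UNIV u \<Longrightarrow> D a (\<lambda>x. c * u x :: real) x = c * D a u x"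
  by (simp add: D_mult)

lemma e_eq: "e = (\<lambda>x. (1 / 2) * (\<Sum>a\<in>Basis. \<Sum>b\<in>Basis. A a x b \<bullet> A a x b))"
  by (simp add: e_def[abs_def] hs_def)

lemma D_e: "D d e x = (\<Sum>a\<in>Basis. hs (B d a x) (A a x))"
proof -
  have "D d e x = (1 / 2) * D d (\<lambda>x. \<Sum>a\<in>Basis. \<Sum>b\<in>Basis. A a x b \<bullet> A a x b) x"
    unfolding e_eq by (intro D_cmult smooths smooth_A)
  also have "D d (\<lambda>x. \<Sum>a\<in>Basis. \<Sum>b\<in>Basis. A a x b \<bullet> A a x b) x
      = (\<Sum>a\<in>Basis. \<Sum>b\<in>Basis. 2 * (B d a x b \<bullet> A a x b))"
    by (simp add: D_sum D_inner D_apply_const smooths smooth_A B_def inner_commute)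
  finally show ?thesis by (simp add: hs_def sum_distrib_left[symmetric])
qed

lemma D_D_e: "D c (D d e) x = (\<Sum>a\<in>Basis. hs (C c d a x) (A a x) + hs (B d a x) (B c a x))"
proof -
  have e: "D d e = (\<lambda>x. \<Sum>a\<in>Basis. \<Sum>b\<in>Basis. B d a x b \<bullet> A a x b)"
    using D_e by (auto simp: hs_def)
  have "D c (D d e) x = (\<Sum>a\<in>Basis. \<Sum>b\<in>Basis. B d a x b \<bullet> B c a x b + C c d a x b \<bullet> A a x b)"
    unfolding e by (simp add: D_sum D_inner D_apply_const smooths smooth_A smooth_B B_def[of c] C_def)
  then show ?thesis by (simp add: hs_def sum.distrib add.commute)
qed

lemma D_LP: "D d (\<lambda>x. LP x b) x = (\<Sum>a\<in>Basis. C d a a x b)"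
  unfolding LP_def by (simp add: D_sum D_apply_const smooths smooth_B C_def)

lemma smooth_Dm: "smooth_on UNIV (\<lambda>x. Dm x b)"
  unfolding Dm_def by (intro smooths smooth_A)

lemma D_Dm: "D d (\<lambda>x. Dm x b) x = (\<Sum>c\<in>Basis. B d c x (A c x b) + A c x (B d c x b))"
  unfolding Dm_def by (simp add: D_sum D_apply D_apply_const smooths smooth_A B_def add.commute)

end

text \<open>The frames are just a choice of orthonormal bases at each point, with no continuity in
  \<open>x\<close>, and are never differentiated. \<open>flat\<close> is accordingly a condition on
  \<open>A\<close> at the point.\<close>

locale flat_minimal_immersion = minimal_immersion X E P
  for X :: "'x::euclidean_space \<Rightarrow> 'v::euclidean_space" and E P +
  fixes t :: "'x \<Rightarrow> 'i::finite \<Rightarrow> 'v" and nu :: "'x \<Rightarrow> 'j::finite \<Rightarrow> 'v"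
  assumes t_tangent: "P x (t x i) = t x i" and nu_normal: "P x (nu x \<alpha>) = 0"
    and t_orth: "t x i \<bullet> t x k = (if i = k then 1 else 0)"
    and nu_orth: "nu x \<alpha> \<bullet> nu x \<beta> = (if \<alpha> = \<beta> then 1 else 0)"
    and frame_expand: "v = (\<Sum>i\<in>UNIV. (v \<bullet> t x i) *\<^sub>R t x i) + (\<Sum>\<alpha>\<in>UNIV. (v \<bullet> nu x \<alpha>) *\<^sub>R nu x \<alpha>)"
    and flat: "A (t x i) x (nu x \<alpha>) \<bullet> A (t x k) x (nu x \<beta>) = A (t x k) x (nu x \<alpha>) \<bullet> A (t x i) x (nu x \<beta>)"
begin

lemma frame_inner:
  "v \<bullet> w = (\<Sum>i\<in>UNIV. (v \<bullet> t x i) * (w \<bullet> t x i)) + (\<Sum>\<alpha>\<in>UNIV. (v \<bullet> nu x \<alpha>) * (w \<bullet> nu x \<alpha>))"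
proof -
  have "v \<bullet> w = ((\<Sum>i\<in>UNIV. (v \<bullet> t x i) *\<^sub>R t x i) + (\<Sum>\<alpha>\<in>UNIV. (v \<bullet> nu x \<alpha>) *\<^sub>R nu x \<alpha>)) \<bullet> w"
    using frame_expand[of v x] by (rule arg_cong)
  then show ?thesis by (simp add: inner_add_left inner_sum_left inner_commute[of w])
qed

lemma frame_eqI:
  assumes "\<And>i. v \<bullet> t x i = w \<bullet> t x i" "\<And>\<alpha>. v \<bullet> nu x \<alpha> = w \<bullet> nu x \<alpha>"
  shows "v = w"
  using frame_expand[of v x] frame_expand[of w x] by (simp add: assms)

lemma frame_linear_eqI:
  assumes "linear f" "linear g" "\<And>i. f (t x i) = g (t x i)" "\<And>\<alpha>. f (nu x \<alpha>) = g (nu x \<alpha>)"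
  shows "f v = g v"
proof -
  have "f v = f ((\<Sum>i\<in>UNIV. (v \<bullet> t x i) *\<^sub>R t x i) + (\<Sum>\<alpha>\<in>UNIV. (v \<bullet> nu x \<alpha>) *\<^sub>R nu x \<alpha>))"
    using frame_expand[of v x] by (rule arg_cong)
  also have "\<dots> = g ((\<Sum>i\<in>UNIV. (v \<bullet> t x i) *\<^sub>R t x i) + (\<Sum>\<alpha>\<in>UNIV. (v \<bullet> nu x \<alpha>) *\<^sub>R nu x \<alpha>))"
    using assms by (simp add: linear_add linear_sum linear_scale)
  also have "\<dots> = g v" using frame_expand[of v x] by (rule arg_cong[symmetric])
  finally show ?thesis .
qed

text \<open>The trace of a bilinear map is the same in every orthonormal basis. Definitions use the
  constant basis, which commutes with differentiation, and results are read off in the frame at one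
  point.\<close>

lemma basis_sum:
  fixes f :: "'v \<Rightarrow> 'v \<Rightarrow> 'c::real_normed_vector"
  assumes 1: "\<And>a. bounded_linear (f a)" and 2: "\<And>b. bounded_linear (\<lambda>a. f a b)"
  shows "(\<Sum>a\<in>Basis. f a a) = (\<Sum>i\<in>UNIV. f (t x i) (t x i)) + (\<Sum>\<alpha>\<in>UNIV. f (nu x \<alpha>) (nu x \<alpha>))"
proof -
  have f: "f v v = (\<Sum>b\<in>Basis. \<Sum>c\<in>Basis. ((v \<bullet> b) * (v \<bullet> c)) *\<^sub>R f b c)" for v
  proof -
    interpret f1: bounded_linear "f a" for a by (rule 1)
    interpret f2: bounded_linear "\<lambda>a. f a b" for b by (rule 2)
    have "f v v = f (\<Sum>b\<in>Basis. (v \<bullet> b) *\<^sub>R b) (\<Sum>c\<in>Basis. (v \<bullet> c) *\<^sub>R c)"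
      by (simp add: euclidean_representation)
    also have "\<dots> = (\<Sum>c\<in>Basis. \<Sum>b\<in>Basis. ((v \<bullet> b) * (v \<bullet> c)) *\<^sub>R f b c)"
      by (simp add: f1.sum f1.scaleR f2.sum f2.scaleR scaleR_sum_right mult.commute)
    also have "\<dots> = (\<Sum>b\<in>Basis. \<Sum>c\<in>Basis. ((v \<bullet> b) * (v \<bullet> c)) *\<^sub>R f b c)"
      by (rule sum.swap)
    finally show ?thesis .
  qed
  have "(\<Sum>i\<in>UNIV. f (t x i) (t x i)) + (\<Sum>\<alpha>\<in>UNIV. f (nu x \<alpha>) (nu x \<alpha>))
     = (\<Sum>b\<in>Basis. \<Sum>c\<in>Basis. (\<Sum>i\<in>UNIV. (t x i \<bullet> b) * (t x i \<bullet> c)) *\<^sub>R f b c)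
     + (\<Sum>b\<in>Basis. \<Sum>c\<in>Basis. (\<Sum>\<alpha>\<in>UNIV. (nu x \<alpha> \<bullet> b) * (nu x \<alpha> \<bullet> c)) *\<^sub>R f b c)"
  proof -
    have "(\<Sum>i\<in>I. f (u i) (u i)) = (\<Sum>b\<in>Basis. \<Sum>c\<in>Basis. (\<Sum>i\<in>I. (u i \<bullet> b) * (u i \<bullet> c)) *\<^sub>R f b c)"
      for u :: "'k \<Rightarrow> 'v" and I
    proof -
      have "(\<Sum>i\<in>I. f (u i) (u i)) = (\<Sum>i\<in>I. \<Sum>b\<in>Basis. \<Sum>c\<in>Basis. ((u i \<bullet> b) * (u i \<bullet> c)) *\<^sub>R f b c)"
        by (rule sum.cong[OF refl], rule f)
      also have "\<dots> = (\<Sum>b\<in>Basis. \<Sum>i\<in>I. \<Sum>c\<in>Basis. ((u i \<bullet> b) * (u i \<bullet> c)) *\<^sub>R f b c)"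
        by (rule sum.swap)
      also have "\<dots> = (\<Sum>b\<in>Basis. \<Sum>c\<in>Basis. \<Sum>i\<in>I. ((u i \<bullet> b) * (u i \<bullet> c)) *\<^sub>R f b c)"
        by (rule sum.cong[OF refl], rule sum.swap)
      finally show ?thesis by (simp add: scaleR_sum_left)
    qed
    note s = this
    show ?thesis unfolding s[of "t x" UNIV] s[of "nu x" UNIV] ..
  qed
  also have "\<dots> = (\<Sum>b\<in>Basis. \<Sum>c\<in>Basis. (b \<bullet> c) *\<^sub>R f b c)"
    unfolding sum.distrib[symmetric] scaleR_add_left[symmetric]
    by (intro sum.cong refl) (simp add: frame_inner[symmetric] inner_commute[of "t x _"] inner_commute[of "nu x _"])
  also have "\<dots> = (\<Sum>b\<in>Basis. \<Sum>c\<in>Basis. if b = c then f b c else 0)"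
    by (intro sum.cong refl) (simp add: inner_Basis)
  finally show ?thesis by simp
qed

text \<open>The coefficients of the second fundamental form up to sign, since the derivative falls
  on \<open>P\<close> instead of the normal field.\<close>

definition H :: "'x \<Rightarrow> 'j \<Rightarrow> 'i \<Rightarrow> 'i \<Rightarrow> real" where
  "H x \<alpha> i k = A (t x i) x (t x k) \<bullet> nu x \<alpha>"

lemma A_nu: "A (nu x \<alpha>) x = 0" using A_P_eq[of x "nu x \<alpha>"] by (simp add: nu_normal A_0)
lemma B_nu: "B (nu x \<alpha>) a x = 0" unfolding B_def by (rule D_eq_0[OF smooth_A nu_normal])
lemma C_nu: "C (nu x \<alpha>) d a x = 0" unfolding C_def by (rule D_eq_0[OF smooth_B nu_normal])

lemma inner_t_eq_0: "P x v = 0 \<Longrightarrow> v \<bullet> t x i = 0"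
  by (metis P_sym inner_zero_left t_tangent)

lemma inner_nu_eq_0: "P x v = v \<Longrightarrow> v \<bullet> nu x \<alpha> = 0"
  by (metis P_sym inner_zero_right nu_normal)

lemma P_A_t: "P x (A a x (t x k)) = 0"
  using A_P[of a x "t x k"] by (simp add: t_tangent)

lemma P_A_nu: "P x (A a x (nu x \<alpha>)) = A a x (nu x \<alpha>)"
  using A_P[of a x "nu x \<alpha>"] by (simp add: nu_normal)

lemma A_tt: "A a x (t x i) \<bullet> t x k = 0" by (rule inner_t_eq_0[OF P_A_t])
lemma A_nn: "A a x (nu x \<alpha>) \<bullet> nu x \<beta> = 0" by (rule inner_nu_eq_0[OF P_A_nu])
lemma A_tn: "A (t x i) x (t x k) \<bullet> nu x \<alpha> = H x \<alpha> i k" by (simp add: H_def)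
lemma A_nt: "A (t x i) x (nu x \<alpha>) \<bullet> t x k = H x \<alpha> i k" 
  using A_sym[of "t x i" x "nu x \<alpha>" "t x k"] by (simp add: H_def inner_commute)

lemmas A_components = A_tt A_nn A_tn A_nt

text \<open>\<open>z\<close> is always tangent, whereas \<open>A\<close> maps tangent vectors to
  normal ones; hence both parts vanish. This is the symmetry of the second fundamental form.\<close>

lemma z_tt: "z (t x i) (t x k) x = 0"
proof -
  have "P x (z (t x i) (t x k) x) = 0" by (simp add: z_def blinfun.bilinear_simps P_A_t)
  then show ?thesis by (simp add: z_tangent)
qed

lemma z_tn: "z (t x i) (nu x \<alpha>) x = A (t x i) x (nu x \<alpha>)"
  by (simp add: z_def A_nu blinfun.bilinear_simps)

lemma A_t_commute: "A (t x i) x (t x k) = A (t x k) x (t x i)"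
  using z_tt[of x i k] by (simp add: z_def)

lemma A_inner_tt: "A (t x i) x (t x k) \<bullet> A (t x l) x (t x m) = (\<Sum>\<alpha>\<in>UNIV. H x \<alpha> i k * H x \<alpha> l m)"
  by (subst frame_inner[of _ _ x]) (simp add: A_components)

lemma A_inner_nn: "A (t x i) x (nu x \<alpha>) \<bullet> A (t x l) x (nu x \<beta>) = (\<Sum>c\<in>UNIV. H x \<alpha> i c * H x \<beta> l c)"
  by (subst frame_inner[of _ _ x]) (simp add: A_components)

lemma sum_A_t: "(\<Sum>i\<in>UNIV. A (t x i) x (t x i)) = 0"
proof -
  have "(\<Sum>a\<in>Basis. A a x a) = (\<Sum>i\<in>UNIV. A (t x i) x (t x i)) + (\<Sum>\<alpha>\<in>UNIV. A (nu x \<alpha>) x (nu x \<alpha>))"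
    by (rule basis_sum[of "\<lambda>a b. A a x b"]) (rule blinfun.bounded_linear_right linear_A_apply)+
  then show ?thesis by (simp add: minimal_A A_nu)
qed

sublocale sf: second_form "H x" for x
proof
  show "H x \<alpha> i k = H x \<alpha> k i" for \<alpha> i k by (simp add: H_def A_t_commute)
  show "(\<Sum>i\<in>UNIV. H x \<alpha> i i) = 0" for \<alpha>
    using arg_cong[OF sum_A_t[of x], of "\<lambda>v. v \<bullet> nu x \<alpha>"] by (simp add: H_def inner_sum_left)
  show "(\<Sum>k\<in>UNIV. H x \<alpha> i k * H x \<beta> j k) = (\<Sum>k\<in>UNIV. H x \<alpha> j k * H x \<beta> i k)" for \<alpha> \<beta> i j
    using flat[of x i \<alpha> j \<beta>] by (simp add: A_inner_nn)
qed

lemma A_A_apply: "(\<Sum>a\<in>Basis. A a x (A a x b)) = (\<Sum>i\<in>UNIV. A (t x i) x (A (t x i) x b))"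
proof -
  have "(\<Sum>a\<in>Basis. A a x (A a x b)) = (\<Sum>i\<in>UNIV. A (t x i) x (A (t x i) x b))
     + (\<Sum>\<alpha>\<in>UNIV. A (nu x \<alpha>) x (A (nu x \<alpha>) x b))"
    by (rule basis_sum[of "\<lambda>a c. A a x (A c x b)"])
     (rule linear_A_apply bounded_linear_compose[OF blinfun.bounded_linear_right linear_A_apply])+
  then show ?thesis by (simp add: A_nu)
qed

lemma Dm_eq: "Dm x b = (\<Sum>i\<in>UNIV. A (t x i) x (A (t x i) x b))"
  by (simp add: Dm_def A_A_apply)

lemma linear_LP_apply: "linear (LP x)"
  unfolding LP_def[abs_def] by (intro linear_compose_sum ballI bounded_linear.linear blinfun.bounded_linear_right)

lemma linear_Dm_apply: "linear (Dm x)"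
  unfolding Dm_def[abs_def] by (intro linear_compose_sum ballI bounded_linear.linear
     bounded_linear_compose[OF blinfun.bounded_linear_right blinfun.bounded_linear_right])

lemma LP_sym: "LP x b \<bullet> c = b \<bullet> LP x c"
  by (simp add: LP_def inner_sum_left inner_sum_right B_sym)

lemma Dm_sym: "Dm x b \<bullet> c = b \<bullet> Dm x c"
  by (simp add: Dm_def inner_sum_left inner_sum_right A_sym)

lemma LP_P: "LP x (P x b) + 2 *\<^sub>R Dm x b + P x (LP x b) = LP x b"
proof -
  have "(\<Sum>a\<in>Basis. B a a x (P x b) + A a x (A a x b) + A a x (A a x b) + P x (B a a x b)) = LP x b"
    unfolding LP_def by (rule sum.cong[OF refl], rule B_P)
  then show ?thesis
    by (simp add: LP_def Dm_def sum.distrib blinfun.sum_right scaleR_2 algebra_simps)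
qed

lemma Dm_t_nu: "Dm x (t x k) \<bullet> nu x \<alpha> = 0"
proof -
  have "A (t x i) x (t x k) \<bullet> A (t x i) x (nu x \<alpha>) = 0" for i
    by (subst frame_inner[of _ _ x]) (simp add: A_components)
  then show ?thesis by (simp add: Dm_eq inner_sum_left A_sym)
qed

lemma sum_frame_B: "(\<Sum>a\<in>Basis. B a a x b) = (\<Sum>i\<in>UNIV. B (t x i) (t x i) x b)"
proof -
  have "(\<Sum>a\<in>Basis. B a a x b) = (\<Sum>i\<in>UNIV. B (t x i) (t x i) x b) + (\<Sum>\<alpha>\<in>UNIV. B (nu x \<alpha>) (nu x \<alpha>) x b)"
    by (rule basis_sum[of "\<lambda>a c. B a c x b"])
      (rule bounded_linear_compose[OF bounded_linear_blinfun_apply_left linear_B1]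
        bounded_linear_compose[OF bounded_linear_blinfun_apply_left linear_B2])+
  then show ?thesis by (simp add: B_nu)
qed

text \<open>The Codazzi equation: the bracket \<open>z\<close> of two tangent frame vectors vanishes
  at the point.\<close>

lemma B_t_commute: "B (t x i) (t x k) x = B (t x k) (t x i) x"
  using B_commute[of "t x i" "t x k" x] by (simp add: z_tt A_0)

text \<open>A vector normal at \<open>x\<close> acquires a tangential part nearby as the tangent
  space turns, so this derivative survives although \<open>A (nu x \<alpha>) x\<close> is zero. The
  commutator computes it.\<close>

lemma B_tn: "B (t x k) (nu x \<alpha>) x = A (A (t x k) x (nu x \<alpha>)) x"
  using B_commute[of "t x k" "nu x \<alpha>" x] by (simp add: z_tn B_nu)

lemma D_z_normal: "D d (z (t x i) (t x k)) x \<bullet> nu x \<alpha> = 0"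
  using D_z_tangent[of d x "t x i" "t x k"] by (intro inner_nu_eq_0) (simp add: z_tt blinfun.bilinear_simps)

text \<open>The mixed block of the Laplacian is a derivative of the mean curvature: the Codazzi
  equation moves k into the derivative slot, \<open>minimal_B\<close> applies, and the leftover sum
  over normal indices is tangent.\<close>

lemma LP_t_nu: "LP x (t x k) \<bullet> nu x \<alpha> = 0"
proof -
  have 1: "B (t x i) (t x i) x (t x k) \<bullet> nu x \<alpha> = B (t x k) (t x i) x (t x i) \<bullet> nu x \<alpha>" for i
  proof -
    have "B (t x i) (t x i) x (t x k) = B (t x i) (t x k) x (t x i) + D (t x i) (z (t x i) (t x k)) x"
      by (simp add: D_z)
    then show ?thesis by (simp add: inner_add_left D_z_normal B_t_commute[of x i k])
  qed
  have "(\<Sum>a\<in>Basis. B (t x k) a x a) = (\<Sum>i\<in>UNIV. B (t x k) (t x i) x (t x i))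
      + (\<Sum>\<beta>\<in>UNIV. B (t x k) (nu x \<beta>) x (nu x \<beta>))"
    by (rule basis_sum[of "\<lambda>a c. B (t x k) a x c"])
      (rule blinfun.bounded_linear_right bounded_linear_compose[OF bounded_linear_blinfun_apply_left linear_B2])+
  then have "(\<Sum>i\<in>UNIV. B (t x k) (t x i) x (t x i)) = - (\<Sum>\<beta>\<in>UNIV. B (t x k) (nu x \<beta>) x (nu x \<beta>))"
    by (simp add: minimal_B eq_neg_iff_add_eq_0)
  then have "(\<Sum>i\<in>UNIV. B (t x k) (t x i) x (t x i)) \<bullet> nu x \<alpha> = 0"
    by (simp add: inner_sum_left B_tn A_nn)
  then show ?thesis by (simp add: LP_def sum_frame_B inner_sum_left 1)
qed

text \<open>This is the harmonicity of the Gauss map (Ruh and Vilms).\<close>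

lemma LP_eq: "LP x b = 2 *\<^sub>R Dm x b - 4 *\<^sub>R P x (Dm x b)"
proof (rule frame_linear_eqI[where x = x and f = "LP x" and v = b
      and g = "\<lambda>b. 2 *\<^sub>R Dm x b - 4 *\<^sub>R P x (Dm x b)"])
  show "linear (LP x)" by (rule linear_LP_apply)
  show "linear (\<lambda>b. 2 *\<^sub>R Dm x b - 4 *\<^sub>R P x (Dm x b))"
    using linear_Dm_apply[of x] by (intro linearI) (simp_all add: linear_add linear_scale blinfun.bilinear_simps algebra_simps)
  have Pt: "P x v \<bullet> t x i = v \<bullet> t x i" for v i by (simp add: P_sym t_tangent)
  have Pn: "P x v \<bullet> nu x \<alpha> = 0" for v \<alpha> by (simp add: P_sym nu_normal)
  fix i \<alpha>
  show "LP x (t x i) = 2 *\<^sub>R Dm x (t x i) - 4 *\<^sub>R P x (Dm x (t x i))"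
  proof (rule frame_eqI[where x = x])
    fix k
    have "LP x (t x i) \<bullet> t x k + 2 * (Dm x (t x i) \<bullet> t x k) + LP x (t x i) \<bullet> t x k = LP x (t x i) \<bullet> t x k"
      using arg_cong[OF LP_P[of x "t x i"], of "\<lambda>v. v \<bullet> t x k"] by (simp add: t_tangent inner_add_left Pt)
    then show "LP x (t x i) \<bullet> t x k = (2 *\<^sub>R Dm x (t x i) - 4 *\<^sub>R P x (Dm x (t x i))) \<bullet> t x k"
      by (simp add: inner_diff_left Pt)
  next
    fix \<beta>
    show "LP x (t x i) \<bullet> nu x \<beta> = (2 *\<^sub>R Dm x (t x i) - 4 *\<^sub>R P x (Dm x (t x i))) \<bullet> nu x \<beta>"
      by (simp add: inner_diff_left Pn LP_t_nu Dm_t_nu)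
  qed
  show "LP x (nu x \<alpha>) = 2 *\<^sub>R Dm x (nu x \<alpha>) - 4 *\<^sub>R P x (Dm x (nu x \<alpha>))"
  proof (rule frame_eqI[where x = x])
    fix k
    have "LP x (nu x \<alpha>) \<bullet> t x k = 0" "Dm x (nu x \<alpha>) \<bullet> t x k = 0"
      using LP_t_nu[of x k \<alpha>] Dm_t_nu[of x k \<alpha>] LP_sym[of x "nu x \<alpha>" "t x k"] Dm_sym[of x "nu x \<alpha>" "t x k"]
      by (simp_all add: inner_commute)
    then show "LP x (nu x \<alpha>) \<bullet> t x k = (2 *\<^sub>R Dm x (nu x \<alpha>) - 4 *\<^sub>R P x (Dm x (nu x \<alpha>))) \<bullet> t x k"
      by (simp add: inner_diff_left Pt)
  next
    fix \<beta>
    have "LP x (P x (nu x \<alpha>)) = 0" by (simp add: nu_normal linear_0[OF linear_LP_apply])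
    then show "LP x (nu x \<alpha>) \<bullet> nu x \<beta> = (2 *\<^sub>R Dm x (nu x \<alpha>) - 4 *\<^sub>R P x (Dm x (nu x \<alpha>))) \<bullet> nu x \<beta>"
      using arg_cong[OF LP_P[of x "nu x \<alpha>"], of "\<lambda>v. v \<bullet> nu x \<beta>"] by (simp add: inner_add_left inner_diff_left Pn)
  qed
qed

end

section \<open>The Simons identity for flat normal bundle\<close>

context flat_minimal_immersion
begin

lemma linear_hs1: "bounded_linear (\<lambda>F. hs F G)"
  unfolding hs_def by (intro bounded_linear_sum bounded_linear_compose[OF bounded_linear_inner_left bounded_linear_blinfun_apply_left])

lemma hs_commute: "hs F G = hs G F"
  by (simp add: hs_def inner_commute)

lemma linear_hs2: "bounded_linear (hs F)"
  using linear_hs1[of F] by (simp add: hs_commute[of F, abs_def])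

lemma hs_frame:
  "hs F G = (\<Sum>l\<in>UNIV. \<Sum>m\<in>UNIV. (F (t x l) \<bullet> t x m) * (G (t x l) \<bullet> t x m))
     + (\<Sum>l\<in>UNIV. \<Sum>\<alpha>\<in>UNIV. (F (t x l) \<bullet> nu x \<alpha>) * (G (t x l) \<bullet> nu x \<alpha>))
     + (\<Sum>\<alpha>\<in>UNIV. \<Sum>l\<in>UNIV. (F (nu x \<alpha>) \<bullet> t x l) * (G (nu x \<alpha>) \<bullet> t x l))
     + (\<Sum>\<alpha>\<in>UNIV. \<Sum>\<beta>\<in>UNIV. (F (nu x \<alpha>) \<bullet> nu x \<beta>) * (G (nu x \<alpha>) \<bullet> nu x \<beta>))"
proof -
  have "hs F G = (\<Sum>l\<in>UNIV. F (t x l) \<bullet> G (t x l)) + (\<Sum>\<alpha>\<in>UNIV. F (nu x \<alpha>) \<bullet> G (nu x \<alpha>))"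
    unfolding hs_def
    by (rule basis_sum[of "\<lambda>a b. F a \<bullet> G b"])
      (rule bounded_linear_compose[OF bounded_linear_inner_right blinfun.bounded_linear_right]
       bounded_linear_compose[OF bounded_linear_inner_left blinfun.bounded_linear_right])+
  then show ?thesis
    unfolding frame_inner[of "blinfun_apply F (t x _)" "blinfun_apply G (t x _)" x]
      frame_inner[of "blinfun_apply F (nu x _)" "blinfun_apply G (nu x _)" x]
    by (simp add: sum.distrib)
qed

lemma hs_frame_sym:
  fixes F G :: "'v \<Rightarrow>\<^sub>L 'v"
  assumes "\<And>b c. F b \<bullet> c = b \<bullet> F c" "\<And>b c. G b \<bullet> c = b \<bullet> G c"
  shows "hs F G = (\<Sum>l\<in>UNIV. \<Sum>m\<in>UNIV. (F (t x l) \<bullet> t x m) * (G (t x l) \<bullet> t x m))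
     + 2 * (\<Sum>l\<in>UNIV. \<Sum>\<alpha>\<in>UNIV. (F (t x l) \<bullet> nu x \<alpha>) * (G (t x l) \<bullet> nu x \<alpha>))
     + (\<Sum>\<alpha>\<in>UNIV. \<Sum>\<beta>\<in>UNIV. (F (nu x \<alpha>) \<bullet> nu x \<beta>) * (G (nu x \<alpha>) \<bullet> nu x \<beta>))"
proof -
  have "F (nu x \<alpha>) \<bullet> t x l = F (t x l) \<bullet> nu x \<alpha>" "G (nu x \<alpha>) \<bullet> t x l = G (t x l) \<bullet> nu x \<alpha>" for \<alpha> l
    using assms(1)[of "nu x \<alpha>" "t x l"] assms(2)[of "nu x \<alpha>" "t x l"] by (simp_all add: inner_commute)
  then have "(\<Sum>\<alpha>\<in>UNIV. \<Sum>l\<in>UNIV. (F (nu x \<alpha>) \<bullet> t x l) * (G (nu x \<alpha>) \<bullet> t x l))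
    = (\<Sum>\<alpha>\<in>UNIV. \<Sum>l\<in>UNIV. (F (t x l) \<bullet> nu x \<alpha>) * (G (t x l) \<bullet> nu x \<alpha>))"
    by simp
  also have "\<dots> = (\<Sum>l\<in>UNIV. \<Sum>\<alpha>\<in>UNIV. (F (t x l) \<bullet> nu x \<alpha>) * (G (t x l) \<bullet> nu x \<alpha>))"
    by (rule sum.swap)
  finally show ?thesis using hs_frame[of F G x] by simp
qed

text \<open>\<open>A\<close> is off-diagonal, so only the mixed block of \<open>F\<close> pairs with
  it; by symmetry that block occurs twice.\<close>

lemma hs_A:
  fixes F :: "'v \<Rightarrow>\<^sub>L 'v"
  assumes "\<And>b c. F b \<bullet> c = b \<bullet> F c"
  shows "hs F (A (t x k) x) = 2 * (\<Sum>l\<in>UNIV. \<Sum>\<alpha>\<in>UNIV. (F (t x l) \<bullet> nu x \<alpha>) * H x \<alpha> k l)"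
  by (subst hs_frame_sym[where x = x, OF assms A_sym]) (simp add: A_components)

lemma hs_A_A: "hs (A (t x k) x) (A (t x l) x) = 2 * sf.ss x k l"
  by (subst hs_A[OF A_sym]) (simp add: A_components sf.ss_def sf.H_sym[of x _ k] sf.H_sym[of x _ l])

lemma e_eq_ee: "e x = sf.ee x"
proof -
  have "(\<Sum>a\<in>Basis. hs (A a x) (A a x)) = (\<Sum>i\<in>UNIV. hs (A (t x i) x) (A (t x i) x)) + (\<Sum>\<alpha>\<in>UNIV. hs (A (nu x \<alpha>) x) (A (nu x \<alpha>) x))"
    by (rule basis_sum[of "\<lambda>a b. hs (A a x) (A b x)"])
      (rule bounded_linear_compose[OF linear_hs2 linear_A] bounded_linear_compose[OF linear_hs1 linear_A])+
  also have "\<dots> = 2 * (\<Sum>k\<in>UNIV. sf.ss x k k)"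
    by (simp add: hs_A_A A_nu sum_distrib_left) (simp add: hs_def)
  also have "(\<Sum>k\<in>UNIV. sf.ss x k k) = (\<Sum>k\<in>UNIV. \<Sum>i\<in>UNIV. \<Sum>\<alpha>\<in>UNIV. H x \<alpha> i k * H x \<alpha> i k)"
    by (simp add: sf.ss_def)
  also have "\<dots> = (\<Sum>k\<in>UNIV. \<Sum>\<alpha>\<in>UNIV. \<Sum>i\<in>UNIV. H x \<alpha> i k * H x \<alpha> i k)"
    by (rule sum.cong[OF refl], rule sum.swap)
  also have "\<dots> = (\<Sum>\<alpha>\<in>UNIV. \<Sum>k\<in>UNIV. \<Sum>i\<in>UNIV. H x \<alpha> i k * H x \<alpha> i k)"
    by (rule sum.swap)
  also have "\<dots> = sf.ee x" by (simp add: sf.ee_def sf.nn_def sf.H_sym)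
  finally show ?thesis by (simp add: e_def)
qed

text \<open>The covariant derivative of the second fundamental form. No Christoffel terms appear,
  because constant vectors that are tangent at \<open>x\<close> have projections that are parallel
  there.\<close>

definition nabla_A :: "'x \<Rightarrow> 'i \<Rightarrow> 'i \<Rightarrow> 'i \<Rightarrow> 'j \<Rightarrow> real" where
  "nabla_A x i k l \<alpha> = B (t x i) (t x k) x (t x l) \<bullet> nu x \<alpha>"

lemma nabla_A_sym: "nabla_A x i k l \<alpha> = nabla_A x k i l \<alpha>"
  by (simp add: nabla_A_def B_t_commute[of x i k])

lemma nabla_A_trace: "(\<Sum>i\<in>UNIV. nabla_A x i i l \<alpha>) = 0"
  using LP_t_nu[of x l \<alpha>] by (simp add: LP_def sum_frame_B inner_sum_left nabla_A_def)

lemma B_tt: "B (t x i) (t x k) x (t x l) \<bullet> t x m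
    = - ((\<Sum>\<alpha>\<in>UNIV. H x \<alpha> k l * H x \<alpha> i m) + (\<Sum>\<alpha>\<in>UNIV. H x \<alpha> i l * H x \<alpha> k m))"
proof -
  have "P x v \<bullet> t x m = v \<bullet> t x m" for v by (simp add: P_sym t_tangent)
  then show ?thesis
    using arg_cong[OF B_P[of "t x i" "t x k" x "t x l"], of "\<lambda>v. v \<bullet> t x m"]
    by (simp add: inner_add_left t_tangent A_sym[of _ _ "A _ _ _"] A_inner_tt add.commute)
qed

lemma B_nn: "B (t x i) (t x k) x (nu x \<alpha>) \<bullet> nu x \<beta>
    = (\<Sum>c\<in>UNIV. H x \<alpha> k c * H x \<beta> i c) + (\<Sum>c\<in>UNIV. H x \<alpha> i c * H x \<beta> k c)"
proof -
  have "P x v \<bullet> nu x \<beta> = 0" for v by (simp add: P_sym nu_normal)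
  then show ?thesis
    using arg_cong[OF B_P[of "t x i" "t x k" x "nu x \<alpha>"], of "\<lambda>v. v \<bullet> nu x \<beta>"]
    by (simp add: inner_add_left nu_normal blinfun.bilinear_simps A_sym[of _ _ "A _ _ _"] A_inner_nn add.commute)
qed

lemma D_e_frame: "D (t x i) e x = 2 * (\<Sum>k\<in>UNIV. \<Sum>l\<in>UNIV. \<Sum>\<alpha>\<in>UNIV. nabla_A x i k l \<alpha> * H x \<alpha> k l)"
proof -
  have "D (t x i) e x = (\<Sum>k\<in>UNIV. hs (B (t x i) (t x k) x) (A (t x k) x))
      + (\<Sum>\<alpha>\<in>UNIV. hs (B (t x i) (nu x \<alpha>) x) (A (nu x \<alpha>) x))"
    unfolding D_e
    by (rule basis_sum[of "\<lambda>a b. hs (B (t x i) a x) (A b x)"])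
      (rule bounded_linear_compose[OF linear_hs2 linear_A] bounded_linear_compose[OF linear_hs1 linear_B2])+
  also have "\<dots> = (\<Sum>k\<in>UNIV. hs (B (t x i) (t x k) x) (A (t x k) x))"
    by (simp add: A_nu) (simp add: hs_def)
  finally show ?thesis by (simp add: hs_A[OF B_sym] nabla_A_def sum_distrib_left)
qed

lemma A_A_nu: "A (A (t x i) x (nu x \<alpha>)) x = (\<Sum>k\<in>UNIV. H x \<alpha> i k *\<^sub>R A (t x k) x)"
proof -
  interpret bounded_linear "\<lambda>a. A a x" by (rule linear_A)
  have "A (t x i) x (nu x \<alpha>) = (\<Sum>k\<in>UNIV. H x \<alpha> i k *\<^sub>R t x k)"
    using frame_expand[of "A (t x i) x (nu x \<alpha>)" x] by (simp add: A_components)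
  then show ?thesis by (simp add: sum scaleR)
qed

text \<open>Normal indices contribute through \<open>B_tn\<close>: each term is \<open>A\<close> in
  the direction of a value of a shape operator, and the pairings \<open>hs_A_A\<close> assemble to
  the square of \<open>ss\<close>.\<close>

lemma sum_hs_B_tn: "(\<Sum>i\<in>UNIV. \<Sum>\<alpha>\<in>UNIV. hs (B (t x i) (nu x \<alpha>) x) (B (t x i) (nu x \<alpha>) x)) = 2 * sf.s2 x"
proof -
  have 1: "hs (B (t x i) (nu x \<alpha>) x) (B (t x i) (nu x \<alpha>) x)
      = (\<Sum>k\<in>UNIV. \<Sum>l\<in>UNIV. (2 * sf.ss x k l) * (H x \<alpha> i k * H x \<alpha> i l))" for i \<alpha>
  proof -
    interpret h1: bounded_linear "\<lambda>F. hs F G" for G by (rule linear_hs1)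
    interpret h2: bounded_linear "hs F" for F by (rule linear_hs2)
    show ?thesis
      unfolding B_tn A_A_nu h1.sum h2.sum h1.scaleR h2.scaleR hs_A_A
      by (subst sum.swap) (simp add: sum_distrib_left mult_ac)
  qed
  have "(\<Sum>i\<in>UNIV. \<Sum>\<alpha>\<in>UNIV. hs (B (t x i) (nu x \<alpha>) x) (B (t x i) (nu x \<alpha>) x))
    = (\<Sum>q\<in>UNIV. \<Sum>k\<in>UNIV. \<Sum>l\<in>UNIV. (2 * sf.ss x k l) * (H x (snd q) (fst q) k * H x (snd q) (fst q) l))"
    by (simp add: 1 sum_UNIV_prod)
  also have "\<dots> = (\<Sum>k\<in>UNIV. \<Sum>q\<in>UNIV. \<Sum>l\<in>UNIV. (2 * sf.ss x k l) * (H x (snd q) (fst q) k * H x (snd q) (fst q) l))"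
    by (rule sum.swap)
  also have "\<dots> = (\<Sum>k\<in>UNIV. \<Sum>l\<in>UNIV. \<Sum>q\<in>UNIV. (2 * sf.ss x k l) * (H x (snd q) (fst q) k * H x (snd q) (fst q) l))"
    by (rule sum.cong[OF refl], rule sum.swap)
  also have "\<dots> = (\<Sum>k\<in>UNIV. \<Sum>l\<in>UNIV. 2 * (sf.ss x k l)\<^sup>2)"
  proof (intro sum.cong refl)
    fix k l
    have "(\<Sum>q\<in>UNIV. H x (snd q) (fst q) k * H x (snd q) (fst q) l) = sf.ss x k l"
      by (simp add: sf.ss_def sum_UNIV_prod)
    then show "(\<Sum>q\<in>UNIV. (2 * sf.ss x k l) * (H x (snd q) (fst q) k * H x (snd q) (fst q) l)) = 2 * (sf.ss x k l)\<^sup>2"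
      by (simp only: sum_distrib_left[symmetric] power2_eq_square mult.assoc)
  qed
  finally show ?thesis by (simp add: sf.s2_def sum_distrib_left)
qed

text \<open>The tangential block contributes 2 n2 + 2 s2, the normal block 4 s2, and the mixed block
  occurs twice by symmetry.\<close>

lemma sum_hs_B_tt: "(\<Sum>i\<in>UNIV. \<Sum>k\<in>UNIV. hs (B (t x i) (t x k) x) (B (t x i) (t x k) x))
   = 2 * sf.n2 x + 6 * sf.s2 x + 2 * (\<Sum>i\<in>UNIV. \<Sum>k\<in>UNIV. \<Sum>l\<in>UNIV. \<Sum>\<alpha>\<in>UNIV. (nabla_A x i k l \<alpha>)\<^sup>2)"
proof -
  have 1: "hs (B (t x i) (t x k) x) (B (t x i) (t x k) x)
    = (\<Sum>l\<in>UNIV. \<Sum>m\<in>UNIV. ((\<Sum>\<alpha>\<in>UNIV. H x \<alpha> k l * H x \<alpha> i m) + (\<Sum>\<alpha>\<in>UNIV. H x \<alpha> i l * H x \<alpha> k m))\<^sup>2)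
     + 2 * (\<Sum>l\<in>UNIV. \<Sum>\<alpha>\<in>UNIV. (nabla_A x i k l \<alpha>)\<^sup>2)
     + (\<Sum>\<alpha>\<in>UNIV. \<Sum>\<beta>\<in>UNIV. ((\<Sum>c\<in>UNIV. H x \<alpha> k c * H x \<beta> i c) + (\<Sum>c\<in>UNIV. H x \<alpha> i c * H x \<beta> k c))\<^sup>2)" for i k
    unfolding hs_frame_sym[where x = x and F = "B (t x i) (t x k) x" and G = "B (t x i) (t x k) x", OF B_sym B_sym] nabla_A_def[symmetric] B_tt B_nn
    by (simp only: power2_eq_square minus_mult_minus)
  show ?thesis
    unfolding 1 sum.distrib sum_distrib_left[symmetric] sf.sum_tangential_squares sf.sum_normal_squares
    by simp
qed

text \<open>The index k is moved past both others. Brackets of tangent frame vectors vanish at the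
  point, so only the term with the derivative of \<open>z\<close> remains.\<close>

lemma C_t: "C (t x i) (t x i) (t x k) x
    = C (t x k) (t x i) (t x i) x + A (D (t x i) (z (t x i) (t x k)) x) x"
  using C_commute2[of "t x i" "t x i" "t x k" x] C_commute[of "t x i" "t x k" "t x i" x]
  by (simp add: z_tt B_0 B_02 algebra_simps)

lemma C_tnn: "C (t x k) (nu x \<alpha>) (nu x \<alpha>) x = A (A (A (t x k) x (nu x \<alpha>)) x (nu x \<alpha>)) x"
proof -
  let ?W = "A (t x k) x (nu x \<alpha>)"
  have "C (t x k) (nu x \<alpha>) (nu x \<alpha>) x = B ?W (nu x \<alpha>) x"
    using C_commute[of "t x k" "nu x \<alpha>" "nu x \<alpha>" x] by (simp add: C_nu z_tn)
  also have "\<dots> = A (A ?W x (nu x \<alpha>)) x"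
    using B_commute[of ?W "nu x \<alpha>" x] by (simp add: B_nu z_def A_nu)
  finally show ?thesis .
qed

text \<open>The correction term in the commutator of the Laplacian with \<open>D a\<close>; by the Gauss equation its
  tangential part is twice the Ricci curvature.\<close>

definition zeta :: "'x \<Rightarrow> 'i \<Rightarrow> 'v" where
  "zeta x k = (\<Sum>i\<in>UNIV. D (t x i) (z (t x i) (t x k)) x)
     - (\<Sum>\<alpha>\<in>UNIV. A (A (t x k) x (nu x \<alpha>)) x (nu x \<alpha>))"

text \<open>A Bochner formula: the Laplacian of D a P is the derivative of the Laplacian of
  \<open>P\<close> plus a curvature term. The trace over the ambient basis also contains normal
  directions, whose contribution \<open>C_tnn\<close> is moved into \<open>zeta\<close>.\<close>

lemma sum_C_t: "(\<Sum>i\<in>UNIV. C (t x i) (t x i) (t x k) x) = (\<Sum>a\<in>Basis. C (t x k) a a x) + A (zeta x k) x"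
proof -
  interpret bounded_linear "\<lambda>a. A a x" by (rule linear_A)
  have "(\<Sum>a\<in>Basis. C (t x k) a a x) = (\<Sum>i\<in>UNIV. C (t x k) (t x i) (t x i) x)
     + (\<Sum>\<alpha>\<in>UNIV. C (t x k) (nu x \<alpha>) (nu x \<alpha>) x)"
    by (rule basis_sum[of "\<lambda>a b. C (t x k) a b x"]) (rule linear_C2 linear_C3)+
  then show ?thesis
    by (simp add: C_t C_tnn zeta_def sum.distrib diff sum)
qed

text \<open>The three parts of \<open>zeta\<close> contribute -2, +1 and -1 times \<open>ss\<close>;
  minimality removes the sum with the trace of \<open>H\<close>.\<close>

lemma zeta_t: "zeta x k \<bullet> t x m = - 2 * sf.ss x k m"
proof -
  have 1: "(\<Sum>i\<in>UNIV. B (t x i) (t x i) x (t x k) \<bullet> t x m) = - 2 * sf.ss x k m"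
    unfolding B_tt by (simp add: sf.ss_def sum_negf sum_distrib_left)
  have "(\<Sum>i\<in>UNIV. \<Sum>\<alpha>\<in>UNIV. H x \<alpha> i i * H x \<alpha> k m) = (\<Sum>\<alpha>\<in>UNIV. (\<Sum>i\<in>UNIV. H x \<alpha> i i) * H x \<alpha> k m)"
    by (subst sum.swap) (simp add: sum_distrib_right)
  then have 2: "(\<Sum>i\<in>UNIV. B (t x i) (t x k) x (t x i) \<bullet> t x m) = - sf.ss x k m"
    unfolding B_tt by (simp add: sf.ss_def sum_negf sum.distrib sum_subtractf sf.H_trace sf.H_sym[of x _ k])
  have 3: "(\<Sum>\<alpha>\<in>UNIV. A (A (t x k) x (nu x \<alpha>)) x (nu x \<alpha>) \<bullet> t x m) = sf.ss x k m"
  proof -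
    have "A (A (t x k) x (nu x \<alpha>)) x (nu x \<alpha>) \<bullet> t x m = (\<Sum>i\<in>UNIV. H x \<alpha> k i * H x \<alpha> i m)" for \<alpha>
      unfolding A_A_nu by (simp add: blinfun.sum_left blinfun.scaleR_left inner_sum_left A_components)
    then have "(\<Sum>\<alpha>\<in>UNIV. A (A (t x k) x (nu x \<alpha>)) x (nu x \<alpha>) \<bullet> t x m) = (\<Sum>\<alpha>\<in>UNIV. \<Sum>i\<in>UNIV. H x \<alpha> i k * H x \<alpha> i m)"
      by (simp add: sf.H_sym[of x _ k])
    also have "\<dots> = sf.ss x k m" unfolding sf.ss_def by (rule sum.swap)
    finally show ?thesis .
  qed
  show ?thesis
    by (simp add: zeta_def D_z inner_diff_left inner_sum_left sum_subtractf 1 2 3)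
qed

lemma hs_A_zeta: "hs (A (zeta x k) x) (A (t x k) x) = - 4 * (\<Sum>m\<in>UNIV. (sf.ss x k m)\<^sup>2)"
proof -
  interpret l: bounded_linear "\<lambda>a. A a x" by (rule linear_A)
  interpret h1: bounded_linear "\<lambda>F. hs F G" for G by (rule linear_hs1)
  have "A (zeta x k) x = A ((\<Sum>m\<in>UNIV. (zeta x k \<bullet> t x m) *\<^sub>R t x m) + (\<Sum>\<alpha>\<in>UNIV. (zeta x k \<bullet> nu x \<alpha>) *\<^sub>R nu x \<alpha>)) x"
    using frame_expand[of "zeta x k" x] by (rule arg_cong)
  also have "\<dots> = (\<Sum>m\<in>UNIV. (- 2 * sf.ss x k m) *\<^sub>R A (t x m) x)"
    by (simp only: l.add l.sum l.scaleR A_nu zeta_t) simp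
  finally have "hs (A (zeta x k) x) (A (t x k) x) = (\<Sum>m\<in>UNIV. (- 2 * sf.ss x k m) * (2 * sf.ss x k m))"
    by (simp only: h1.sum h1.scaleR hs_A_A sf.ss_sym[of x _ k] real_scaleR_def)
  then show ?thesis by (simp add: sum_distrib_left power2_eq_square)
qed

lemma D_Dm_tn: "D (t x k) (\<lambda>y. Dm y (t x l)) x \<bullet> nu x \<alpha>
   = (\<Sum>i\<in>UNIV. (\<Sum>\<beta>\<in>UNIV. H x \<beta> i l * ((\<Sum>c\<in>UNIV. H x \<beta> i c * H x \<alpha> k c) + (\<Sum>c\<in>UNIV. H x \<beta> k c * H x \<alpha> i c)))
         - (\<Sum>m\<in>UNIV. ((\<Sum>\<gamma>\<in>UNIV. H x \<gamma> i l * H x \<gamma> k m) + (\<Sum>\<gamma>\<in>UNIV. H x \<gamma> k l * H x \<gamma> i m)) * H x \<alpha> i m))"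
proof -
  let ?d = "t x k" and ?b = "t x l"
  have "D ?d (\<lambda>y. Dm y ?b) x = (\<Sum>i\<in>UNIV. B ?d (t x i) x (A (t x i) x ?b) + A (t x i) x (B ?d (t x i) x ?b))
     + (\<Sum>\<alpha>\<in>UNIV. B ?d (nu x \<alpha>) x (A (nu x \<alpha>) x ?b) + A (nu x \<alpha>) x (B ?d (nu x \<alpha>) x ?b))"
    unfolding D_Dm
    by (rule basis_sum[of "\<lambda>a c. B ?d a x (A c x ?b) + A a x (B ?d c x ?b)"])
      (intro bounded_linear_add
         bounded_linear_compose[OF blinfun.bounded_linear_right linear_A_apply]
         bounded_linear_compose[OF blinfun.bounded_linear_right bounded_linear_compose[OF bounded_linear_blinfun_apply_left linear_B2]]
         bounded_linear_compose[OF bounded_linear_blinfun_apply_left linear_B2] linear_A_apply)+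
  then have 1: "D ?d (\<lambda>y. Dm y ?b) x \<bullet> nu x \<alpha> = (\<Sum>i\<in>UNIV. A (t x i) x ?b \<bullet> B ?d (t x i) x (nu x \<alpha>) 
      + B ?d (t x i) x ?b \<bullet> A (t x i) x (nu x \<alpha>))"
    by (simp add: A_nu inner_sum_left inner_add_left A_sym[of _ _ "B _ _ _ _"] B_sym[of _ _ _ "A _ _ _"])
  have 2: "A (t x i) x ?b \<bullet> B ?d (t x i) x (nu x \<alpha>) 
     = (\<Sum>\<beta>\<in>UNIV. H x \<beta> i l * ((\<Sum>c\<in>UNIV. H x \<beta> i c * H x \<alpha> k c) + (\<Sum>c\<in>UNIV. H x \<beta> k c * H x \<alpha> i c)))" for i
    by (subst frame_inner[of _ _ x]) (simp add: A_components B_nn mult.commute[of "H x \<alpha> _ _"] add.commute)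
  have 3: "B ?d (t x i) x ?b \<bullet> A (t x i) x (nu x \<alpha>)
    = - (\<Sum>m\<in>UNIV. ((\<Sum>\<gamma>\<in>UNIV. H x \<gamma> i l * H x \<gamma> k m) + (\<Sum>\<gamma>\<in>UNIV. H x \<gamma> k l * H x \<gamma> i m)) * H x \<alpha> i m)" for i
    by (subst frame_inner[of _ _ x]) (simp only: A_components B_tt sum_negf mult_minus_left mult_zero_right sum.neutral_const add_0_right)
  show ?thesis unfolding 1 2 3 by simp
qed

lemma A_Dm_tn: "A (t x k) x (Dm x (t x l)) \<bullet> nu x \<alpha> = (\<Sum>m\<in>UNIV. sf.ss x l m * H x \<alpha> k m)"
proof -
  have 1: "Dm x (t x l) \<bullet> t x m = sf.ss x l m" for m
    by (simp add: Dm_eq inner_sum_left A_sym[of _ _ "A _ _ _"] A_inner_tt sf.ss_def)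
  show ?thesis unfolding A_sym
    by (subst frame_inner[of _ _ x]) (simp add: A_components 1)
qed

text \<open>\<open>LP_eq\<close> holds at every point and is differentiated along t_k with t_l kept
  as a constant vector. In the derivative of P(Dm) only the part that differentiates
  \<open>P\<close> has a normal component.\<close>

lemma sum_C_normal: "(\<Sum>a\<in>Basis. C (t x k) a a x (t x l)) \<bullet> nu x \<alpha>
   = 2 * (D (t x k) (\<lambda>y. Dm y (t x l)) x \<bullet> nu x \<alpha>) - 4 * (\<Sum>m\<in>UNIV. sf.ss x l m * H x \<alpha> k m)"
proof -
  let ?b = "t x l" and ?d = "t x k"
  have "(\<Sum>a\<in>Basis. C ?d a a x ?b) = D ?d (\<lambda>y. 2 *\<^sub>R Dm y ?b - 4 *\<^sub>R P y (Dm y ?b)) x"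
    unfolding D_LP[symmetric] LP_eq ..
  also have "\<dots> = 2 *\<^sub>R D ?d (\<lambda>y. Dm y ?b) x - 4 *\<^sub>R (P x (D ?d (\<lambda>y. Dm y ?b) x) + A ?d x (Dm x ?b))"
    by (simp add: D_diff D_scaleR D_apply smooths smooth_Dm A_def)
  finally show ?thesis
    by (simp add: inner_diff_left inner_add_left A_Dm_tn P_sym nu_normal)
qed

text \<open>The squares of \<open>B\<close> contribute the squares of \<open>nabla_A\<close> twice
  plus 2 n2 + 8 s2, the derivative of \<open>LP\<close> contributes -4 n2 - 4 s2, and the curvature
  term -4 s2. All of \<open>s2\<close> cancels; the commutators of shape operators present in
  general codimension vanish by flatness.\<close>

lemma simons: "(\<Sum>i\<in>UNIV. D (t x i) (D (t x i) e) x)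
   = 2 * (\<Sum>i\<in>UNIV. \<Sum>k\<in>UNIV. \<Sum>l\<in>UNIV. \<Sum>\<alpha>\<in>UNIV. (nabla_A x i k l \<alpha>)\<^sup>2) - 2 * sf.n2 x"
proof -
  let ?C = "\<lambda>k. \<Sum>a\<in>Basis. C (t x k) a a x"
  have "D (t x i) (D (t x i) e) x = (\<Sum>k\<in>UNIV. hs (C (t x i) (t x i) (t x k) x) (A (t x k) x) + hs (B (t x i) (t x k) x) (B (t x i) (t x k) x))
     + (\<Sum>\<alpha>\<in>UNIV. hs (C (t x i) (t x i) (nu x \<alpha>) x) (A (nu x \<alpha>) x) + hs (B (t x i) (nu x \<alpha>) x) (B (t x i) (nu x \<alpha>) x))" for i
    unfolding D_D_e
    by (rule basis_sum[of "\<lambda>a b. hs (C (t x i) (t x i) a x) (A b x) + hs (B (t x i) a x) (B (t x i) b x)"])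
      (intro bounded_linear_add bounded_linear_compose[OF linear_hs2 linear_A] bounded_linear_compose[OF linear_hs2 linear_B2]
         bounded_linear_compose[OF linear_hs1 linear_C3] bounded_linear_compose[OF linear_hs1 linear_B2])+
  then have "D (t x i) (D (t x i) e) x = (\<Sum>k\<in>UNIV. hs (C (t x i) (t x i) (t x k) x) (A (t x k) x))
      + (\<Sum>k\<in>UNIV. hs (B (t x i) (t x k) x) (B (t x i) (t x k) x))
     + (\<Sum>\<alpha>\<in>UNIV. hs (B (t x i) (nu x \<alpha>) x) (B (t x i) (nu x \<alpha>) x))" for i
    by (simp add: A_nu sum.distrib linear_simps(3)[OF linear_hs2])
  then have 1: "(\<Sum>i\<in>UNIV. D (t x i) (D (t x i) e) x)
     = (\<Sum>i\<in>UNIV. \<Sum>k\<in>UNIV. hs (C (t x i) (t x i) (t x k) x) (A (t x k) x))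
      + (2 * sf.n2 x + 6 * sf.s2 x + 2 * (\<Sum>i\<in>UNIV. \<Sum>k\<in>UNIV. \<Sum>l\<in>UNIV. \<Sum>\<alpha>\<in>UNIV. (nabla_A x i k l \<alpha>)\<^sup>2)) + 2 * sf.s2 x"
    by (simp only: sum.distrib sum_hs_B_tt sum_hs_B_tn)
  have "(\<Sum>i\<in>UNIV. \<Sum>k\<in>UNIV. hs (C (t x i) (t x i) (t x k) x) (A (t x k) x))
     = (\<Sum>k\<in>UNIV. hs (\<Sum>i\<in>UNIV. C (t x i) (t x i) (t x k) x) (A (t x k) x))"
  proof -
    interpret h1: bounded_linear "\<lambda>F. hs F G" for G by (rule linear_hs1)
    show ?thesis by (subst sum.swap) (simp add: h1.sum)
  qed
  also have "\<dots> = (\<Sum>k\<in>UNIV. hs (?C k) (A (t x k) x)) + (\<Sum>k\<in>UNIV. hs (A (zeta x k) x) (A (t x k) x))"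
    unfolding sum_C_t by (simp add: linear_simps(1)[OF linear_hs1] sum.distrib)
  also have "(\<Sum>k\<in>UNIV. hs (A (zeta x k) x) (A (t x k) x)) = - 4 * sf.s2 x"
    unfolding hs_A_zeta sf.s2_def by (simp add: sum_distrib_left)
  also have "(\<Sum>k\<in>UNIV. hs (?C k) (A (t x k) x)) = 2 * (- 2 * sf.s2 x - 2 * sf.n2 x)"
  proof -
    have sy: "blinfun_apply (?C k) b \<bullet> c = b \<bullet> ?C k c" for b c k
      by (simp add: blinfun.sum_left inner_sum_left inner_sum_right C_sym)
    have "hs (?C k) (A (t x k) x) = 2 * (\<Sum>l\<in>UNIV. \<Sum>\<alpha>\<in>UNIV. H x \<alpha> k l *
       (2 * (D (t x k) (\<lambda>y. Dm y (t x l)) x \<bullet> nu x \<alpha>) - 4 * (\<Sum>m\<in>UNIV. sf.ss x l m * H x \<alpha> k m)))" for k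
      unfolding hs_A[OF sy] by (simp add: blinfun.sum_left sum_C_normal mult.commute)
    then show ?thesis
      unfolding sf.sum_derivative_terms[of x, symmetric] D_Dm_tn by (simp only: sum_distrib_left)
  qed
  finally show ?thesis unfolding 1 by simp
qed

text \<open>Kato is used with the pair (l, \<alpha>) as last index, then \<open>simons\<close> and
  \<open>n2_le\<close>. Multiplication by e keeps the inequality meaningful at zeros of e.\<close>

lemma simons_kato:
  "(1 + 1 / real CARD('i)) * (\<Sum>i\<in>UNIV. (D (t x i) e x)\<^sup>2)
     \<le> 2 * e x * (\<Sum>i\<in>UNIV. D (t x i) (D (t x i) e) x) + 4 * (e x) ^ 3"
proof -
  define BB where "BB = (\<Sum>i\<in>UNIV. \<Sum>k\<in>UNIV. \<Sum>l\<in>UNIV. \<Sum>\<alpha>\<in>UNIV. (nabla_A x i k l \<alpha>)\<^sup>2)"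
  let ?B = "\<lambda>i k m. nabla_A x i k (fst m) (snd m)" and ?h = "\<lambda>k m. H x (snd m) k (fst m)"
  have "(1 + 1 / real CARD('i)) * (\<Sum>i\<in>UNIV. (\<Sum>k\<in>UNIV. \<Sum>m\<in>UNIV. ?B i k m * ?h k m)\<^sup>2)
     \<le> (\<Sum>k\<in>UNIV. \<Sum>m\<in>UNIV. (?h k m)\<^sup>2) * (\<Sum>i\<in>UNIV. \<Sum>k\<in>UNIV. \<Sum>m\<in>UNIV. (?B i k m)\<^sup>2)"
    by (rule kato_inequality) (rule nabla_A_sym nabla_A_trace)+
  also have "(\<Sum>i\<in>UNIV. \<Sum>k\<in>UNIV. \<Sum>m\<in>UNIV. (?B i k m)\<^sup>2) = BB"
    by (simp add: sum_UNIV_prod BB_def)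
  also have "(\<Sum>k\<in>UNIV. \<Sum>m\<in>UNIV. (?h k m)\<^sup>2) = e x"
  proof -
    have "(\<Sum>k\<in>UNIV. \<Sum>m\<in>UNIV. (?h k m)\<^sup>2) = (\<Sum>k\<in>UNIV. \<Sum>l\<in>UNIV. \<Sum>\<alpha>\<in>UNIV. H x \<alpha> k l * H x \<alpha> k l)"
      by (simp add: sum_UNIV_prod power2_eq_square)
    also have "\<dots> = (\<Sum>k\<in>UNIV. \<Sum>\<alpha>\<in>UNIV. \<Sum>l\<in>UNIV. H x \<alpha> k l * H x \<alpha> k l)"
      by (rule sum.cong[OF refl], rule sum.swap)
    also have "\<dots> = (\<Sum>\<alpha>\<in>UNIV. \<Sum>k\<in>UNIV. \<Sum>l\<in>UNIV. H x \<alpha> k l * H x \<alpha> k l)"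
      by (rule sum.swap)
    finally show ?thesis by (simp add: e_eq_ee sf.ee_def sf.nn_def)
  qed
  also have "(\<Sum>i\<in>UNIV. (\<Sum>k\<in>UNIV. \<Sum>m\<in>UNIV. ?B i k m * ?h k m)\<^sup>2) = (\<Sum>i\<in>UNIV. (D (t x i) e x)\<^sup>2) / 4"
    by (simp add: sum_UNIV_prod D_e_frame power_mult_distrib sum_divide_distrib)
  finally have 1: "(1 + 1 / real CARD('i)) * (\<Sum>i\<in>UNIV. (D (t x i) e x)\<^sup>2) \<le> 4 * (e x * BB)"
    by simp
  have e0: "e x \<ge> 0" by (simp add: e_def hs_def sum_nonneg)
  have "4 * e x * sf.n2 x \<le> 4 * e x * (e x)\<^sup>2"
    using e0 sf.n2_le[of x] by (intro mult_left_mono) (auto simp: e_eq_ee)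
  then have "4 * (e x * BB) \<le> 2 * e x * (2 * BB - 2 * sf.n2 x) + 4 * (e x) ^ 3"
    by (simp add: algebra_simps power2_eq_square power3_eq_cube)
  with 1 show ?thesis unfolding simons BB_def by linarith
qed

end

section \<open>The volume density and the maximum principle\<close>

context minimal_immersion
begin

text \<open>\<open>oblique\<close> is the projection onto the tangent space along the kernel of \<open>E\<close>, and \<open>dlog a\<close> is
  the derivative along \<open>a\<close> of the logarithm of the volume density of the graph.\<close>

definition oblique :: "'v \<Rightarrow> 'x \<Rightarrow> 'v" where "oblique b = dird (E b) X"

definition dlog :: "'v \<Rightarrow> 'x \<Rightarrow> real" where "dlog a x = - (\<Sum>b\<in>Basis. oblique b x \<bullet> A a x b)"

lemma smooth_oblique: "smooth_on UNIV (oblique b)"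
  unfolding oblique_def by (intro smooths)

lemma smooth_dlog: "smooth_on UNIV (dlog a)"
  unfolding dlog_def[abs_def] by (intro smooths smooth_oblique smooth_A)

lemma linear_oblique: "bounded_linear (\<lambda>b. oblique b x)"
  unfolding oblique_def using bounded_linear_compose[OF dird_bounded_linear[OF smooth_X] linear_E] .

lemma P_oblique: "P x (oblique b x) = oblique b x"
  by (simp add: oblique_def P_dX)

lemma oblique_tangent: "P x b = b \<Longrightarrow> oblique b x = b"
  using dX_E_P[of x b] by (simp add: oblique_def)

text \<open>\<open>oblique b\<close> is characterised by being tangent and having the constant image
  E b under \<open>E\<close>; both conditions are differentiated.\<close>

lemma D_oblique: "D d (oblique b) x = A d x (oblique b x) - oblique (A d x (oblique b x)) x"
proof -
  let ?w = "D d (oblique b) x" and ?v = "A d x (oblique b x)"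
  interpret E: bounded_linear E by (rule linear_E)
  interpret o: bounded_linear "\<lambda>b. oblique b x" by (rule linear_oblique)
  have "D d (\<lambda>x. P x (oblique b x)) x = ?w" by (simp add: P_oblique)
  then have 1: "P x ?w + ?v = ?w" by (simp add: D_apply smooths smooth_oblique A_def)
  have "D d (\<lambda>x. E (oblique b x)) x = 0" by (simp add: oblique_def E_dX)
  then have 2: "E ?w = 0" unfolding D_def by (simp add: dird_linear[OF linear_E smooth_oblique])
  have "P x ?w = oblique (P x ?w) x" by (simp add: oblique_tangent P_idem)
  also have "P x ?w = ?w - ?v" using 1 by (simp add: algebra_simps)
  finally have "?w - ?v = oblique ?w x - oblique ?v x" by (simp add: o.diff)
  moreover have "oblique ?w x = 0" using 2 linear_simps(3)[OF dird_bounded_linear[OF smooth_X]]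
    by (simp add: oblique_def)
  ultimately show ?thesis by (simp add: algebra_simps)
qed

lemma D_dlog: "D d (dlog a) x = - (\<Sum>b\<in>Basis. oblique b x \<bullet> B d a x b + D d (oblique b) x \<bullet> A a x b)"
  unfolding dlog_def[abs_def]
  by (simp add: D_minus D_sum D_inner D_apply_const smooths smooth_oblique smooth_A B_def)

text \<open>If c were positive, q' would be positive just to the right of 0, and the mean value
  theorem would push q above its value at 0.\<close>

lemma local_max_second_derivative_nonpos:
  fixes q q' :: "real \<Rightarrow> real"
  assumes q: "\<And>s. (q has_real_derivative q' s) (at s)" and q': "(q' has_real_derivative c) (at 0)"
    and max: "\<epsilon> > 0" "\<And>s. \<bar>s\<bar> < \<epsilon> \<Longrightarrow> q s \<le> q 0"
  shows "q' 0 = 0" "c \<le> 0"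
proof -
  show 0: "q' 0 = 0"
    by (rule DERIV_local_max[OF q[of 0] max(1)]) (use max(2) in auto)
  show "c \<le> 0"
  proof (rule ccontr)
    assume "\<not> c \<le> 0"
    then have "c > 0" by simp
    from DERIV_pos_inc_right[OF q' this] obtain \<delta> where \<delta>: "\<delta> > 0" "\<And>h. h > 0 \<Longrightarrow> h < \<delta> \<Longrightarrow> q' 0 < q' h"
      by auto
    define s where "s = min \<delta> \<epsilon> / 2"
    have s: "s > 0" "s < \<delta>" "s < \<epsilon>" using \<delta>(1) max(1) by (auto simp: s_def)
    from MVT2[OF s(1), of q q'] q obtain r where r: "0 < r" "r < s" "q s - q 0 = (s - 0) * q' r" by blast
    have "q' r > 0" using \<delta>(2)[of r] r s 0 by simp
    then have "q s > q 0" using r s by (simp add: algebra_simps mult_pos_pos)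
    then show False using max(2)[of s] s by simp
  qed
qed

text \<open>Tested along straight lines in the chart. D a (D a \<phi>) differs from a second
  directional derivative by a first derivative of \<phi>, which vanishes at p.\<close>

lemma local_max_D:
  fixes \<phi> :: "'x \<Rightarrow> real"
  assumes \<phi>: "smooth_on UNIV \<phi>" and U: "open U" "p \<in> U" and max: "\<And>y. y \<in> U \<Longrightarrow> \<phi> y \<le> \<phi> p"
  shows "D a \<phi> p = 0" "D a (D a \<phi>) p \<le> 0"
proof -
  obtain r where r: "r > 0" "ball p r \<subseteq> U" using U openE by blast
  have *: "dird w \<phi> p = 0 \<and> dird w (dird w \<phi>) p \<le> 0" for w
  proof -
    define q where "q s = \<phi> (p + s *\<^sub>R w)" for s
    define q' where "q' s = dird w \<phi> (p + s *\<^sub>R w)" for s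
    define \<epsilon> where "\<epsilon> = r / (norm w + 1)"
    have "\<epsilon> > 0" using r by (simp add: \<epsilon>_def add_nonneg_pos)
    moreover have "q s \<le> q 0" if "\<bar>s\<bar> < \<epsilon>" for s
    proof -
      have "\<bar>s\<bar> * norm w \<le> \<bar>s\<bar> * (norm w + 1)" by (simp add: mult_left_mono)
      also have "\<dots> < \<epsilon> * (norm w + 1)" using that by (intro mult_strict_right_mono) (simp_all add: add_nonneg_pos)
      also have "\<dots> = r" by (simp add: \<epsilon>_def add_nonneg_pos less_imp_neq[symmetric] add_nonneg_eq_0_iff)
      finally have "p + s *\<^sub>R w \<in> ball p r" by (simp add: dist_norm)
      then show ?thesis using max r by (auto simp: q_def)
    qed
    moreover have "(q has_real_derivative q' s) (at s)" for s
      unfolding q_def q'_def by (rule smooth_has_real_derivative_line[OF \<phi>])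
    moreover have "(q' has_real_derivative dird w (dird w \<phi>) p) (at 0)"
      unfolding q'_def using smooth_has_real_derivative_line[OF smooth_dird[OF \<phi>, of w], where x = p and h = w and s = 0] by simp
    ultimately have "q' 0 = 0" "dird w (dird w \<phi>) p \<le> 0"
      using local_max_second_derivative_nonpos[of q q' "dird w (dird w \<phi>) p" \<epsilon>] by auto
    then show ?thesis by (simp add: q'_def)
  qed
  show "D a \<phi> p = 0" using * by (simp add: D_def)
  show "D a (D a \<phi>) p \<le> 0"
    using * unfolding D_def[of a \<phi>, abs_def] by (simp add: D_def dird_dird_field[OF \<phi> smooth_EP])
qed

end

section \<open>The Laplacian of the logarithm of the volume density\<close>

context flat_minimal_immersion
begin

lemma oblique_t: "oblique (t x k) x = t x k"
  by (simp add: oblique_tangent t_tangent)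

lemma oblique_nu_nu: "oblique b x \<bullet> nu x \<beta> = 0"
  by (rule inner_nu_eq_0[OF P_oblique])

text \<open>The oblique projection is the identity on tangent vectors, so its matrix on the normal
  space carries all information on the tilt of the tangent space against the chart.\<close>

definition \<sigma> :: "'x \<Rightarrow> 'j \<Rightarrow> 'i \<Rightarrow> real" where "\<sigma> x \<alpha> k = oblique (nu x \<alpha>) x \<bullet> t x k"

lemma oblique_nu: "oblique (nu x \<alpha>) x = (\<Sum>k\<in>UNIV. \<sigma> x \<alpha> k *\<^sub>R t x k)"
  using frame_expand[of "oblique (nu x \<alpha>) x" x] by (simp add: oblique_nu_nu \<sigma>_def)

lemma dlog_frame: "dlog (t x i) x = - (\<Sum>\<alpha>\<in>UNIV. \<Sum>j\<in>UNIV. \<sigma> x \<alpha> j * H x \<alpha> i j)"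
proof -
  have "(\<Sum>b\<in>Basis. oblique b x \<bullet> A (t x i) x b)
    = (\<Sum>k\<in>UNIV. oblique (t x k) x \<bullet> A (t x i) x (t x k)) + (\<Sum>\<alpha>\<in>UNIV. oblique (nu x \<alpha>) x \<bullet> A (t x i) x (nu x \<alpha>))"
    by (rule basis_sum[of "\<lambda>b c. oblique b x \<bullet> A (t x i) x c"])
      (rule bounded_linear_compose[OF bounded_linear_inner_right blinfun.bounded_linear_right]
       bounded_linear_compose[OF bounded_linear_inner_left linear_oblique])+
  then show ?thesis
    by (simp add: dlog_def oblique_t oblique_nu inner_sum_left A_components inner_commute[of "t x _"])
qed

text \<open>Of the three sums in the derivative of \<open>dlog\<close>, the one with
  \<open>LP\<close> gives 2e, the one with two factors \<open>A\<close> gives -e, and the one with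
  the derivative of the oblique direction becomes the squared gradient.\<close>

lemma sum_D_dlog: "(\<Sum>i\<in>UNIV. D (t x i) (dlog (t x i)) x) = e x + (\<Sum>i\<in>UNIV. (dlog (t x i) x)\<^sup>2)"
proof -
  let ?A = "\<lambda>i b. blinfun_apply (A (t x i) x) b"
  interpret o: bounded_linear "\<lambda>b. oblique b x" by (rule linear_oblique)
  have Dtt: "Dm x (t x k) \<bullet> t x k = sf.ss x k k" for k
    by (simp add: Dm_eq inner_sum_left A_sym[of _ _ "A _ _ _"] A_inner_tt sf.ss_def)
  have tr: "(\<Sum>k\<in>UNIV. sf.ss x k k) = e x"
  proof -
    have "(\<Sum>k\<in>UNIV. sf.ss x k k) = (\<Sum>k\<in>UNIV. \<Sum>\<alpha>\<in>UNIV. \<Sum>i\<in>UNIV. H x \<alpha> i k * H x \<alpha> i k)"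
      unfolding sf.ss_def by (rule sum.cong[OF refl], rule sum.swap)
    also have "\<dots> = (\<Sum>\<alpha>\<in>UNIV. \<Sum>k\<in>UNIV. \<Sum>i\<in>UNIV. H x \<alpha> i k * H x \<alpha> i k)"
      by (rule sum.swap)
    finally show ?thesis by (simp add: e_eq_ee sf.ee_def sf.nn_def sf.H_sym)
  qed
  have 1: "(\<Sum>b\<in>Basis. oblique b x \<bullet> LP x b) = - 2 * e x"
  proof -
    have "(\<Sum>b\<in>Basis. oblique b x \<bullet> LP x b)
      = (\<Sum>k\<in>UNIV. oblique (t x k) x \<bullet> LP x (t x k)) + (\<Sum>\<alpha>\<in>UNIV. oblique (nu x \<alpha>) x \<bullet> LP x (nu x \<alpha>))"
    proof (rule basis_sum[of "\<lambda>b c. oblique b x \<bullet> LP x c"])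
      have "bounded_linear (LP x)" unfolding LP_def[abs_def]
        by (intro bounded_linear_sum blinfun.bounded_linear_right)
      then show "bounded_linear (\<lambda>c. oblique b x \<bullet> LP x c)" for b
        by (rule bounded_linear_compose[OF bounded_linear_inner_right])
    qed (rule bounded_linear_compose[OF bounded_linear_inner_left linear_oblique])
    moreover have "oblique (nu x \<alpha>) x \<bullet> LP x (nu x \<alpha>) = 0" for \<alpha>
    proof -
      have "t x k \<bullet> LP x (nu x \<alpha>) = 0" for k by (metis LP_sym LP_t_nu)
      then show ?thesis by (simp add: oblique_nu inner_sum_left)
    qed
    moreover have "oblique (t x k) x \<bullet> LP x (t x k) = - 2 * sf.ss x k k" for k
    proof -
      have "t x k \<bullet> P x (Dm x (t x k)) = t x k \<bullet> Dm x (t x k)"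
        using P_sym[of x "t x k"] by (simp add: t_tangent)
      then show ?thesis
        using Dtt[of k] by (simp add: oblique_t LP_eq inner_diff_right inner_commute)
    qed
    ultimately show ?thesis by (simp add: sum_distrib_left[symmetric] sum_negf tr)
  qed
  have 2: "(\<Sum>b\<in>Basis. ?A i (oblique b x) \<bullet> ?A i b) = (\<Sum>k\<in>UNIV. ?A i (t x k) \<bullet> ?A i (t x k))" for i
  proof -
    have "(\<Sum>b\<in>Basis. ?A i (oblique b x) \<bullet> ?A i b)
      = (\<Sum>k\<in>UNIV. ?A i (oblique (t x k) x) \<bullet> ?A i (t x k)) + (\<Sum>\<alpha>\<in>UNIV. ?A i (oblique (nu x \<alpha>) x) \<bullet> ?A i (nu x \<alpha>))"
      by (rule basis_sum[of "\<lambda>b c. ?A i (oblique b x) \<bullet> ?A i c"])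
       (rule bounded_linear_compose[OF bounded_linear_inner_right blinfun.bounded_linear_right]
        bounded_linear_compose[OF bounded_linear_inner_left bounded_linear_compose[OF blinfun.bounded_linear_right linear_oblique]])+
    moreover have "?A i (t x k) \<bullet> ?A i (nu x \<alpha>) = 0" for k \<alpha>
      by (subst frame_inner[of _ _ x]) (simp add: A_components)
    ultimately show ?thesis
      by (simp add: oblique_t oblique_nu blinfun.sum_right blinfun.scaleR_right inner_sum_left)
  qed
  have ee2: "(\<Sum>i\<in>UNIV. \<Sum>k\<in>UNIV. ?A i (t x k) \<bullet> ?A i (t x k)) = e x"
    unfolding tr[symmetric] sf.ss_def A_inner_tt by (rule sum.swap)
  have 3: "(\<Sum>b\<in>Basis. oblique (?A i (oblique b x)) x \<bullet> ?A i b)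
     = (\<Sum>\<alpha>\<in>UNIV. \<Sum>j\<in>UNIV. \<Sum>\<beta>\<in>UNIV. \<Sum>k\<in>UNIV. (\<sigma> x \<alpha> j * \<sigma> x \<beta> k) * (H x \<beta> i j * H x \<alpha> i k))" for i
  proof -
    have "(\<Sum>b\<in>Basis. oblique (?A i (oblique b x)) x \<bullet> ?A i b)
      = (\<Sum>k\<in>UNIV. oblique (?A i (oblique (t x k) x)) x \<bullet> ?A i (t x k)) 
      + (\<Sum>\<alpha>\<in>UNIV. oblique (?A i (oblique (nu x \<alpha>) x)) x \<bullet> ?A i (nu x \<alpha>))"
      by (rule basis_sum[of "\<lambda>b c. oblique (?A i (oblique b x)) x \<bullet> ?A i c"])
       (rule bounded_linear_compose[OF bounded_linear_inner_right blinfun.bounded_linear_right]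
        bounded_linear_compose[OF bounded_linear_inner_left bounded_linear_compose[OF linear_oblique 
           bounded_linear_compose[OF blinfun.bounded_linear_right linear_oblique]]])+
    moreover have "oblique v x \<bullet> ?A i (t x k) = 0" for v k
      by (subst frame_inner[of _ _ x]) (simp add: A_components oblique_nu_nu)
    moreover have At: "?A i (t x j) = (\<Sum>\<beta>\<in>UNIV. H x \<beta> i j *\<^sub>R nu x \<beta>)" for j
      using frame_expand[of "?A i (t x j)" x] by (simp add: A_components)
    have "oblique (?A i (oblique (nu x \<alpha>) x)) x \<bullet> ?A i (nu x \<alpha>) 
        = (\<Sum>j\<in>UNIV. \<Sum>\<beta>\<in>UNIV. \<Sum>k\<in>UNIV. (\<sigma> x \<alpha> j * \<sigma> x \<beta> k) * (H x \<beta> i j * H x \<alpha> i k))" for \<alpha>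
      by (simp add: oblique_nu blinfun.sum_right blinfun.scaleR_right At o.sum o.scaleR inner_sum_left
           A_components inner_commute[of "t x _"] sum_distrib_left mult_ac)
    ultimately show ?thesis by simp
  qed
  have 4: "(\<Sum>i\<in>UNIV. \<Sum>\<alpha>\<in>UNIV. \<Sum>j\<in>UNIV. \<Sum>\<beta>\<in>UNIV. \<Sum>k\<in>UNIV. (\<sigma> x \<alpha> j * \<sigma> x \<beta> k) * (H x \<beta> i j * H x \<alpha> i k))
     = (\<Sum>i\<in>UNIV. (dlog (t x i) x)\<^sup>2)"
  proof -
    let ?p = "\<lambda>i p. \<sigma> x (fst p) (snd p) * H x (fst p) i (snd p)"
    \<comment> \<open>Flatness exchanges j and k, so that each \<sigma> meets the \<open>H\<close>
      with its own indices and the sum becomes a square.\<close>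
    have fl: "(\<Sum>i\<in>UNIV. H x \<beta> i j * H x \<alpha> i k) = (\<Sum>i\<in>UNIV. H x \<beta> i k * H x \<alpha> i j)" for \<alpha> \<beta> j k
      using sf.H_flat[of x \<beta> j \<alpha> k] by (simp add: sf.H_sym[of x _ j] sf.H_sym[of x _ k])
    have "(\<Sum>i\<in>UNIV. \<Sum>\<alpha>\<in>UNIV. \<Sum>j\<in>UNIV. \<Sum>\<beta>\<in>UNIV. \<Sum>k\<in>UNIV. (\<sigma> x \<alpha> j * \<sigma> x \<beta> k) * (H x \<beta> i j * H x \<alpha> i k))
      = (\<Sum>i\<in>UNIV. \<Sum>p\<in>UNIV. \<Sum>q\<in>UNIV. (\<sigma> x (fst p) (snd p) * \<sigma> x (fst q) (snd q)) * (H x (fst q) i (snd p) * H x (fst p) i (snd q)))"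
      by (simp add: sum_UNIV_prod)
    also have "\<dots> = (\<Sum>p\<in>UNIV. \<Sum>i\<in>UNIV. \<Sum>q\<in>UNIV. (\<sigma> x (fst p) (snd p) * \<sigma> x (fst q) (snd q)) * (H x (fst q) i (snd p) * H x (fst p) i (snd q)))"
      by (rule sum.swap)
    also have "\<dots> = (\<Sum>p\<in>UNIV. \<Sum>q\<in>UNIV. \<Sum>i\<in>UNIV. (\<sigma> x (fst p) (snd p) * \<sigma> x (fst q) (snd q)) * (H x (fst q) i (snd p) * H x (fst p) i (snd q)))"
      by (rule sum.cong[OF refl], rule sum.swap)
    also have "\<dots> = (\<Sum>p\<in>UNIV. \<Sum>q\<in>UNIV. \<Sum>i\<in>UNIV. (\<sigma> x (fst p) (snd p) * \<sigma> x (fst q) (snd q)) * (H x (fst q) i (snd q) * H x (fst p) i (snd p)))"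
      unfolding sum_distrib_left[symmetric]
      by (rule sum.cong[OF refl], rule sum.cong[OF refl], rule arg_cong[OF fl])
    also have "\<dots> = (\<Sum>p\<in>UNIV. \<Sum>q\<in>UNIV. \<Sum>i\<in>UNIV. ?p i p * ?p i q)"
      by (simp add: mult_ac)
    also have "\<dots> = (\<Sum>p\<in>UNIV. \<Sum>i\<in>UNIV. \<Sum>q\<in>UNIV. ?p i p * ?p i q)"
      by (rule sum.cong[OF refl], rule sum.swap)
    also have "\<dots> = (\<Sum>i\<in>UNIV. \<Sum>p\<in>UNIV. \<Sum>q\<in>UNIV. ?p i p * ?p i q)"
      by (rule sum.swap)
    also have "\<dots> = (\<Sum>i\<in>UNIV. (dlog (t x i) x)\<^sup>2)"
    proof -
      have "dlog (t x i) x = - (\<Sum>p\<in>UNIV. ?p i p)" for i by (simp add: dlog_frame sum_UNIV_prod)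
      then show ?thesis by (simp add: power2_eq_square sum_product)
    qed
    finally show ?thesis .
  qed
  have "(\<Sum>i\<in>UNIV. D (t x i) (dlog (t x i)) x) = - (\<Sum>i\<in>UNIV. \<Sum>b\<in>Basis. oblique b x \<bullet> B (t x i) (t x i) x b)
     - (\<Sum>i\<in>UNIV. \<Sum>b\<in>Basis. ?A i (oblique b x) \<bullet> ?A i b)
     + (\<Sum>i\<in>UNIV. \<Sum>b\<in>Basis. oblique (?A i (oblique b x)) x \<bullet> ?A i b)"
    unfolding D_dlog D_oblique by (simp add: inner_diff_left sum.distrib sum_subtractf sum_negf)
  also have "(\<Sum>i\<in>UNIV. \<Sum>b\<in>Basis. oblique b x \<bullet> B (t x i) (t x i) x b) = (\<Sum>b\<in>Basis. oblique b x \<bullet> LP x b)"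
    unfolding LP_def sum_frame_B inner_sum_right by (rule sum.swap)
  finally show ?thesis unfolding 1 2 ee2 3 4 by simp
qed

end

text \<open>A factor below 1 in front of (a + b)^2 allows coefficient 1 on a^2; the price is n on
  b^2. Here a will be a multiple of the gradient of ln v and b the gradient of the logarithm of the
  cutoff.\<close>

lemma cross_bound:
  fixes a b n :: real
  assumes "n \<ge> 1"
  shows "(1 - 1 / n) * (a + b)\<^sup>2 \<le> a\<^sup>2 + n * b\<^sup>2"
proof -
  have "0 \<le> (a - (n - 1) * b)\<^sup>2 + n * b\<^sup>2" using assms by simp
  also have "\<dots> = n * (a\<^sup>2 + n * b\<^sup>2) - (n - 1) * (a + b)\<^sup>2" by (simp add: power2_eq_square algebra_simps)
  finally have "(n - 1) * (a + b)\<^sup>2 \<le> n * (a\<^sup>2 + n * b\<^sup>2)" by simp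
  then have "(n - 1) * (a + b)\<^sup>2 / n \<le> a\<^sup>2 + n * b\<^sup>2" using assms by (simp add: field_simps)
  then show ?thesis using assms by (simp add: diff_divide_distrib left_diff_distrib)
qed

text \<open>\<open>D_g\<close> makes half of ln g a potential of \<open>dlog\<close>, so that g is a
  squared volume density.\<close>

locale calibrated_immersion = flat_minimal_immersion X E P t nu
  for X :: "'x::euclidean_space \<Rightarrow> 'v::euclidean_space" and E P
    and t :: "'x \<Rightarrow> 'i::finite \<Rightarrow> 'v" and nu :: "'x \<Rightarrow> 'j::finite \<Rightarrow> 'v" +
  fixes g :: "'x \<Rightarrow> real"
  assumes smooth_g: "smooth_on UNIV g" and g_pos: "g x > 0"
    and D_g: "D a g x = 2 * g x * dlog a x"
begin

text \<open>\<open>\<Lambda> u\<close> is the Laplacian of \<open>ln u\<close>; without the logarithm no positivity away from the point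
  of evaluation is needed.\<close>

definition \<Lambda> :: "('x \<Rightarrow> real) \<Rightarrow> 'x \<Rightarrow> real" where
  "\<Lambda> u x = (\<Sum>i\<in>UNIV. D (t x i) (D (t x i) u) x / u x - (D (t x i) u x / u x)\<^sup>2)"

lemma \<Lambda>_mult:
  assumes "smooth_on UNIV u" "smooth_on UNIV v" "u x \<noteq> 0" "v x \<noteq> 0"
  shows "\<Lambda> (\<lambda>x. u x * v x) x = \<Lambda> u x + \<Lambda> v x"
    "D a (\<lambda>x. u x * v x) x / (u x * v x) = D a u x / u x + D a v x / v x"
proof -
  have D1: "D a (\<lambda>x. u x * v x) = (\<lambda>x. u x * D a v x + D a u x * v x)" for a
    using D_mult[OF assms(1,2)] by blast
  have D2: "D a (D a (\<lambda>x. u x * v x)) x = u x * D a (D a v) x + 2 * D a u x * D a v x + D a (D a u) x * v x" for a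
    unfolding D1 using assms(1,2) by (simp add: D_add D_mult smooths)
  show 2: "D a (\<lambda>x. u x * v x) x / (u x * v x) = D a u x / u x + D a v x / v x" for a
    unfolding D1 using assms by (simp add: field_simps)
  have "D a (D a (\<lambda>x. u x * v x)) x / (u x * v x) - (D a (\<lambda>x. u x * v x) x / (u x * v x))\<^sup>2
     = (D a (D a u) x / u x - (D a u x / u x)\<^sup>2) + (D a (D a v) x / v x - (D a v x / v x)\<^sup>2)" for a
    unfolding 2 D2 using assms(3,4) by (simp add: field_simps power2_eq_square)
  then show "\<Lambda> (\<lambda>x. u x * v x) x = \<Lambda> u x + \<Lambda> v x"
    unfolding \<Lambda>_def sum.distrib[symmetric] by (intro sum.cong refl)
qed

definition dlog_sq :: "'x \<Rightarrow> real" where "dlog_sq x = (\<Sum>i\<in>UNIV. (dlog (t x i) x)\<^sup>2)"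

lemma D_D_g: "D a (D a g) x = 2 * g x * (2 * (dlog a x)\<^sup>2 + D a (dlog a) x)"
proof -
  have "D a g = (\<lambda>x. 2 * (g x * dlog a x))" using D_g by (auto simp: mult.assoc)
  then have "D a (D a g) x = 2 * (g x * D a (dlog a) x + D a g x * dlog a x)"
    by (simp add: D_cmult D_mult smooths smooth_g smooth_dlog)
  then show ?thesis by (simp add: D_g power2_eq_square algebra_simps)
qed

lemma \<Lambda>_g: "\<Lambda> g x = 2 * e x + 2 * dlog_sq x"
proof -
  have "g x \<noteq> 0" using g_pos[of x] by simp
  then have "\<Lambda> g x = (\<Sum>i\<in>UNIV. 2 * D (t x i) (dlog (t x i)) x)"
    unfolding \<Lambda>_def D_D_g D_g by (intro sum.cong refl) (simp add: field_simps power2_eq_square)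
  then show ?thesis by (simp add: sum_distrib_left[symmetric] sum_D_dlog dlog_sq_def)
qed

text \<open>\<open>\<Lambda>_mult\<close> does not cover a sum; the logarithmic derivative of W + g
  is r times that of g, and the second derivatives come from \<open>D_D_g\<close>.\<close>

lemma \<Lambda>_add_g:
  fixes W :: real
  assumes "W > 0"
  defines "r \<equiv> \<lambda>x. g x / (W + g x)"
  shows "\<Lambda> (\<lambda>x. W + g x) x = r x * (2 * e x + 6 * dlog_sq x) - 4 * (r x)\<^sup>2 * dlog_sq x"
    "D a (\<lambda>x. W + g x) x / (W + g x) = 2 * r x * dlog a x"
proof -
  have p: "W + g x > 0" using assms(1) g_pos[of x] by simp
  have D1: "D a (\<lambda>x. W + g x) = D a g" for a using smooth_g by (auto simp: D_add)
  show "D a (\<lambda>x. W + g x) x / (W + g x) = 2 * r x * dlog a x" for a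
    unfolding D1 D_g r_def by simp
  note 2 = this
  have "\<Lambda> (\<lambda>x. W + g x) x = (\<Sum>i\<in>UNIV. r x * (4 * (dlog (t x i) x)\<^sup>2 + 2 * D (t x i) (dlog (t x i)) x)
      - 4 * (r x)\<^sup>2 * (dlog (t x i) x)\<^sup>2)"
  proof -
    have "D a (D a g) x / (W + g x) = r x * (4 * (dlog a x)\<^sup>2 + 2 * D a (dlog a) x)" for a
      unfolding D_D_g r_def by (simp add: algebra_simps add_divide_distrib)
    then show ?thesis
      unfolding \<Lambda>_def 2 unfolding D1 by (simp add: power_mult_distrib)
  qed
  also have "\<dots> = r x * (4 * dlog_sq x + 2 * (e x + dlog_sq x)) - 4 * (r x)\<^sup>2 * dlog_sq x"
    by (simp only: sum_subtractf sum.distrib sum_distrib_left[symmetric] sum_D_dlog dlog_sq_def[symmetric])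
  finally show "\<Lambda> (\<lambda>x. W + g x) x = r x * (2 * e x + 6 * dlog_sq x) - 4 * (r x)\<^sup>2 * dlog_sq x"
    by (simp add: algebra_simps)
qed

text \<open>\<open>simons_kato\<close> divided by 2 e^2 and written in De/(2e), the gradient of ln
  |A|. The coefficient arises as 2(1 + 1/n) - 4 = -2(1 - 1/n).\<close>

lemma \<Lambda>_e:
  assumes "e x > 0"
  shows "\<Lambda> e x \<ge> - 2 * (1 - 1 / real CARD('i)) * (\<Sum>i\<in>UNIV. (D (t x i) e x / (2 * e x))\<^sup>2) - 2 * e x"
proof -
  define n where "n = real CARD('i)"
  define a where "a = (\<Sum>i\<in>UNIV. (D (t x i) e x / (2 * e x))\<^sup>2)"
  define L where "L = (\<Sum>i\<in>UNIV. D (t x i) (D (t x i) e) x)"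
  have a: "(\<Sum>i\<in>UNIV. (D (t x i) e x)\<^sup>2) = 4 * (e x)\<^sup>2 * a"
    using assms by (simp add: a_def power_divide power_mult_distrib sum_divide_distrib[symmetric])
  have 1: "\<Lambda> e x = L / e x - 4 * a"
    using assms unfolding \<Lambda>_def sum_subtractf L_def a_def sum_divide_distrib
    by (simp add: power_divide power_mult_distrib sum_distrib_left)
  have "(1 + 1 / n) * (4 * (e x)\<^sup>2 * a) \<le> 2 * e x * L + 4 * (e x) ^ 3"
    using simons_kato[of x] unfolding a n_def L_def .
  then have "2 * (e x)\<^sup>2 * ((1 + 1 / n) * 2 * a) \<le> 2 * (e x)\<^sup>2 * (L / e x + 2 * e x)"
    using assms by (simp add: power2_eq_square power3_eq_cube algebra_simps)
  then have "(1 + 1 / n) * 2 * a \<le> L / e x + 2 * e x" using assms by simp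
  then show ?thesis unfolding 1 a_def[symmetric] n_def[symmetric] by (simp add: algebra_simps)
qed

definition \<eta> :: "real \<Rightarrow> 'v \<Rightarrow> 'x \<Rightarrow> real" where "\<eta> R c x = R\<^sup>2 - (X x - c) \<bullet> (X x - c)"

lemma smooth_\<eta>: "smooth_on UNIV (\<eta> R c)"
  unfolding \<eta>_def[abs_def] by (intro smooths)

lemma D_\<eta>: "D a (\<eta> R c) x = - 2 * ((X x - c) \<bullet> P x a)"
  unfolding \<eta>_def[abs_def] by (simp add: D_diff D_inner smooths D_X inner_commute)

lemma sum_D_\<eta>: "(\<Sum>i\<in>UNIV. (D (t x i) (\<eta> R c) x)\<^sup>2) \<le> 4 * (norm (X x - c))\<^sup>2"
proof -
  let ?v = "X x - c"
  have "(\<Sum>i\<in>UNIV. (D (t x i) (\<eta> R c) x)\<^sup>2) = 4 * (\<Sum>i\<in>UNIV. (?v \<bullet> t x i)\<^sup>2)"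
    by (simp add: D_\<eta> t_tangent power_mult_distrib sum_distrib_left)
  also have "(\<Sum>i\<in>UNIV. (?v \<bullet> t x i)\<^sup>2) \<le> (\<Sum>i\<in>UNIV. (?v \<bullet> t x i)\<^sup>2) + (\<Sum>\<alpha>\<in>UNIV. (?v \<bullet> nu x \<alpha>)\<^sup>2)"
    by (simp add: sum_nonneg)
  also have "\<dots> = ?v \<bullet> ?v" by (subst frame_inner[of _ _ x]) (simp add: power2_eq_square)
  finally show ?thesis by (simp add: power2_norm_eq_inner)
qed

text \<open>Minimality makes the ambient coordinates harmonic, so only the trace n of
  \<open>P\<close> remains.\<close>

lemma sum_D_D_\<eta>: "(\<Sum>i\<in>UNIV. D (t x i) (D (t x i) (\<eta> R c)) x) = - 2 * real CARD('i)"
proof -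
  have "D a (D a (\<eta> R c)) x = - 2 * ((X x - c) \<bullet> A a x a + P x a \<bullet> P x a)" for a
  proof -
    have 1: "D a (\<eta> R c) = (\<lambda>x. - 2 * ((X x - c) \<bullet> P x a))" using D_\<eta> by blast
    have "D a (D a (\<eta> R c)) x = - 2 * D a (\<lambda>x. (X x - c) \<bullet> P x a) x"
      unfolding 1 by (intro D_cmult smooths)
    then show ?thesis by (simp add: D_inner D_diff D_apply_const smooths D_X A_def)
  qed
  moreover have "(\<Sum>i\<in>UNIV. (X x - c) \<bullet> A (t x i) x (t x i)) = 0"
    by (simp add: inner_sum_right[symmetric] sum_A_t)
  ultimately show ?thesis
    by (simp add: t_tangent t_orth sum_subtractf sum_distrib_left[symmetric] sum_negf)
qed

text \<open>
  The factor \<open>W + g\<close> is chosen so that, with \<open>r = g/(W + g)\<close>, the good term \<open>r e\<close> survives in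
  \<open>\<Lambda> \<phi>\<close> while the coefficient of the squared gradient of \<open>ln g\<close> stays nonnegative; the latter needs
  \<open>r \<le> 1/3\<close>.
\<close>

lemma maximum_point_bound:
  fixes W R :: real and c :: 'v
  defines "\<phi> \<equiv> \<lambda>x. e x * (g x * ((W + g x) * (\<eta> R c x * \<eta> R c x)))"
  assumes W: "g p \<le> W / 2" and e: "e p > 0" and \<eta>: "\<eta> R c p > 0"
    and U: "open U" "p \<in> U" and max: "\<And>y. y \<in> U \<Longrightarrow> \<phi> y \<le> \<phi> p"
  shows "\<phi> p \<le> 23 * real CARD('i) * R\<^sup>2 * W\<^sup>2"
proof -
  define n where "n = real CARD('i)"
  have n: "n \<ge> 1" by (simp add: n_def Suc_leI)
  define r where "r = g p / (W + g p)"
  define \<alpha> where "\<alpha> i = D (t p i) e p / (2 * e p)" for i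
  define b where "b i = dlog (t p i) p" for i
  define \<gamma> where "\<gamma> i = D (t p i) (\<eta> R c) p / \<eta> R c p" for i
  define h where "h = \<eta> R c p"
  have g1: "g p > 0" by (rule g_pos)
  have Wp: "W > 0" using W g1 by simp
  have r: "0 < r" "r \<le> 1 / 3" using g1 W Wp by (auto simp: r_def field_simps)
  have W0: "W + g p \<noteq> 0" using Wp g1 by simp
  have sW: "smooth_on UNIV (\<lambda>x. W + g x)" by (intro smooths smooth_g)
  have s\<eta>: "smooth_on UNIV (\<lambda>x. \<eta> R c x * \<eta> R c x)" by (intro smooths smooth_\<eta>)
  have s3: "smooth_on UNIV (\<lambda>x. (W + g x) * (\<eta> R c x * \<eta> R c x))" by (intro smooths smooth_g smooth_\<eta>)
  have s4: "smooth_on UNIV (\<lambda>x. g x * ((W + g x) * (\<eta> R c x * \<eta> R c x)))" by (intro smooths smooth_g smooth_\<eta>)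
  have s5: "smooth_on UNIV \<phi>" unfolding \<phi>_def by (intro smooths smooth_g smooth_\<eta> smooth_e)
  have nz: "e p \<noteq> 0" "g p \<noteq> 0" "\<eta> R c p \<noteq> 0" using e g1 \<eta> by auto
  have \<phi>p: "\<phi> p > 0" using e g1 \<eta> Wp by (simp add: \<phi>_def)
  have \<Lambda>: "\<Lambda> \<phi> p = \<Lambda> e p + (\<Lambda> g p + (\<Lambda> (\<lambda>x. W + g x) p + (\<Lambda> (\<eta> R c) p + \<Lambda> (\<eta> R c) p)))"
    unfolding \<phi>_def using nz W0
    by (simp add: \<Lambda>_mult(1)[OF smooth_e s4] \<Lambda>_mult(1)[OF smooth_g s3] \<Lambda>_mult(1)[OF sW s\<eta>] \<Lambda>_mult(1)[OF smooth_\<eta> smooth_\<eta>])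
  have \<lambda>: "D a \<phi> p / \<phi> p = D a e p / e p + (D a g p / g p + (D a (\<lambda>x. W + g x) p / (W + g p) 
       + (D a (\<eta> R c) p / \<eta> R c p + D a (\<eta> R c) p / \<eta> R c p)))" for a
    unfolding \<phi>_def using nz W0
    by (simp add: \<Lambda>_mult(2)[OF smooth_e s4] \<Lambda>_mult(2)[OF smooth_g s3] \<Lambda>_mult(2)[OF sW s\<eta>] \<Lambda>_mult(2)[OF smooth_\<eta> smooth_\<eta>])
  \<comment> \<open>Half the logarithmic gradient of \<phi> vanishes at the maximum; g contributes
    b, W + g contributes r b, and the two factors \<eta> contribute \<gamma>.\<close>
  have crit: "\<alpha> i = - ((1 + r) * b i + \<gamma> i)" for i
  proof -
    have "D (t p i) \<phi> p = 0" by (rule local_max_D(1)[OF s5 U max])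
    then have "0 = 2 * \<alpha> i + (2 * b i + (2 * r * b i + (\<gamma> i + \<gamma> i)))"
      using \<lambda>[of "t p i"] nz unfolding \<Lambda>_add_g(2)[OF Wp] D_g \<alpha>_def b_def \<gamma>_def r_def by simp
    then show ?thesis by (simp add: algebra_simps)
  qed
  have neg: "\<Lambda> \<phi> p \<le> 0"
    unfolding \<Lambda>_def
  proof (rule sum_nonpos)
    fix i
    have "D (t p i) \<phi> p = 0" by (rule local_max_D(1)[OF s5 U max])
    moreover have "D (t p i) (D (t p i) \<phi>) p \<le> 0" by (rule local_max_D(2)[OF s5 U max])
    ultimately show "D (t p i) (D (t p i) \<phi>) p / \<phi> p - (D (t p i) \<phi> p / \<phi> p)\<^sup>2 \<le> 0"
      using \<phi>p by (simp add: divide_nonpos_pos)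
  qed
  define aa where "aa = (\<Sum>i\<in>UNIV. (\<alpha> i)\<^sup>2)"
  define cc where "cc = (\<Sum>i\<in>UNIV. (\<gamma> i)\<^sup>2)"
  have bb: "dlog_sq p = (\<Sum>i\<in>UNIV. (b i)\<^sup>2)" by (simp add: dlog_sq_def b_def)
  have \<Lambda>\<eta>: "\<Lambda> (\<eta> R c) p = - 2 * n / h - cc"
    unfolding \<Lambda>_def sum_subtractf sum_divide_distrib[symmetric] sum_D_D_\<eta> by (simp add: n_def h_def cc_def \<gamma>_def)
  have \<Lambda>e: "\<Lambda> e p \<ge> - 2 * ((1 - 1 / n) * aa) - 2 * e p"
    using \<Lambda>_e[OF e] by (simp only: n_def aa_def \<alpha>_def mult.assoc)
  have "(1 - 1 / n) * (\<alpha> i)\<^sup>2 \<le> (1 + r)\<^sup>2 * (b i)\<^sup>2 + n * (\<gamma> i)\<^sup>2" for i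
    using cross_bound[OF n, of "(1 + r) * b i" "\<gamma> i"] unfolding crit power2_minus by (simp add: power_mult_distrib)
  then have "(\<Sum>i\<in>UNIV. (1 - 1 / n) * (\<alpha> i)\<^sup>2) \<le> (\<Sum>i\<in>UNIV. (1 + r)\<^sup>2 * (b i)\<^sup>2 + n * (\<gamma> i)\<^sup>2)"
    by (intro sum_mono)
  then have aa: "(1 - 1 / n) * aa \<le> (1 + r)\<^sup>2 * dlog_sq p + n * cc"
    by (simp add: aa_def cc_def bb sum.distrib sum_distrib_left)
  have bb0: "dlog_sq p \<ge> 0" by (simp add: dlog_sq_def sum_nonneg)
  \<comment> \<open>The coefficients differ by r - 3 r^2, which is where r \<le> 1/3 is
    used.\<close>
  have quad: "(1 + r)\<^sup>2 * dlog_sq p \<le> (1 + 3 * r - 2 * r\<^sup>2) * dlog_sq p"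
  proof (rule mult_right_mono[OF _ bb0])
    have "r * (3 * r) \<le> r * 1" using r by (intro mult_left_mono) auto
    then show "(1 + r)\<^sup>2 \<le> 1 + 3 * r - 2 * r\<^sup>2" by (simp add: power2_eq_square algebra_simps)
  qed
  have "0 \<ge> \<Lambda> e p + (2 * e p + 2 * dlog_sq p) + (r * (2 * e p + 6 * dlog_sq p) - 4 * r\<^sup>2 * dlog_sq p) + 2 * (- 2 * n / h - cc)"
    using neg unfolding \<Lambda> \<Lambda>_g \<Lambda>_add_g(1)[OF Wp] \<Lambda>\<eta> r_def[symmetric] by simp
  \<comment> \<open>The terms 2 e p from \<Lambda> g and -2 e p from the Simons identity cancel,
    leaving 2 r e p.\<close>
  then have "0 \<ge> - 2 * ((1 - 1 / n) * aa) + 2 * ((1 + 3 * r - 2 * r\<^sup>2) * dlog_sq p) + 2 * (r * e p) - 2 * (2 * n / h + cc)"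
    using \<Lambda>e by (simp add: algebra_simps)
  moreover have "u \<le> v + k" if "0 \<ge> - 2 * q + 2 * y + 2 * u - 2 * k" "q \<le> x + v" "x \<le> y" for u v k q x y :: real
    using that by linarith
  ultimately have "r * e p \<le> n * cc + (2 * n / h + cc)"
    using aa quad by blast
  then have 1: "r * e p \<le> (n + 1) * cc + 2 * n / h" by (simp add: algebra_simps)
  have h: "h > 0" "h \<le> R\<^sup>2" using \<eta> by (auto simp: h_def \<eta>_def)
  have cc: "cc \<le> 4 * R\<^sup>2 / h\<^sup>2"
  proof -
    have "cc = (\<Sum>i\<in>UNIV. (D (t p i) (\<eta> R c) p)\<^sup>2) / h\<^sup>2"
      by (simp add: cc_def \<gamma>_def h_def power_divide sum_divide_distrib)
    also have "\<dots> \<le> (4 * (norm (X p - c))\<^sup>2) / h\<^sup>2" by (intro divide_right_mono sum_D_\<eta>) simp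
    also have "\<dots> \<le> 4 * R\<^sup>2 / h\<^sup>2"
      using \<eta> by (intro divide_right_mono) (auto simp: \<eta>_def power2_norm_eq_inner)
    finally show ?thesis .
  qed
  have "r * e p * h\<^sup>2 \<le> ((n + 1) * cc + 2 * n / h) * h\<^sup>2" using 1 by (intro mult_right_mono) auto
  also have "\<dots> = (n + 1) * (cc * h\<^sup>2) + 2 * n * h" using h by (simp add: power2_eq_square field_simps)
  also have "\<dots> \<le> (n + 1) * (4 * R\<^sup>2) + 2 * n * R\<^sup>2"
    using cc h n by (intro add_mono mult_left_mono) (auto simp: field_simps)
  also have "\<dots> \<le> 10 * n * R\<^sup>2" using n mult_right_mono[of 1 n "R\<^sup>2"] by (simp add: algebra_simps)
  finally have 2: "r * e p * h\<^sup>2 \<le> 10 * n * R\<^sup>2" .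
  \<comment> \<open>Here g (W + g) = r (W + g)^2. Since W + g \<le> 3W/2 at p, the constant is 10
    (3/2)^2 = 45/2, rounded up to 23.\<close>
  have "\<phi> p = (r * e p * h\<^sup>2) * (W + g p)\<^sup>2"
    using W0 by (simp add: \<phi>_def r_def h_def power2_eq_square)
  also have "\<dots> \<le> (10 * n * R\<^sup>2) * (3 / 2 * W)\<^sup>2"
  proof (rule mult_mono[OF 2])
    show "(W + g p)\<^sup>2 \<le> (3 / 2 * W)\<^sup>2" using W g1 Wp by (intro power_mono) auto
  qed (use n in auto)
  also have "\<dots> = 45 / 2 * (n * R\<^sup>2 * W\<^sup>2)" by (simp add: power2_eq_square)
  also have "\<dots> \<le> 23 * (n * R\<^sup>2 * W\<^sup>2)" using n by (intro mult_right_mono) auto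
  finally show ?thesis by (simp add: n_def mult.assoc)
qed

text \<open>The cutoff vanishes on the boundary of the compact set \<open>K\<close>, so a maximum
  over \<open>K\<close> lies in the open set \<open>U\<close>. At x0 the cutoff equals R^2, and W +
  g is bounded below by W.\<close>

lemma interior_bound:
  assumes R: "R > 0" and bd: "bounded {x. norm (X x - X x0) \<le> R}"
    and W: "\<And>x. norm (X x - X x0) \<le> R \<Longrightarrow> g x \<le> W / 2"
  shows "e x0 * g x0 \<le> 23 * real CARD('i) * W / R\<^sup>2"
proof (cases "e x0 = 0")
  case True
  have "W \<ge> 0" using W[of x0] g_pos[of x0] R by simp
  then show ?thesis using True by simp
next
  case False
  have e0: "e x \<ge> 0" for x by (simp add: e_def hs_def sum_nonneg)
  define c where "c = X x0"
  define \<phi> where "\<phi> x = e x * (g x * ((W + g x) * (\<eta> R c x * \<eta> R c x)))" for x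
  define K where "K = {x. norm (X x - c) \<le> R}"
  have g1: "g x > 0" for x by (rule g_pos)
  have Wp: "W > 0" using W[of x0] g1[of x0] R by simp
  have "closed K" unfolding K_def
    by (intro closed_Collect_le continuous_intros smooth_continuous[OF smooth_X])
  then have cK: "compact K" using bd by (simp add: K_def c_def compact_eq_bounded_closed)
  have s: "smooth_on UNIV \<phi>" unfolding \<phi>_def by (intro smooths smooth_g smooth_\<eta> smooth_e)
  have x0: "x0 \<in> K" using R by (simp add: K_def c_def)
  obtain p where p: "p \<in> K" "\<And>y. y \<in> K \<Longrightarrow> \<phi> y \<le> \<phi> p"
    using continuous_attains_sup[OF cK, of \<phi>] x0 continuous_on_subset[OF smooth_continuous[OF s]] by blast
  have \<phi>0: "\<phi> x0 = e x0 * (g x0 * ((W + g x0) * (R\<^sup>2 * R\<^sup>2)))" by (simp add: \<phi>_def \<eta>_def c_def)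
  have "\<phi> x0 > 0" unfolding \<phi>0 using False e0[of x0] g1[of x0] Wp R by (intro mult_pos_pos) auto
  then have \<phi>p: "\<phi> p > 0" using p(2)[OF x0] by simp
  have \<eta>p: "\<eta> R c p \<ge> 0"
  proof -
    have "(norm (X p - c))\<^sup>2 \<le> R\<^sup>2" using p(1) R by (intro power_mono) (auto simp: K_def)
    then show ?thesis by (simp add: \<eta>_def power2_norm_eq_inner)
  qed
  have ep: "e p > 0" and \<eta>p': "\<eta> R c p > 0"
    using \<phi>p e0[of p] \<eta>p unfolding \<phi>_def by (auto simp: less_le)
  define U where "U = {x. norm (X x - c) < R}"
  have "open U" unfolding U_def
    by (intro open_Collect_less continuous_intros smooth_continuous[OF smooth_X])
  moreover have "p \<in> U"
  proof -
    have "(norm (X p - c))\<^sup>2 < R\<^sup>2" using \<eta>p' by (simp add: \<eta>_def power2_norm_eq_inner)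
    then show ?thesis using R by (simp add: U_def power2_less_imp_less)
  qed
  moreover have "\<phi> y \<le> \<phi> p" if "y \<in> U" for y using that p(2) by (simp add: U_def K_def)
  moreover have "g p \<le> W / 2" using W p(1) by (simp add: K_def c_def)
  ultimately have "\<phi> p \<le> 23 * real CARD('i) * R\<^sup>2 * W\<^sup>2"
    using maximum_point_bound[of p W R c U] ep \<eta>p' unfolding \<phi>_def by blast
  then have 1: "\<phi> x0 \<le> 23 * real CARD('i) * R\<^sup>2 * W\<^sup>2" using p(2)[OF x0] by simp
  have "e x0 * g x0 * (W * (R\<^sup>2 * R\<^sup>2)) \<le> e x0 * g x0 * ((W + g x0) * (R\<^sup>2 * R\<^sup>2))"
    using e0[of x0] g1[of x0] by (intro mult_left_mono mult_right_mono) auto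
  also have "\<dots> = \<phi> x0" by (simp add: \<phi>0 mult_ac)
  finally have "(W * R\<^sup>2) * (e x0 * g x0 * R\<^sup>2) \<le> (W * R\<^sup>2) * (23 * real CARD('i) * W)"
    using 1 by (simp add: power2_eq_square mult_ac)
  then have "e x0 * g x0 * R\<^sup>2 \<le> 23 * real CARD('i) * W" using Wp R by simp
  then show ?thesis using R by (simp add: field_simps)
qed

end

section \<open>Vanishing second fundamental form\<close>

context minimal_immersion
begin

text \<open>With A = 0 the projection \<open>P\<close> is constant. A tangent vector is determined
  by its image under \<open>E\<close>, so dX is constant too.\<close>

lemma affine_of_e_eq_0:
  assumes "\<And>x. e x = 0"
  shows "X x = X 0 + dird x X 0"
proof -
  have "A a x b = 0" if "a \<in> Basis" "b \<in> Basis" for a b x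
  proof -
    have n1: "0 \<le> hs (A a x) (A a x)" for a unfolding hs_def by (intro sum_nonneg) simp
    have "(\<Sum>a\<in>Basis. hs (A a x) (A a x)) = 0" using assms[of x] by (simp add: e_def)
    then have "hs (A a x) (A a x) = 0" using n1 that by (simp add: sum_nonneg_eq_0_iff)
    then show ?thesis using that unfolding hs_def by (simp add: sum_nonneg_eq_0_iff)
  qed
  then have "A a x = 0" if "a \<in> Basis" for a x using that by (intro blinfun_euclidean_eqI) simp
  then have A0: "A a x = 0" for a x
  proof -
    assume *: "\<And>a x. a \<in> Basis \<Longrightarrow> A a x = 0"
    interpret l: bounded_linear "\<lambda>a. A a x" by (rule linear_A)
    have "A a x = A (\<Sum>i\<in>Basis. (a \<bullet> i) *\<^sub>R i) x" by (simp add: euclidean_representation)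
    then show ?thesis by (simp add: l.sum l.scaleR *)
  qed
  have "dird h P x = 0" for h x
    using A0[of "dird h X x" x] by (simp add: A_def D_def P_dX E_dX)
  then have "(P has_derivative (\<lambda>h. 0)) (at x)" for x
    using smooth_has_derivative[OF smooth_P, of x] by simp
  then obtain Q where Q: "\<And>x. P x = Q"
    using has_derivative_zero_constant[of UNIV P] by auto
  have dX: "dird h X x = dird h X 0" for h x
  proof -
    have "dird h X 0 = P x (dird h X 0)" using P_dX[of 0 h] by (simp add: Q)
    also have "\<dots> = dird (E (P x (dird h X 0))) X x" by (rule dX_E_P[symmetric])
    also have "P x (dird h X 0) = dird h X 0" using P_dX[of 0 h] by (simp add: Q)
    finally show ?thesis by (simp add: E_dX)
  qed
  have "((\<lambda>x. X x - dird x X 0) has_derivative (\<lambda>h. 0)) (at x)" for x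
  proof -
    have "((\<lambda>x. X x - dird x X 0) has_derivative (\<lambda>h. dird h X x - dird h X 0)) (at x)"
      by (intro has_derivative_diff smooth_has_derivative smooth_X
          bounded_linear_imp_has_derivative dird_bounded_linear)
    then show ?thesis unfolding dX[of _ x] by simp
  qed
  then obtain c where c: "\<And>x. X x - dird x X 0 = c"
    using has_derivative_zero_constant[of UNIV "\<lambda>x. X x - dird x X 0"] by auto
  have "dird 0 X 0 = 0" by (rule linear_simps(3)[OF dird_bounded_linear[OF smooth_X]])
  then show ?thesis using c[of x] c[of 0] by (simp add: algebra_simps)
qed

end

section \<open>Graphs\<close>

lemma smooth_prod:
  fixes u :: "'i \<Rightarrow> 'a::euclidean_space \<Rightarrow> real"
  shows "(\<And>i. i \<in> I \<Longrightarrow> smooth_on UNIV (u i)) \<Longrightarrow> smooth_on UNIV (\<lambda>x. \<Prod>i\<in>I. u i x)"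
  by (induction I rule: infinite_finite_induct) (simp_all add: smooth_mult)

lemma smooth_det:
  fixes M :: "'a::euclidean_space \<Rightarrow> real^'n^'n"
  assumes "\<And>i j. smooth_on UNIV (\<lambda>x. M x $ i $ j)"
  shows "smooth_on UNIV (\<lambda>x. det (M x))"
  unfolding det_def by (intro smooth_sum smooth_mult smooth_const smooth_prod assms)

text \<open>The derivative is built from 1/u and smooth functions, so induction on the order of
  differentiability of 1/u suffices.\<close>

lemma smooth_inverse:
  fixes u :: "'a::euclidean_space \<Rightarrow> real"
  assumes u: "smooth_on UNIV u" and nz: "\<And>x. u x \<noteq> 0"
  shows "smooth_on UNIV (\<lambda>x. inverse (u x))"
proof -
  have hd: "((\<lambda>x. inverse (u x)) has_derivative (\<lambda>h. - (inverse (u x) * dird h u x * inverse (u x)))) (at x)" for x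
    by (rule Deriv.has_derivative_inverse[OF nz smooth_has_derivative[OF u]])
  have d: "dird h (\<lambda>x. inverse (u x)) = (\<lambda>x. - (inverse (u x) * dird h u x * inverse (u x)))" for h
    using dird_eqI[OF hd] by blast
  have "Ck_on k UNIV (\<lambda>x. inverse (u x))" for k
  proof (induction k)
    case 0
    then show ?case using u nz by (simp add: continuous_on_inverse smooth_continuous)
  next
    case (Suc k)
    have "Ck_on k UNIV (\<lambda>x. inverse (u x) * dird h u x * inverse (u x))" for h
      using Suc smooth_dird[OF u] by (intro Ck_bilinear[OF bounded_bilinear_mult]) (auto simp: smooth_on_def)
    then have "Ck_on k UNIV (dird h (\<lambda>x. inverse (u x)))" for h
      unfolding d using Ck_bounded_linear[OF bounded_linear_minus[OF bounded_linear_ident]] by blast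
    moreover have "(\<lambda>x. inverse (u x)) differentiable at x" for x using hd differentiable_def by blast
    ultimately show ?case unfolding Ck_on_Suc_dird by blast
  qed
  then show ?thesis by (simp add: smooth_on_def)
qed

lemma matrix_inv_inverse:
  fixes M :: "real^'n^'n"
  assumes "det M \<noteq> 0"
  shows "M ** matrix_inv M = mat 1" "matrix_inv M ** M = mat 1"
proof -
  have "\<exists>M'. M ** M' = mat 1 \<and> M' ** M = mat 1"
    using assms unfolding invertible_det_nz[symmetric] invertible_def .
  then have "M ** matrix_inv M = mat 1 \<and> matrix_inv M ** M = mat 1"
    unfolding matrix_inv_def by (rule someI_ex)
  then show "M ** matrix_inv M = mat 1" "matrix_inv M ** M = mat 1" by auto
qed

text \<open>Cramer's rule makes the entries polynomials divided by the determinant, from which their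
  smoothness is read off.\<close>

lemma matrix_inv_cramer:
  fixes M :: "real^'n^'n"
  assumes "det M \<noteq> 0"
  shows "matrix_inv M $ k $ j = det (\<chi> a b. if b = k then axis j 1 $ a else M $ a $ b) * inverse (det M)"
proof -
  have "M *v (matrix_inv M *v axis j 1) = axis j 1"
    by (simp add: matrix_vector_mul_assoc matrix_inv_inverse(1)[OF assms])
  then have "matrix_inv M *v axis j 1 = (\<chi> k. det (\<chi> a b. if b = k then axis j 1 $ a else M $ a $ b) / det M)"
    using cramer[OF assms] by blast
  then have "(matrix_inv M *v axis j 1) $ k = det (\<chi> a b. if b = k then axis j 1 $ a else M $ a $ b) / det M"
    by simp
  then show ?thesis by (simp add: matrix_vector_mul_component cart_eq_inner_axis[symmetric] divide_inverse)
qed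

lemma smooth_matrix_inv:
  fixes M :: "'a::euclidean_space \<Rightarrow> real^'n^'n"
  assumes M: "\<And>i j. smooth_on UNIV (\<lambda>x. M x $ i $ j)" and nz: "\<And>x. det (M x) \<noteq> 0"
  shows "smooth_on UNIV (\<lambda>x. matrix_inv (M x) $ k $ j)"
proof -
  have "smooth_on UNIV (\<lambda>x. ((\<chi> a b. if b = k then axis j 1 $ a else M x $ a $ b) :: real^'n^'n) $ a $ b)" for a b
    using M by (cases "b = k") simp_all
  then show ?thesis
    unfolding matrix_inv_cramer[OF nz]
    by (intro smooth_mult smooth_inverse smooth_det nz M) auto
qed

lemma dird_prod:
  fixes u :: "'i \<Rightarrow> 'a::euclidean_space \<Rightarrow> real"
  assumes "\<And>i. i \<in> I \<Longrightarrow> smooth_on UNIV (u i)"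
  shows "dird h (\<lambda>x. \<Prod>i\<in>I. u i x) x = (\<Sum>i\<in>I. dird h (u i) x * (\<Prod>j\<in>I - {i}. u j x))"
  by (rule dird_eqI[OF has_derivative_prod]) (rule smooth_has_derivative[OF assms])

text \<open>In the Leibniz expansion a permutation other than the identity moves at least two indices, so
  its term vanishes to second order at the identity matrix.\<close>

lemma dird_det_at_identity:
  fixes M :: "'a::euclidean_space \<Rightarrow> real^'n^'n"
  assumes M: "\<And>i j. smooth_on UNIV (\<lambda>x. M x $ i $ j)" and x: "M x = mat 1"
  shows "dird h (\<lambda>y. det (M y)) x = (\<Sum>i\<in>UNIV. dird h (\<lambda>y. M y $ i $ i) x)"
proof -
  let ?S = "{p. p permutes (UNIV :: 'n set)}"
  have "dird h (\<lambda>y. det (M y)) x = (\<Sum>p\<in>?S. of_int (sign p) * dird h (\<lambda>y. \<Prod>i\<in>UNIV. M y $ i $ p i) x)"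
    unfolding det_def by (simp add: dird_sum dird_mult smooth_mult smooth_const smooth_prod M)
  also have "\<dots> = (\<Sum>p\<in>?S. if p = id then (\<Sum>i\<in>UNIV. dird h (\<lambda>y. M y $ i $ i) x) else 0)"
  proof (intro sum.cong refl)
    fix p :: "'n \<Rightarrow> 'n" assume "p \<in> ?S"
    then have inj: "inj p" by (auto simp: permutes_inj)
    show "of_int (sign p) * dird h (\<lambda>y. \<Prod>i\<in>UNIV. M y $ i $ p i) x
       = (if p = id then (\<Sum>i\<in>UNIV. dird h (\<lambda>y. M y $ i $ i) x) else 0)"
    proof (cases "p = id")
      case True
      then show ?thesis by (simp add: dird_prod M x mat_def sign_id)
    next
      case False
      then obtain j where j: "p j \<noteq> j" by (auto simp: fun_eq_iff)
      have "(\<Prod>k\<in>UNIV - {i}. M x $ k $ p k) = 0" for i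
      proof -
        obtain k where "k \<noteq> i" "p k \<noteq> k"
        proof (cases "j = i")
          case True
          moreover have "p (p j) \<noteq> p j" using inj j by (simp add: inj_eq)
          ultimately show ?thesis using that[of "p j"] j by simp
        qed (use that j in auto)
        then show ?thesis by (intro prod_zero bexI[of _ k]) (auto simp: x mat_def)
      qed
      moreover have "dird h (\<lambda>y. \<Prod>i\<in>UNIV. M y $ i $ p i) x
          = (\<Sum>i\<in>UNIV. dird h (\<lambda>y. M y $ i $ p i) x * (\<Prod>k\<in>UNIV - {i}. M x $ k $ p k))"
        by (rule dird_prod) (rule M)
      ultimately show ?thesis using False by (simp only: mult_zero_right sum.neutral_const if_False)
    qed
  qed
  also have "\<dots> = (\<Sum>i\<in>UNIV. dird h (\<lambda>y. M y $ i $ i) x)"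
    using permutes_id[of "UNIV :: 'n set"] by (simp add: sum.delta finite_permutations)
  finally show ?thesis .
qed

text \<open>Jacobi's formula, reduced to the identity matrix by multiplying with the constant
  inverse of M x.\<close>

lemma dird_det:
  fixes M :: "'a::euclidean_space \<Rightarrow> real^'n^'n"
  assumes M: "\<And>i j. smooth_on UNIV (\<lambda>x. M x $ i $ j)" and nz: "det (M x) \<noteq> 0"
  shows "dird h (\<lambda>y. det (M y)) x
    = det (M x) * (\<Sum>p\<in>UNIV. \<Sum>q\<in>UNIV. matrix_inv (M x) $ p $ q * dird h (\<lambda>y. M y $ q $ p) x)"
proof -
  let ?G = "matrix_inv (M x)"
  have G: "det ?G * det (M x) = 1"
    using matrix_inv_inverse(2)[OF nz] by (metis det_I det_mul)
  have comp: "(?G ** M y) $ i $ j = (\<Sum>q\<in>UNIV. ?G $ i $ q * M y $ q $ j)" for y i j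
    by (simp add: matrix_matrix_mult_def)
  have sm: "smooth_on UNIV (\<lambda>y. (?G ** M y) $ i $ j)" for i j
    unfolding comp by (intro smooth_sum smooth_mult smooth_const M)
  have "det ?G * dird h (\<lambda>y. det (M y)) x = dird h (\<lambda>y. det (?G ** M y)) x"
    by (simp add: det_mul dird_mult smooth_det M)
  also have "\<dots> = (\<Sum>i\<in>UNIV. dird h (\<lambda>y. (?G ** M y) $ i $ i) x)"
    by (rule dird_det_at_identity[OF sm matrix_inv_inverse(2)[OF nz]])
  also have "\<dots> = (\<Sum>p\<in>UNIV. \<Sum>q\<in>UNIV. ?G $ p $ q * dird h (\<lambda>y. M y $ q $ p) x)"
    unfolding comp by (simp add: dird_sum dird_mult smooth_mult smooth_const M)
  finally have 1: "det ?G * dird h (\<lambda>y. det (M y)) x = (\<Sum>p\<in>UNIV. \<Sum>q\<in>UNIV. ?G $ p $ q * dird h (\<lambda>y. M y $ q $ p) x)" .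
  have "dird h (\<lambda>y. det (M y)) x = (det ?G * det (M x)) * dird h (\<lambda>y. det (M y)) x" by (simp add: G)
  then show ?thesis unfolding 1[symmetric] by (simp add: mult_ac)
qed

text \<open>The segment from the identity to \<open>M\<close> consists of invertible matrices.\<close>

lemma det_pos:
  fixes M :: "real^'n^'n"
  assumes M: "\<And>v. v \<bullet> (M *v v) \<ge> v \<bullet> v"
  shows "det M > 0"
proof -
  define N where "N s = (\<chi> i j. (1 - s) * (mat 1 :: real^'n^'n) $ i $ j + s * M $ i $ j)" for s :: real
  have Nv: "N s *v v = (1 - s) *\<^sub>R v + s *\<^sub>R (M *v v)" for s v
  proof -
    have "N s = (1 - s) *\<^sub>R mat 1 + s *\<^sub>R M" by (simp add: N_def vec_eq_iff)
    then show ?thesis by (simp add: matrix_vector_mult_add_rdistrib scaleR_matrix_vector_assoc[symmetric])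
  qed
  have nz: "det (N s) \<noteq> 0" if "0 \<le> s" "s \<le> 1" for s
  proof -
    have "v = 0" if "N s *v v = 0" for v
    proof -
      have "0 = v \<bullet> (N s *v v)" using that by simp
      also have "\<dots> = (1 - s) * (v \<bullet> v) + s * (v \<bullet> (M *v v))" by (simp add: Nv inner_add_right)
      also have "\<dots> \<ge> (1 - s) * (v \<bullet> v) + s * (v \<bullet> v)"
        using M \<open>0 \<le> s\<close> by (intro add_left_mono mult_left_mono) auto
      finally have "v \<bullet> v \<le> 0" by (simp add: algebra_simps)
      then show "v = 0" using inner_ge_zero[of v] by (simp add: order_antisym)
    qed
    then have "invertible (N s)"
      unfolding invertible_left_inverse matrix_left_invertible_ker by blast
    then show ?thesis by (simp add: invertible_det_nz)
  qed
  have cont: "continuous_on {0..1} (\<lambda>s. det (N s))"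
    unfolding det_def N_def vec_lambda_beta by (intro continuous_intros)
  have N0: "det (N 0) = 1" and N1: "N 1 = M" by (simp_all add: N_def vec_eq_iff[symmetric] det_I vec_lambda_eta)
  show ?thesis
  proof (rule ccontr)
    assume "\<not> det M > 0"
    then have "det (N 1) \<le> 0" by (simp add: N1)
    then obtain s where "0 \<le> s" "s \<le> 1" "det (N s) = 0"
      using IVT2'[of "\<lambda>s. det (N s)" 1 0 0] N0 cont by auto
    then show False using nz by blast
  qed
qed

lemma dird_sum_axis:
  fixes u :: "real^'n \<Rightarrow> 'b::real_normed_vector"
  assumes "smooth_on UNIV u"
  shows "dird h u x = (\<Sum>i\<in>UNIV. h $ i *\<^sub>R dird (axis i 1) u x)"
proof -
  interpret bounded_linear "\<lambda>h. dird h u x" using dird_bounded_linear[OF assms] .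
  have "h = (\<Sum>i\<in>UNIV. h $ i *\<^sub>R axis i 1)" by (simp add: basis_expansion scalar_mult_eq_scaleR[symmetric])
  then have "dird h u x = dird (\<Sum>i\<in>UNIV. h $ i *\<^sub>R axis i 1) u x" by (rule arg_cong)
  then show ?thesis by (simp add: sum scaleR)
qed

lemma partial_eq_dird:
  assumes "smooth_on UNIV u"
  shows "partial i u x = dird (axis i 1) u x"
  unfolding partial_def
  by (rule DERIV_imp_deriv) (use smooth_has_real_derivative_line[OF assms, of x "axis i 1" 0] in simp)

text \<open>The root is factored out of the derivative so that it can be cancelled from each
  equation of the system.\<close>

lemma partial_sqrt_mult:
  assumes "smooth_on UNIV u" "smooth_on UNIV v" "u x > 0"
  shows "partial i (\<lambda>y. sqrt (u y) * v y) x
    = sqrt (u x) * (dird (axis i 1) v x + dird (axis i 1) u x / (2 * u x) * v x)"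
proof -
  let ?l = "\<lambda>t. x + t *\<^sub>R axis i 1"
  have u: "((\<lambda>t. u (?l t)) has_real_derivative dird (axis i 1) u x) (at 0)"
    using smooth_has_real_derivative_line[OF assms(1), of x "axis i 1" 0] by simp
  have v: "((\<lambda>t. v (?l t)) has_real_derivative dird (axis i 1) v x) (at 0)"
    using smooth_has_real_derivative_line[OF assms(2), of x "axis i 1" 0] by simp
  have 1: "((\<lambda>t. sqrt (u (?l t)) * v (?l t)) has_real_derivative
     (dird (axis i 1) u x * (inverse (sqrt (u x)) / 2) * v x + dird (axis i 1) v x * sqrt (u x))) (at 0)"
    using assms(3) by (auto intro!: derivative_eq_intros u v)
  have 2: "dird (axis i 1) u x * (inverse (sqrt (u x)) / 2) * v x + dird (axis i 1) v x * sqrt (u x)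
     = sqrt (u x) * (dird (axis i 1) v x + dird (axis i 1) u x / (2 * u x) * v x)"
  proof -
    have "inverse (sqrt (u x)) = sqrt (u x) / u x"
      using assms(3) by (simp add: field_simps)
    then show ?thesis by (simp add: algebra_simps)
  qed
  show ?thesis unfolding partial_def using DERIV_imp_deriv[OF 1] unfolding 2 .
qed

lemma smooth_Pair: "smooth_on UNIV u \<Longrightarrow> smooth_on UNIV v \<Longrightarrow> smooth_on UNIV (\<lambda>x. (u x, v x))"
  using smooth_add[OF smooth_bounded_linear[OF bounded_linear_Pair[OF bounded_linear_ident bounded_linear_zero]]
      smooth_bounded_linear[OF bounded_linear_Pair[OF bounded_linear_zero bounded_linear_ident]], of u v]
  by simp

definition rank_one :: "'v \<Rightarrow> 'w \<Rightarrow> 'v::real_inner \<Rightarrow>\<^sub>L 'w::real_normed_vector" where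
  "rank_one a b = blinfun_scaleR_left b o\<^sub>L blinfun_inner_right a"

lemma rank_one_apply [simp]: "rank_one a b v = (a \<bullet> v) *\<^sub>R b"
  by (simp add: rank_one_def)

lemma smooth_rank_one: "smooth_on UNIV u \<Longrightarrow> smooth_on UNIV v \<Longrightarrow> smooth_on UNIV (\<lambda>x. rank_one (u x) (v x))"
  unfolding rank_one_def
  by (intro smooth_bilinear[OF bounded_bilinear_blinfun_compose]
     smooth_bounded_linear[OF bounded_linear_blinfun_scaleR_left] smooth_bounded_linear[OF bounded_linear_blinfun_inner_right])

section \<open>Metric, tangent projection and second derivatives of a graph\<close>

locale smooth_graph =
  fixes f :: "real^'n \<Rightarrow> real^'m"
  assumes smooth_f: "smooth_on UNIV f"
begin

abbreviation X :: "real^'n \<Rightarrow> (real^'n) \<times> (real^'m)" where "X \<equiv> graph_map f"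
definition Xd :: "'n \<Rightarrow> real^'n \<Rightarrow> (real^'n) \<times> (real^'m)" where "Xd i = dird (axis i 1) X"
definition Xdd :: "'n \<Rightarrow> 'n \<Rightarrow> real^'n \<Rightarrow> (real^'n) \<times> (real^'m)" where "Xdd k i = dird (axis k 1) (Xd i)"
definition G :: "'n \<Rightarrow> 'n \<Rightarrow> real^'n \<Rightarrow> real" where "G i j x = matrix_inv (metric f x) $ i $ j"
definition P :: "real^'n \<Rightarrow> ((real^'n) \<times> (real^'m)) \<Rightarrow>\<^sub>L ((real^'n) \<times> (real^'m))" where
  "P x = (\<Sum>i\<in>UNIV. \<Sum>j\<in>UNIV. G i j x *\<^sub>R rank_one (Xd j x) (Xd i x))"

lemma smooth_X: "smooth_on UNIV X"
  unfolding graph_map_def[abs_def] by (intro smooth_Pair smooth_ident smooth_f)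

lemma dird_X: "dird h X x = (h, dird h f x)"
  unfolding graph_map_def[abs_def]
  by (rule dird_eqI) (intro has_derivative_Pair has_derivative_ident smooth_has_derivative smooth_f)

lemma smooth_Xd: "smooth_on UNIV (Xd i)" unfolding Xd_def by (intro smooth_dird smooth_X)

lemma Xd_eq: "Xd i x = (axis i 1, dird (axis i 1) f x)" by (simp add: Xd_def dird_X)

lemma Xdd_sym: "Xdd k i x = Xdd i k x"
  unfolding Xdd_def Xd_def by (rule dird_dird_commute[OF smooth_X])

lemma Xdd_eq: "Xdd k i x = (0, dird (axis k 1) (dird (axis i 1) f) x)"
proof -
  have "Xd i = (\<lambda>x. (axis i 1, dird (axis i 1) f x))" using Xd_eq by blast
  then show ?thesis unfolding Xdd_def
    by (auto intro!: dird_eqI has_derivative_Pair has_derivative_const smooth_has_derivative smooth_dird smooth_f)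
qed

lemma dird_X_sum: "dird h X x = (\<Sum>i\<in>UNIV. h $ i *\<^sub>R Xd i x)"
  unfolding Xd_def by (rule dird_sum_axis[OF smooth_X])

lemma partial_f: "partial i (\<lambda>y. f y $ \<beta>) x = dird (axis i 1) f x $ \<beta>"
  by (simp add: partial_eq_dird smooth_bounded_linear[OF bounded_linear_vec_nth smooth_f]
      dird_linear[OF bounded_linear_vec_nth smooth_f])

lemma metric_eq: "metric f x $ i $ j = Xd i x \<bullet> Xd j x"
  by (simp add: metric_def partial_f Xd_eq inner_vec_def[of "dird _ f x"] inner_axis_axis)

lemma smooth_metric: "smooth_on UNIV (\<lambda>x. metric f x $ i $ j)"
  unfolding metric_eq by (intro smooth_inner smooth_Xd)

lemma det_metric_pos: "det (metric f x) > 0"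
proof (rule det_pos)
  fix v :: "real^'n"
  have "v \<bullet> (metric f x *v v) = dird v X x \<bullet> dird v X x"
    unfolding dird_X_sum
    by (simp add: inner_vec_def[of v] matrix_vector_mult_def metric_eq inner_sum_left inner_sum_right sum_distrib_left mult_ac)
      (simp add: inner_commute)
  then show "v \<bullet> v \<le> v \<bullet> (metric f x *v v)" by (simp add: dird_X)
qed

lemma det_metric_nz: "det (metric f x) \<noteq> 0" using det_metric_pos[of x] by simp

lemma smooth_G: "smooth_on UNIV (G i j)"
  unfolding G_def[abs_def] by (intro smooth_matrix_inv smooth_metric det_metric_nz)

lemma G_metric: "(\<Sum>k\<in>UNIV. G i k x * (Xd k x \<bullet> Xd j x)) = (if i = j then 1 else 0)"
  using arg_cong[OF matrix_inv_inverse(2)[OF det_metric_nz[of x]], of "\<lambda>M. M $ i $ j"]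
  by (simp add: matrix_matrix_mult_def mat_def G_def metric_eq)

lemma metric_G: "(\<Sum>k\<in>UNIV. (Xd i x \<bullet> Xd k x) * G k j x) = (if i = j then 1 else 0)"
  using arg_cong[OF matrix_inv_inverse(1)[OF det_metric_nz[of x]], of "\<lambda>M. M $ i $ j"]
  by (simp add: matrix_matrix_mult_def mat_def G_def metric_eq)

lemma G_sym: "G i j x = G j i x"
proof -
  have "G i j x = (\<Sum>l\<in>UNIV. G i l x * (if l = j then 1 else 0))"
    by (simp add: if_distrib[of "\<lambda>c. _ * c"] cong: if_cong)
  also have "\<dots> = (\<Sum>l\<in>UNIV. G i l x * (\<Sum>k\<in>UNIV. G j k x * (Xd k x \<bullet> Xd l x)))"
    by (simp only: G_metric eq_commute[of j])
  also have "\<dots> = (\<Sum>l\<in>UNIV. \<Sum>k\<in>UNIV. G i l x * (G j k x * (Xd k x \<bullet> Xd l x)))"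
    by (simp only: sum_distrib_left)
  also have "\<dots> = (\<Sum>k\<in>UNIV. \<Sum>l\<in>UNIV. G i l x * (G j k x * (Xd k x \<bullet> Xd l x)))"
    by (rule sum.swap)
  also have "\<dots> = (\<Sum>k\<in>UNIV. G j k x * (\<Sum>l\<in>UNIV. G i l x * (Xd l x \<bullet> Xd k x)))"
    by (simp add: sum_distrib_left inner_commute mult_ac)
  also have "\<dots> = (\<Sum>k\<in>UNIV. if i = k then G j k x else 0)"
    by (intro sum.cong refl) (simp add: G_metric)
  also have "\<dots> = G j i x" by simp
  finally show ?thesis .
qed

lemma P_apply: "P x v = (\<Sum>i\<in>UNIV. \<Sum>j\<in>UNIV. (G i j x * (Xd j x \<bullet> v)) *\<^sub>R Xd i x)"
  by (simp add: P_def blinfun.sum_left blinfun.scaleR_left)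

lemma smooth_P: "smooth_on UNIV P"
  unfolding P_def[abs_def] by (intro smooth_sum smooth_scaleR smooth_G smooth_rank_one smooth_Xd)

lemma P_Xd: "P x (Xd k x) = Xd k x"
proof -
  have "P x (Xd k x) = (\<Sum>i\<in>UNIV. (\<Sum>j\<in>UNIV. G i j x * (Xd j x \<bullet> Xd k x)) *\<^sub>R Xd i x)"
    by (simp add: P_apply scaleR_sum_left)
  then show ?thesis by (simp add: G_metric if_distrib[of "\<lambda>c. c *\<^sub>R _"] cong: if_cong)
qed

lemma P_dird_X: "P x (dird h X x) = dird h X x"
  by (simp add: dird_X_sum blinfun.sum_right blinfun.scaleR_right P_Xd)

lemma P_symmetric: "P x a \<bullet> b = a \<bullet> P x b"
proof -
  have "P x a \<bullet> b = (\<Sum>i\<in>UNIV. \<Sum>j\<in>UNIV. G i j x * (Xd j x \<bullet> a) * (Xd i x \<bullet> b))"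
    by (simp add: P_apply inner_sum_left)
  also have "\<dots> = (\<Sum>j\<in>UNIV. \<Sum>i\<in>UNIV. G i j x * (Xd j x \<bullet> a) * (Xd i x \<bullet> b))"
    by (rule sum.swap)
  also have "\<dots> = a \<bullet> P x b"
    by (simp add: P_apply inner_sum_right inner_commute[of a] G_sym mult_ac)
  finally show ?thesis .
qed

lemma fst_P: "fst (P x v) $ k = (\<Sum>j\<in>UNIV. G k j x * (Xd j x \<bullet> v))"
proof -
  have "fst (P x v) $ k = (\<Sum>i\<in>UNIV. \<Sum>j\<in>UNIV. G i j x * (Xd j x \<bullet> v) * axis i 1 $ k)"
    by (simp add: P_apply fst_sum Xd_eq)
  also have "\<dots> = (\<Sum>i\<in>UNIV. (\<Sum>j\<in>UNIV. G i j x * (Xd j x \<bullet> v)) * axis i 1 $ k)"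
    by (simp only: sum_distrib_right)
  also have "\<dots> = (\<Sum>i\<in>UNIV. if i = k then (\<Sum>j\<in>UNIV. G i j x * (Xd j x \<bullet> v)) else 0)"
    by (intro sum.cong refl) (simp add: axis_def)
  finally show ?thesis by simp
qed

lemma dird_X_fst_P: "dird (fst (P x a)) X x = P x a"
  unfolding dird_X_sum fst_P by (simp add: P_apply scaleR_sum_left)

lemma dird_metric: "dird h (\<lambda>y. metric f y $ i $ j) x = dird h (Xd i) x \<bullet> Xd j x + Xd i x \<bullet> dird h (Xd j) x"
  unfolding metric_eq by (simp add: dird_inner smooth_Xd add.commute)

text \<open>Differentiating the identity G g = 1 and multiplying by the inverse from the
  right.\<close>

lemma dird_G: "dird h (G i j) x
   = - (\<Sum>p\<in>UNIV. \<Sum>q\<in>UNIV. G i p x * dird h (\<lambda>y. metric f y $ p $ q) x * G q j x)"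
proof -
  let ?d = "\<lambda>p q. dird h (\<lambda>y. metric f y $ p $ q) x"
  have 1: "(\<Sum>p\<in>UNIV. dird h (G i p) x * metric f x $ p $ q) = - (\<Sum>p\<in>UNIV. G i p x * ?d p q)" for q
  proof -
    have "dird h (\<lambda>y. \<Sum>p\<in>UNIV. G i p y * metric f y $ p $ q) x = 0"
      by (simp add: metric_eq G_metric)
    moreover have "dird h (\<lambda>y. \<Sum>p\<in>UNIV. G i p y * metric f y $ p $ q) x
       = (\<Sum>p\<in>UNIV. G i p x * ?d p q + dird h (G i p) x * metric f x $ p $ q)"
      by (simp add: dird_sum dird_mult smooth_mult smooth_G smooth_metric)
    ultimately show ?thesis by (simp add: sum.distrib)
  qed
  have "dird h (G i j) x = (\<Sum>p\<in>UNIV. dird h (G i p) x * (\<Sum>q\<in>UNIV. metric f x $ p $ q * G q j x))"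
    by (simp add: metric_eq metric_G if_distrib[of "\<lambda>c. _ * c"] cong: if_cong)
  also have "\<dots> = (\<Sum>p\<in>UNIV. \<Sum>q\<in>UNIV. dird h (G i p) x * metric f x $ p $ q * G q j x)"
    by (simp add: sum_distrib_left mult.assoc)
  also have "\<dots> = (\<Sum>q\<in>UNIV. \<Sum>p\<in>UNIV. dird h (G i p) x * metric f x $ p $ q * G q j x)"
    by (rule sum.swap)
  also have "\<dots> = (\<Sum>q\<in>UNIV. - (\<Sum>p\<in>UNIV. G i p x * ?d p q) * G q j x)"
    by (simp only: sum_distrib_right[symmetric] 1)
  also have "\<dots> = - (\<Sum>q\<in>UNIV. \<Sum>p\<in>UNIV. G i p x * ?d p q * G q j x)"
    by (simp add: sum_distrib_right sum_negf)
  also have "(\<Sum>q\<in>UNIV. \<Sum>p\<in>UNIV. G i p x * ?d p q * G q j x) = (\<Sum>p\<in>UNIV. \<Sum>q\<in>UNIV. G i p x * ?d p q * G q j x)"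
    by (rule sum.swap)
  finally show ?thesis .
qed

lemma smooth_det_metric: "smooth_on UNIV (\<lambda>y. det (metric f y))"
  by (intro smooth_det smooth_metric)

lemma dird_det_metric: "dird h (\<lambda>y. det (metric f y)) x
    = 2 * det (metric f x) * (\<Sum>p\<in>UNIV. \<Sum>q\<in>UNIV. G p q x * (Xd q x \<bullet> dird h (Xd p) x))"
proof -
  let ?s = "\<lambda>p q. G p q x * (Xd q x \<bullet> dird h (Xd p) x)"
  have "(\<Sum>p\<in>UNIV. \<Sum>q\<in>UNIV. G p q x * dird h (\<lambda>y. metric f y $ q $ p) x)
    = (\<Sum>p\<in>UNIV. \<Sum>q\<in>UNIV. ?s p q) + (\<Sum>p\<in>UNIV. \<Sum>q\<in>UNIV. ?s q p)"
    unfolding dird_metric by (simp add: sum.distrib distrib_left inner_commute[of "dird h _ x"] G_sym add.commute)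
  also have "(\<Sum>p\<in>UNIV. \<Sum>q\<in>UNIV. ?s q p) = (\<Sum>p\<in>UNIV. \<Sum>q\<in>UNIV. ?s p q)" by (rule sum.swap)
  finally show ?thesis
    using dird_det[of "metric f" x h, OF smooth_metric det_metric_nz] by (simp add: G_def)
qed

text \<open>The second-order part of the Laplacian of \<open>X\<close>; its normal part is the mean
  curvature vector.\<close>

definition Y :: "real^'n \<Rightarrow> (real^'n) \<times> (real^'m)" where
  "Y x = (\<Sum>i\<in>UNIV. \<Sum>j\<in>UNIV. G i j x *\<^sub>R Xdd i j x)"

text \<open>The left side is the divergence of sqrt g g^{ij} divided by sqrt g, a contracted
  Christoffel symbol. Differentiating the metric gives two sums; the second cancels the logarithmic
  derivative of sqrt g because \<open>Xdd\<close> is symmetric.\<close>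

lemma sum_dird_G: "(\<Sum>i\<in>UNIV. dird (axis i 1) (G i j) x
    + (\<Sum>p\<in>UNIV. \<Sum>q\<in>UNIV. G p q x * (Xd q x \<bullet> Xdd i p x)) * G i j x)
    = - (\<Sum>q\<in>UNIV. G q j x * (Xd q x \<bullet> Y x))"
proof -
  have a: "(\<Sum>i\<in>UNIV. \<Sum>p\<in>UNIV. \<Sum>q\<in>UNIV. G i p x * (Xdd i p x \<bullet> Xd q x) * G q j x)
     = (\<Sum>q\<in>UNIV. G q j x * (Xd q x \<bullet> Y x))"
  proof -
    have "(\<Sum>i\<in>UNIV. \<Sum>p\<in>UNIV. \<Sum>q\<in>UNIV. G i p x * (Xdd i p x \<bullet> Xd q x) * G q j x)
      = (\<Sum>i\<in>UNIV. \<Sum>q\<in>UNIV. \<Sum>p\<in>UNIV. G i p x * (Xdd i p x \<bullet> Xd q x) * G q j x)"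
      by (rule sum.cong[OF refl], rule sum.swap)
    also have "\<dots> = (\<Sum>q\<in>UNIV. \<Sum>i\<in>UNIV. \<Sum>p\<in>UNIV. G i p x * (Xdd i p x \<bullet> Xd q x) * G q j x)"
      by (rule sum.swap)
    finally show ?thesis
      by (simp add: Y_def inner_sum_right sum_distrib_left inner_commute mult_ac)
  qed
  have b: "(\<Sum>i\<in>UNIV. \<Sum>p\<in>UNIV. \<Sum>q\<in>UNIV. G i p x * (Xd p x \<bullet> Xdd i q x) * G q j x)
     = (\<Sum>i\<in>UNIV. (\<Sum>p\<in>UNIV. \<Sum>q\<in>UNIV. G p q x * (Xd q x \<bullet> Xdd i p x)) * G i j x)"
  proof -
    have "(\<Sum>i\<in>UNIV. \<Sum>p\<in>UNIV. \<Sum>q\<in>UNIV. G i p x * (Xd p x \<bullet> Xdd i q x) * G q j x)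
      = (\<Sum>i\<in>UNIV. \<Sum>q\<in>UNIV. \<Sum>p\<in>UNIV. G i p x * (Xd p x \<bullet> Xdd i q x) * G q j x)"
      by (rule sum.cong[OF refl], rule sum.swap)
    also have "\<dots> = (\<Sum>q\<in>UNIV. \<Sum>i\<in>UNIV. \<Sum>p\<in>UNIV. G i p x * (Xd p x \<bullet> Xdd i q x) * G q j x)"
      by (rule sum.swap)
    also have "\<dots> = (\<Sum>q\<in>UNIV. \<Sum>i\<in>UNIV. \<Sum>p\<in>UNIV. G i p x * (Xd p x \<bullet> Xdd q i x) * G q j x)"
      by (intro sum.cong refl) (simp only: Xdd_sym)
    finally show ?thesis by (simp add: sum_distrib_right)
  qed
  have "(\<Sum>i\<in>UNIV. dird (axis i 1) (G i j) x)
     = - ((\<Sum>i\<in>UNIV. \<Sum>p\<in>UNIV. \<Sum>q\<in>UNIV. G i p x * (Xdd i p x \<bullet> Xd q x) * G q j x)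
        + (\<Sum>i\<in>UNIV. \<Sum>p\<in>UNIV. \<Sum>q\<in>UNIV. G i p x * (Xd p x \<bullet> Xdd i q x) * G q j x))"
    unfolding dird_G dird_metric Xdd_def[symmetric]
    by (simp add: sum_negf distrib_left distrib_right sum.distrib sum_subtractf)
  then show ?thesis unfolding sum.distrib a b by simp
qed

end

section \<open>Mean curvature, volume density and flat frames of a minimal graph\<close>

locale minimal_graph = smooth_graph f for f :: "real^'n \<Rightarrow> real^'m" +
  assumes minimal_system: "minimal_surface_system f"
begin

text \<open>The system in nondivergence form: its second-order terms are the second component of Y,
  and by \<open>sum_dird_G\<close> its first-order terms are that of -P Y.\<close>

lemma snd_normal_Y: "snd (Y x - P x (Y x)) = 0"
proof -
  let ?F = "\<lambda>j. dird (axis j 1) f"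
  let ?\<tau> = "\<lambda>i. \<Sum>p\<in>UNIV. \<Sum>q\<in>UNIV. G p q x * (Xd q x \<bullet> Xdd i p x)"
  have "(\<Sum>i\<in>UNIV. \<Sum>j\<in>UNIV. G i j x *\<^sub>R dird (axis i 1) (?F j) x
      + (dird (axis i 1) (G i j) x + ?\<tau> i * G i j x) *\<^sub>R ?F j x) = 0" (is "?S = 0")
  proof (rule vec_eq_iff[THEN iffD2], rule allI)
    fix \<alpha>
    have sF: "smooth_on UNIV (\<lambda>y. ?F j y $ \<alpha>)" for j
      by (intro smooth_bounded_linear[OF bounded_linear_vec_nth] smooth_dird smooth_f)
    have dF: "dird h (\<lambda>y. ?F j y $ \<alpha>) x = dird h (?F j) x $ \<alpha>" for h j
      by (rule dird_linear[OF bounded_linear_vec_nth]) (intro smooth_dird smooth_f)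
    have "partial i (\<lambda>y. sqrt (det (metric f y)) * matrix_inv (metric f y) $ i $ j * partial j (\<lambda>z. f z $ \<alpha>) y) x
      = sqrt (det (metric f x)) * (G i j x * dird (axis i 1) (?F j) x $ \<alpha>
          + (dird (axis i 1) (G i j) x + ?\<tau> i * G i j x) * ?F j x $ \<alpha>)" for i j
    proof -
      have "partial i (\<lambda>y. sqrt (det (metric f y)) * (G i j y * ?F j y $ \<alpha>)) x
        = sqrt (det (metric f x)) * (dird (axis i 1) (\<lambda>y. G i j y * ?F j y $ \<alpha>) x
            + dird (axis i 1) (\<lambda>y. det (metric f y)) x / (2 * det (metric f x)) * (G i j x * ?F j x $ \<alpha>))"
        by (intro partial_sqrt_mult smooth_det_metric smooth_mult smooth_G sF det_metric_pos)
      moreover have "dird (axis i 1) (\<lambda>y. det (metric f y)) x / (2 * det (metric f x)) = ?\<tau> i"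
        using det_metric_nz[of x] by (simp add: dird_det_metric Xdd_def)
      moreover have "dird (axis i 1) (\<lambda>y. G i j y * ?F j y $ \<alpha>) x
          = G i j x * dird (axis i 1) (?F j) x $ \<alpha> + dird (axis i 1) (G i j) x * ?F j x $ \<alpha>"
        by (simp add: dird_mult smooth_G sF dF)
      ultimately show ?thesis
        by (simp add: partial_f G_def[symmetric] mult.assoc distrib_right)
    qed
    then have "sqrt (det (metric f x)) * ?S $ \<alpha>
      = (\<Sum>i\<in>UNIV. \<Sum>j\<in>UNIV. partial i (\<lambda>y. sqrt (det (metric f y)) * matrix_inv (metric f y) $ i $ j * partial j (\<lambda>z. f z $ \<alpha>) y) x)"
      by (simp add: sum_distrib_left)
    also have "\<dots> = 0" using minimal_system unfolding minimal_surface_system_def by blast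
    finally show "?S $ \<alpha> = 0 $ \<alpha>" using det_metric_nz[of x] by simp
  qed
  moreover have "(\<Sum>i\<in>UNIV. \<Sum>j\<in>UNIV. (dird (axis i 1) (G i j) x + ?\<tau> i * G i j x) *\<^sub>R ?F j x)
     = (\<Sum>j\<in>UNIV. (\<Sum>i\<in>UNIV. dird (axis i 1) (G i j) x + ?\<tau> i * G i j x) *\<^sub>R ?F j x)"
    by (subst sum.swap) (simp add: scaleR_sum_left)
  moreover have "\<dots> = - snd (P x (Y x))"
    unfolding sum_dird_G by (simp add: P_apply snd_sum Xd_eq scaleR_sum_left[symmetric] G_sym sum_negf)
  moreover have "snd (Y x) = (\<Sum>i\<in>UNIV. \<Sum>j\<in>UNIV. G i j x *\<^sub>R dird (axis i 1) (?F j) x)"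
    by (simp add: Y_def snd_sum Xdd_eq)
  ultimately show ?thesis by (simp add: sum.distrib)
qed

text \<open>The system supplies only m equations. A normal vector is nevertheless determined by its
  second component, since orthogonality to the coordinate fields fixes the first.\<close>

lemma normal_Y: "Y x - P x (Y x) = 0"
proof -
  let ?w = "Y x - P x (Y x)"
  have "?w \<bullet> Xd k x = 0" for k
    by (simp add: inner_diff_left P_symmetric P_Xd)
  then have "fst ?w $ k = 0" for k
    using snd_normal_Y[of x] by (simp add: Xd_eq inner_Pair_0 inner_prod_def inner_axis)
  then have "fst ?w = 0" by (simp add: vec_eq_iff)
  then show ?thesis using snd_normal_Y[of x] by (simp add: prod_eq_iff)
qed

lemma dird_P_Xd: "dird (axis k 1) P x (Xd j x) = Xdd k j x - P x (Xdd k j x)"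
proof -
  have "dird (axis k 1) (\<lambda>y. P y (Xd j y)) x = Xdd k j x" by (simp add: P_Xd Xdd_def)
  then show ?thesis by (simp add: dird_blinfun_apply smooth_P smooth_Xd Xdd_def algebra_simps)
qed

text \<open>The trace is rewritten in the coordinate fields with the inverse metric and becomes the
  normal part of \<open>Y\<close>.\<close>

lemma mean_curvature_0: "(\<Sum>a\<in>Basis. blinfun_apply (dird (fst (P x a)) P x) a) = 0"
proof -
  have "(\<Sum>a\<in>Basis. blinfun_apply (dird (fst (P x a)) P x) a)
    = (\<Sum>a\<in>Basis. \<Sum>k\<in>UNIV. \<Sum>j\<in>UNIV. (G k j x * (Xd j x \<bullet> a)) *\<^sub>R dird (axis k 1) P x a)"
    by (simp add: dird_sum_axis[OF smooth_P, of "fst _"] fst_P blinfun.sum_left blinfun.scaleR_left scaleR_sum_left)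
  also have "\<dots> = (\<Sum>k\<in>UNIV. \<Sum>a\<in>Basis. \<Sum>j\<in>UNIV. (G k j x * (Xd j x \<bullet> a)) *\<^sub>R dird (axis k 1) P x a)"
    by (rule sum.swap)
  also have "\<dots> = (\<Sum>k\<in>UNIV. \<Sum>j\<in>UNIV. \<Sum>a\<in>Basis. (G k j x * (Xd j x \<bullet> a)) *\<^sub>R dird (axis k 1) P x a)"
    by (rule sum.cong[OF refl], rule sum.swap)
  also have "\<dots> = (\<Sum>k\<in>UNIV. \<Sum>j\<in>UNIV. G k j x *\<^sub>R dird (axis k 1) P x (\<Sum>a\<in>Basis. (Xd j x \<bullet> a) *\<^sub>R a))"
    by (simp only: blinfun.sum_right blinfun.scaleR_right scaleR_sum_right scaleR_scaleR)
  also have "\<dots> = Y x - P x (Y x)"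
    by (simp only: euclidean_representation dird_P_Xd Y_def blinfun.sum_right blinfun.scaleR_right
        scaleR_diff_right sum_subtractf)
  finally show ?thesis by (simp only: normal_Y)
qed

sublocale minimal_immersion X fst P
  by (rule minimal_immersion.intro)
    (rule smooth_X smooth_P bounded_linear_fst P_dird_X dird_X_fst_P P_symmetric mean_curvature_0 |
      simp add: dird_X)+

text \<open>The trace in \<open>dlog\<close> sees only the first components of A(Xd p). As
  \<open>Xd p\<close> has a constant first component, these come entirely from -P(d Xd p), and their
  sum is the one in Jacobi's formula.\<close>

lemma D_det_metric: "D a (\<lambda>y. det (metric f y)) x = 2 * det (metric f x) * dlog a x"
proof -
  let ?h = "fst (P x a)"
  have 1: "A a x (Xd p x) = dird ?h (Xd p) x - P x (dird ?h (Xd p) x)" for p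
  proof -
    have "dird ?h (\<lambda>y. P y (Xd p y)) x = dird ?h (Xd p) x" by (simp add: P_Xd)
    then show ?thesis by (simp add: A_def D_def dird_blinfun_apply smooth_P smooth_Xd algebra_simps)
  qed
  have f0: "fst (dird h (Xd p) x) = 0" for h p
    unfolding dird_sum_axis[OF smooth_Xd, of h] by (simp add: fst_sum Xdd_def[symmetric] Xdd_eq)
  have "(\<Sum>b\<in>Basis. oblique b x \<bullet> A a x b) = (\<Sum>b\<in>Basis. \<Sum>p\<in>UNIV. fst b $ p * (A a x (Xd p x) \<bullet> b))"
    unfolding oblique_def dird_X_sum by (simp add: inner_sum_left A_sym)
  also have "\<dots> = (\<Sum>p\<in>UNIV. \<Sum>b\<in>Basis. fst b $ p * (A a x (Xd p x) \<bullet> b))" by (rule sum.swap)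
  also have "\<dots> = (\<Sum>p\<in>UNIV. fst (\<Sum>b\<in>Basis. (A a x (Xd p x) \<bullet> b) *\<^sub>R b) $ p)"
    by (simp add: fst_sum mult.commute del: euclidean_representation)
  also have "\<dots> = (\<Sum>p\<in>UNIV. fst (A a x (Xd p x)) $ p)" by (simp add: euclidean_representation)
  also have "\<dots> = - (\<Sum>p\<in>UNIV. \<Sum>q\<in>UNIV. G p q x * (Xd q x \<bullet> dird ?h (Xd p) x))"
    unfolding 1 by (simp add: f0 fst_P sum_negf)
  finally show ?thesis by (simp add: dlog_def D_def dird_det_metric)
qed

text \<open>One predicate for all pointwise conditions, so that a frame can be chosen independently
  at each point.\<close>

definition flat_frame_at :: "real^'n \<Rightarrow> ('n \<Rightarrow> (real^'n) \<times> (real^'m)) \<Rightarrow> ('m \<Rightarrow> (real^'n) \<times> (real^'m)) \<Rightarrow> bool" where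
  "flat_frame_at x t nu \<longleftrightarrow> (\<forall>i. P x (t i) = t i) \<and> (\<forall>\<alpha>. P x (nu \<alpha>) = 0)
    \<and> (\<forall>i k. t i \<bullet> t k = (if i = k then 1 else 0))
    \<and> (\<forall>\<alpha> \<beta>. nu \<alpha> \<bullet> nu \<beta> = (if \<alpha> = \<beta> then 1 else 0))
    \<and> (\<forall>v. v = (\<Sum>i\<in>UNIV. (v \<bullet> t i) *\<^sub>R t i) + (\<Sum>\<alpha>\<in>UNIV. (v \<bullet> nu \<alpha>) *\<^sub>R nu \<alpha>))
    \<and> (\<forall>i \<alpha> k \<beta>. A (t i) x (nu \<alpha>) \<bullet> A (t k) x (nu \<beta>) = A (t k) x (nu \<alpha>) \<bullet> A (t i) x (nu \<beta>))"

lemma flat_frame_exists: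
  assumes "flat_normal_bundle f"
  shows "\<exists>t nu. flat_frame_at x t nu"
proof -
  obtain U T N where U: "open U" "x \<in> U" and fr: "adapted_frame f U T N"
    and cu: "\<And>\<alpha> \<beta> i j. normal_curvature T N \<alpha> \<beta> i j x = 0"
    using assms unfolding flat_normal_bundle_def by metis
  have ts: "tangent_space f y = range (\<lambda>h. dird h X y)" for y
    by (simp add: tangent_space_def dird_def)
  have Tt: "P x (T i x) = T i x" for i
  proof -
    have "T i x \<in> range (\<lambda>h. dird h X x)" using fr U unfolding adapted_frame_def ts by blast
    then show ?thesis using P_dird_X by auto
  qed
  have Nn: "P y (N \<alpha> y) = 0" if "y \<in> U" for y \<alpha>
  proof -
    have "N \<alpha> y \<in> (range (\<lambda>h. dird h X y))\<^sup>\<bottom>"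
      using fr that unfolding adapted_frame_def normal_space_def ts by blast
    then have "Xd j y \<bullet> N \<alpha> y = 0" for j
      by (auto simp: orthogonal_comp_def orthogonal_def Xd_def)
    then show ?thesis by (simp add: P_apply)
  qed
  have To: "T i x \<bullet> T k x = (if i = k then 1 else 0)" for i k
    using fr U unfolding adapted_frame_def by blast
  have No: "N \<alpha> x \<bullet> N \<beta> x = (if \<alpha> = \<beta> then 1 else 0)" for \<alpha> \<beta>
    using fr U unfolding adapted_frame_def by blast
  have TN: "T i x \<bullet> N \<alpha> x = 0" for i \<alpha>
    using P_symmetric[of x "T i x" "N \<alpha> x"] by (simp add: Tt Nn[OF U(2)])
  \<comment> \<open>The n + m orthonormal vectors span the ambient space by counting
    dimensions.\<close>
  have ex: "v = (\<Sum>i\<in>UNIV. (v \<bullet> T i x) *\<^sub>R T i x) + (\<Sum>\<alpha>\<in>UNIV. (v \<bullet> N \<alpha> x) *\<^sub>R N \<alpha> x)" for v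
  proof -
    define S1 where "S1 = range (\<lambda>i. T i x)"
    define S2 where "S2 = range (\<lambda>\<alpha>. N \<alpha> x)"
    have i1: "inj (\<lambda>i. T i x)" using To by (intro injI) (metis zero_neq_one)
    have i2: "inj (\<lambda>\<alpha>. N \<alpha> x)" using No by (intro injI) (metis zero_neq_one)
    have dis: "S1 \<inter> S2 = {}"
    proof -
      have "T i x \<noteq> N \<alpha> x" for i \<alpha> using TN[of i \<alpha>] To[of i i] by auto
      then show ?thesis unfolding S1_def S2_def by blast
    qed
    have orth: "pairwise orthogonal (S1 \<union> S2)"
    proof (rule pairwiseI)
      fix u v assume "u \<in> S1 \<union> S2" "v \<in> S1 \<union> S2" and ne: "u \<noteq> v"
      then have "(\<exists>i. u = T i x) \<or> (\<exists>\<alpha>. u = N \<alpha> x)" "(\<exists>i. v = T i x) \<or> (\<exists>\<alpha>. v = N \<alpha> x)"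
        unfolding S1_def S2_def by blast+
      moreover have "N \<alpha> x \<bullet> T i x = 0" for i \<alpha> using TN[of i \<alpha>] by (simp add: inner_commute)
      ultimately have "u \<bullet> v = 0" using ne by (elim disjE exE) (simp_all add: To No TN split: if_splits, blast+)
      then show "orthogonal u v" by (simp add: orthogonal_def)
    qed
    have unit: "norm b = 1" if "b \<in> S1 \<union> S2" for b
      using that To No by (auto simp: S1_def S2_def norm_eq_1)
    have "card (S1 \<union> S2) = CARD('n) + CARD('m)"
      using dis i1 i2 by (simp add: card_Un_disjoint S1_def S2_def card_image)
    then have card: "card (S1 \<union> S2) = DIM((real^'n) \<times> (real^'m))" by simp
    have ind: "independent (S1 \<union> S2)"
      by (rule pairwise_orthogonal_independent[OF orth]) (metis unit norm_zero zero_neq_one)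
    have fin: "finite (S1 \<union> S2)" by (simp add: S1_def S2_def)
    then have "UNIV \<subseteq> span (S1 \<union> S2)"
      using card_eq_dim[of "S1 \<union> S2" UNIV] ind card by (simp add: dim_UNIV)
    then have "v \<in> span (S1 \<union> S2)" by blast
    then have "v = (\<Sum>b\<in>S1 \<union> S2. (v \<bullet> b) *\<^sub>R b)"
      by (intro orthonormal_basis_expand[symmetric] orth unit fin)
    also have "\<dots> = (\<Sum>b\<in>S1. (v \<bullet> b) *\<^sub>R b) + (\<Sum>b\<in>S2. (v \<bullet> b) *\<^sub>R b)"
      by (rule sum.union_disjoint) (use dis in \<open>auto simp: S1_def S2_def\<close>)
    finally show ?thesis by (simp add: S1_def S2_def sum.reindex[OF i1] sum.reindex[OF i2])
  qed
  have PA: "P x (A a x (N \<alpha> x)) = A a x (N \<alpha> x)" for a \<alpha>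
    using A_P[of a x "N \<alpha> x"] by (simp add: Nn[OF U(2)])
  \<comment> \<open>P N = 0 holds on the open set \<open>U\<close> and may be differentiated at
    \<open>x\<close>. This moves the derivative from the normal field to \<open>P\<close> and
    changes the sign, which cancels in the quadratic curvature expression.\<close>
  have h: "second_fundamental_coeff T N \<alpha> i k x = - (A (T i x) x (N \<alpha> x) \<bullet> T k x)" for \<alpha> i k
  proof -
    let ?h = "fst (T i x)"
    have "N \<alpha> differentiable at x"
    proof -
      have "smooth_on U (N \<alpha>)" using fr unfolding adapted_frame_def by blast
      then have "Ck_on (Suc 0) U (N \<alpha>)" unfolding smooth_on_def by blast
      then have "N \<alpha> differentiable_on U" by simp
      then show ?thesis using U by (simp add: differentiable_on_eq_differentiable_at)
    qed
    then have dN: "(N \<alpha> has_derivative (\<lambda>h. dird h (N \<alpha>) x)) (at x)" by (rule differentiable_dird)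
    have d: "((\<lambda>y. P y (N \<alpha> y)) has_derivative (\<lambda>h. P x (dird h (N \<alpha>) x) + dird h P x (N \<alpha> x))) (at x)"
      by (rule bounded_bilinear.FDERIV[OF bounded_bilinear_blinfun_apply smooth_has_derivative[OF smooth_P] dN])
    moreover have "((\<lambda>y. P y (N \<alpha> y)) has_derivative (\<lambda>h. 0)) (at x)"
      by (rule has_derivative_transform_within_open[OF has_derivative_const U]) (simp add: Nn)
    ultimately have "(\<lambda>h. P x (dird h (N \<alpha>) x) + dird h P x (N \<alpha> x)) = (\<lambda>h. 0)"
      by (rule has_derivative_unique)
    from fun_cong[OF this, of ?h]
    have 1: "P x (dird ?h (N \<alpha>) x) = - A (T i x) x (N \<alpha> x)"
      by (simp add: A_def D_def Tt eq_neg_iff_add_eq_0)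
    have "second_fundamental_coeff T N \<alpha> i k x = dird ?h (N \<alpha>) x \<bullet> P x (T k x)"
      by (simp add: second_fundamental_coeff_def flat_connection_def dird_def Tt)
    also have "\<dots> = P x (dird ?h (N \<alpha>) x) \<bullet> T k x" by (simp add: P_symmetric)
    finally show ?thesis unfolding 1 by simp
  qed
  have inn: "A a x (N \<alpha> x) \<bullet> A b x (N \<beta> x) = (\<Sum>k\<in>UNIV. (A a x (N \<alpha> x) \<bullet> T k x) * (A b x (N \<beta> x) \<bullet> T k x))" for a b \<alpha> \<beta>
  proof -
    let ?v = "A a x (N \<alpha> x)" and ?w = "A b x (N \<beta> x)"
    have "?v \<bullet> N \<gamma> x = 0" for \<gamma>
      using P_symmetric[of x ?v "N \<gamma> x"] by (simp add: PA Nn[OF U(2)])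
    then have "?v = (\<Sum>k\<in>UNIV. (?v \<bullet> T k x) *\<^sub>R T k x)" using ex[of ?v] by simp
    then have "?v \<bullet> ?w = (\<Sum>k\<in>UNIV. (?v \<bullet> T k x) *\<^sub>R T k x) \<bullet> ?w" by (rule arg_cong)
    then show ?thesis by (simp add: inner_sum_left inner_commute[of ?w])
  qed
  have "A (T i x) x (N \<alpha> x) \<bullet> A (T k x) x (N \<beta> x) = A (T k x) x (N \<alpha> x) \<bullet> A (T i x) x (N \<beta> x)" for i \<alpha> k \<beta>
    using cu[of \<alpha> \<beta> i k] unfolding normal_curvature_def Let_def h inn by (simp add: sum_subtractf)
  then show ?thesis
    using Tt Nn[OF U(2)] To No ex unfolding flat_frame_at_def by (intro exI[of _ "\<lambda>i. T i x"] exI[of _ "\<lambda>\<alpha>. N \<alpha> x"] conjI allI)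
qed

lemma calibrated:
  assumes "flat_normal_bundle f"
  obtains t :: "real^'n \<Rightarrow> 'n \<Rightarrow> (real^'n) \<times> (real^'m)" and nu :: "real^'n \<Rightarrow> 'm \<Rightarrow> (real^'n) \<times> (real^'m)"
  where "calibrated_immersion X fst P t nu (\<lambda>x. det (metric f x))"
proof -
  obtain t :: "real^'n \<Rightarrow> 'n \<Rightarrow> (real^'n) \<times> (real^'m)" and nu :: "real^'n \<Rightarrow> 'm \<Rightarrow> (real^'n) \<times> (real^'m)"
    where fr: "\<And>x. flat_frame_at x (t x) (nu x)"
    using flat_frame_exists[OF assms] by metis
  have "calibrated_immersion X fst P t nu (\<lambda>x. det (metric f x))"
    by unfold_locales
      (use fr[unfolded flat_frame_at_def] in blast, use fr[unfolded flat_frame_at_def] in blast,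
       use fr[unfolded flat_frame_at_def] in blast, use fr[unfolded flat_frame_at_def] in blast,
       use fr[unfolded flat_frame_at_def] in blast, use fr[unfolded flat_frame_at_def] in blast,
       rule smooth_det_metric, rule det_metric_pos, rule D_det_metric)
  then show ?thesis by (rule that)
qed

end

section \<open>From the interior estimate to an affine map\<close>

theorem theorem1p3:
  fixes f :: "real^'n \<Rightarrow> real^'m"
  assumes smooth: "smooth_on UNIV f"
    and minimal: "minimal_surface_system f"
    and flat: "flat_normal_bundle f"
    and slope: "(\<lambda>x. sqrt (det (mat 1 + transpose (jacobian f (at x)) ** jacobian f (at x))))
                  \<in> o[at_infinity](\<lambda>x. sqrt ((norm x)\<^sup>2 + (norm (f x))\<^sup>2))"
    and volume: "\<exists>c::real. \<forall>R>0. graph_volume f (graph_of f \<inter> ball 0 R) \<le> ennreal (c * R ^ CARD('n))"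
  shows "\<exists>(A::real^'n^'m) b. \<forall>x. f x = A *v x + b"
proof -
  interpret minimal_graph f by unfold_locales (rule smooth minimal)+
  obtain t :: "real^'n \<Rightarrow> 'n \<Rightarrow> (real^'n) \<times> (real^'m)" and nu :: "real^'n \<Rightarrow> 'm \<Rightarrow> (real^'n) \<times> (real^'m)"
    where "calibrated_immersion X fst P t nu (\<lambda>x. det (metric f x))"
    using calibrated[OF flat] .
  then interpret calibrated_immersion X fst P t nu "\<lambda>x. det (metric f x)" .
  let ?g = "\<lambda>x. det (metric f x)"
  have jac: "mat 1 + transpose (jacobian f (at x)) ** jacobian f (at x) = metric f x" for x
    by (simp add: vec_eq_iff metric_def partial_f matrix_matrix_mult_def transpose_def jacobian_def
        matrix_def mat_def dird_def)
  have nX: "norm (X x) = sqrt ((norm x)\<^sup>2 + (norm (f x))\<^sup>2)" for x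
    by (simp add: graph_map_def norm_Pair)
  \<comment> \<open>The interior estimate is applied on one large ball for each \<epsilon>.\<close>
  have small: "e x0 * ?g x0 \<le> 230 * real CARD('n) * \<epsilon>\<^sup>2" if \<epsilon>: "\<epsilon> > 0" for x0 \<epsilon>
  proof -
    have "eventually (\<lambda>x. norm (sqrt (?g x)) \<le> \<epsilon> * norm (norm (X x))) at_infinity"
      using landau_o.smallD[OF slope \<epsilon>] by (simp add: jac nX)
    then obtain b where b: "\<And>x. norm x \<ge> b \<Longrightarrow> sqrt (?g x) \<le> \<epsilon> * norm (X x)"
      unfolding eventually_at_infinity using det_metric_pos by (auto simp: less_imp_le)
    have gb: "?g x \<le> \<epsilon>\<^sup>2 * (norm (X x))\<^sup>2" if "norm x \<ge> b" for x
    proof -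
      have "(sqrt (?g x))\<^sup>2 \<le> (\<epsilon> * norm (X x))\<^sup>2"
        using b[OF that] det_metric_pos[of x] by (intro power_mono) (auto simp: less_imp_le)
      then show ?thesis using det_metric_pos[of x] by (simp add: power_mult_distrib less_imp_le)
    qed
    have "bounded (?g ` cball 0 b)"
      by (intro compact_imp_bounded compact_continuous_image compact_cball
          continuous_on_subset[OF smooth_continuous[OF smooth_det_metric]]) simp
    \<comment> \<open>\<open>M\<close> controls g on the compact part where the growth condition
      does not yet apply.\<close>
    then obtain M where M: "\<And>x. norm x \<le> b \<Longrightarrow> ?g x \<le> M" "M > 0"
      unfolding bounded_pos by (force simp: abs_le_iff)
    define c where "c = norm (X x0)"
    \<comment> \<open>The summands give R \<ge> 1, R + c \<le> 2R and M \<le> \<epsilon>^2 R \<le>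
      \<epsilon>^2 R^2. Hence W \<le> 2(1 + 4) \<epsilon>^2 R^2, and 23 times 10 is 230.\<close>
    define R where "R = 1 + c + M / \<epsilon>\<^sup>2"
    have R: "R \<ge> 1" "R \<ge> c" "R \<ge> M / \<epsilon>\<^sup>2" using M(2) \<epsilon> by (auto simp: R_def c_def)
    define W where "W = 2 * (M + \<epsilon>\<^sup>2 * (R + c)\<^sup>2)"
    have nb: "norm (X x) \<le> R + c" if "norm (X x - X x0) \<le> R" for x
      using norm_triangle_ineq[of "X x - X x0" "X x0"] that by (simp add: c_def)
    \<comment> \<open>The graph map is proper because \<open>x\<close> is the first component of
      \<open>X x\<close>.\<close>
    have "norm x \<le> R + c" if "norm (X x - X x0) \<le> R" for x
      using nb[OF that] norm_fst_le[of x "f x"] by (simp add: graph_map_def)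
    then have bd: "bounded {x. norm (X x - X x0) \<le> R}" by (auto simp: bounded_iff)
    have "?g x \<le> W / 2" if x: "norm (X x - X x0) \<le> R" for x
    proof (cases "norm x \<ge> b")
      case True
      have "(norm (X x))\<^sup>2 \<le> (R + c)\<^sup>2" using nb[OF x] by (intro power_mono) auto
      then have "\<epsilon>\<^sup>2 * (norm (X x))\<^sup>2 \<le> \<epsilon>\<^sup>2 * (R + c)\<^sup>2" by (intro mult_left_mono) auto
      then show ?thesis using gb[OF True] M(2) by (simp add: W_def)
    next
      case False
      then have "?g x \<le> M + \<epsilon>\<^sup>2 * (R + c)\<^sup>2" by (intro add_increasing2 M(1)) auto
      then show ?thesis by (simp add: W_def)
    qed
    then have "e x0 * ?g x0 \<le> 23 * real CARD('n) * W / R\<^sup>2"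
      using R by (intro interior_bound bd) auto
    also have "\<dots> \<le> 23 * real CARD('n) * (10 * \<epsilon>\<^sup>2 * R\<^sup>2) / R\<^sup>2"
    proof (intro divide_right_mono mult_left_mono)
      have "M \<le> \<epsilon>\<^sup>2 * R" using R(3) \<epsilon> by (simp add: field_simps)
      also have "\<dots> \<le> \<epsilon>\<^sup>2 * R\<^sup>2" using R(1) by (intro mult_left_mono) (auto simp: power2_eq_square)
      finally have 1: "M \<le> \<epsilon>\<^sup>2 * R\<^sup>2" .
      have "(R + c)\<^sup>2 \<le> (2 * R)\<^sup>2" using R by (intro power_mono) (auto simp: c_def)
      then have "\<epsilon>\<^sup>2 * (R + c)\<^sup>2 \<le> \<epsilon>\<^sup>2 * (2 * R)\<^sup>2" by (intro mult_left_mono) auto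
      then show "W \<le> 10 * \<epsilon>\<^sup>2 * R\<^sup>2" using 1 by (simp add: W_def power_mult_distrib)
    qed auto
    also have "\<dots> = 230 * real CARD('n) * \<epsilon>\<^sup>2" using R(1) by simp
    finally show ?thesis .
  qed
  have "e x0 = 0" for x0
  proof (rule ccontr)
    assume "e x0 \<noteq> 0"
    moreover have "e x0 \<ge> 0" by (simp add: e_def hs_def sum_nonneg)
    ultimately have p: "e x0 * ?g x0 > 0" using det_metric_pos[of x0] by simp
    \<comment> \<open>With 460 = 2 * 230 the estimate bounds a positive number by its half.\<close>
    define \<epsilon> where "\<epsilon> = sqrt (e x0 * ?g x0 / (460 * real CARD('n)))"
    have "\<epsilon> > 0" "\<epsilon>\<^sup>2 = e x0 * ?g x0 / (460 * real CARD('n))" using p by (simp_all add: \<epsilon>_def)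
    then have "e x0 * ?g x0 \<le> e x0 * ?g x0 / 2" using small[of \<epsilon> x0] by simp
    then show False using p by (simp add: mult.commute)
  qed
  note affine = affine_of_e_eq_0[OF this]
  have 1: "f x = f 0 + dird x f 0" for x
    using arg_cong[OF affine[of x], of snd] unfolding dird_X by (simp add: graph_map_def)
  have "linear (\<lambda>h. dird h f 0)" using dird_bounded_linear[OF smooth] by (rule bounded_linear.linear)
  then have m: "matrix (\<lambda>h. dird h f 0) *v x = dird x f 0" for x by (simp add: matrix_works)
  have "f x = matrix (\<lambda>h. dird h f 0) *v x + f 0" for x
    unfolding m using 1[of x] by (simp only: add.commute)
  then show ?thesis by blast
qed

end
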